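(* With $\overline W_n=\mathbb E_{\mathbb P_n^{\mathrm{gap}}}W_n(U)$, as $n\to\infty$, $$\mathbb E_{\mathbb P_n^{\mathrm{gap}}}\bigl|W_n-e^{-\zeta(2)}\bigr|=O\!\left(\sqrt{\frac{\log n}{n}}\right),\qquad \overline W_n\to e^{-\zeta(2)}.$$ Furthermore $$\frac{d\mathbb P_n^{\mathrm{ad}}}{d\mathbb P_n^{\mathrm{ref}}}=\frac{W_n}{\overline W_n},\qquad \|\mathbb P_n^{\mathrm{ad}}-\mathbb P_n^{\mathrm{ref}}\|_{\mathrm{TV}}=O\!\left(\sqrt{\frac{\log n}{n}}\right),$$ and for all sufficiently large $n$ the density $W_n/\overline W_n$ is pointwise bounded by $2e^{\zeta(2)}$.
   Context: Let $n\ge2$, $t_+=\max(t,0)$, $H_0=\{U\in\mathbb R^n:\sum_iU_i=0\}$ with reference measure $dU=dU_1\cdots dU_{n-1}$ (where $U_n=-\sum_{i<n}U_i$), $\operatorname{osc}U=\max_iU_i-\min_iU_i$. Put $\rho_n(t)=(1-t_+/n)_+$, and $\omega_n(t)=(1-t/n)^{-1}$ for $0\le t<n$, $\omega_n(t)=0$ otherwise. For $U\in H_0$ and $1\le i\le n$ put $$F_{i,U}(a)=\prod_{j\ne i}\rho_n(a+U_j),\quad \kappa_{i,U}(a)=\sum_{j\ne i}\omega_n(a+U_j),\quad Z_i(U)=\int_{-U_i}^{n-U_i}\kappa_{i,U}(a)F_{i,U}(a)\,da .$$ If $Z_i(U)>0$, $\nu_{i,U}(da)=Z_i(U)^{-1}\mathbf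 1_{[-U_i,n-U_i]}(a)\kappa_{i,U}(a)F_{i,U}(a)\,da$; if $Z_i(U)=0$, $\nu_{i,U}=\delta_{-U_i}$. Laws. On $H_0\times\mathbb R^n$, the adaptive law is $\mathbb P_n^{\mathrm{ad}}(dU,dA)=(Z_n^{\mathrm{ad}})^{-1}\prod_iZ_i(U)\,dU\bigotimes_i\nu_{i,U}(dA_i)$, with $Z_n^{\mathrm{ad}}$ the normalizing constant. The gap law on $H_0$ is $\mathbb P_n^{\mathrm{gap}}(dU)=(Z_n^{\mathrm{gap}})^{-1}\exp\{-\frac1n\sum_{i<j}|U_i-U_j|\}\,dU$, with $Z_n^{\mathrm{gap}}$ the normalizing constant. The reference law is $\mathbb P_n^{\mathrm{ref}}(dU,dA)=\mathbb P_n^{\mathrm{gap}}(dU)\bigotimes_i\nu_{i,U}(dA_i)$. Likelihood quantities. If $\operatorname{osc}U<n$ and $U$ has a unique maximizer $m$, put $q_n^{\mathrm{cap}}(U)=\prod_{j\ne m}\frac{U_m-U_j}{n}$; otherwise $q_n^{\mathrm{cap}}(U)=0$. Put $\mathcal R_n(U)=\sum_{i<j}\bigl[-\log(1-\frac{|U_i-U_j|}{n})-\frac{|U_i-U_j|}{n}\bigr]$, with the convention $e^{-\mathcal R_n(U)}=0$ when $\operatorname{osc}U\ge n$, and $W_n(U)=e^{-\mathcal R_n(U)}(1-q_n^{\mathrm{cap}}(U))$. Total variation is $\|P-Q\|_{\mathrm{TV}}=\sup_B|P(B)-Q(B)|$. *)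

theory Defs
  imports "HOL-Probability.Probability" "HOL-Library.Landau_Symbols"
begin

text \<open>Vectors of length \<open>n\<close> are extensional functions on \<open>{1..n}\<close>.\<close>

definition H0 :: "nat \<Rightarrow> (nat \<Rightarrow> real) set" where
  "H0 n = {U \<in> {1..n} \<rightarrow>\<^sub>E UNIV. (\<Sum>i\<in>{1..n}. U i) = 0}"

definition Rn_borel :: "nat \<Rightarrow> (nat \<Rightarrow> real) measure" where
  "Rn_borel n = PiM {1..n} (\<lambda>_. borel)"

text \<open>The measure \<open>dU\<^sub>1 \<dots> dU\<^bsub>n-1\<^esub>\<close> on \<open>H0 n\<close>: the image of Lebesgue measure under
  the parametrization by the first \<open>n - 1\<close> coordinates.\<close>

definition H0_measure :: "nat \<Rightarrow> (nat \<Rightarrow> real) measure" where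
  "H0_measure n = distr (PiM {1..<n} (\<lambda>_. lborel)) (restrict_space (Rn_borel n) (H0 n))
     (\<lambda>V. V(n := - (\<Sum>i\<in>{1..<n}. V i)))"

definition osc :: "nat \<Rightarrow> (nat \<Rightarrow> real) \<Rightarrow> real" where
  "osc n U = Max (U ` {1..n}) - Min (U ` {1..n})"

definition rho :: "nat \<Rightarrow> real \<Rightarrow> real" where
  "rho n t = max (1 - max t 0 / real n) 0"

definition omega :: "nat \<Rightarrow> real \<Rightarrow> real" where
  "omega n t = (if 0 \<le> t \<and> t < real n then 1 / (1 - t / real n) else 0)"

definition F :: "nat \<Rightarrow> nat \<Rightarrow> (nat \<Rightarrow> real) \<Rightarrow> real \<Rightarrow> real" where
  "F n i U a = (\<Prod>j\<in>{1..n} - {i}. rho n (a + U j))"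

definition kappa :: "nat \<Rightarrow> nat \<Rightarrow> (nat \<Rightarrow> real) \<Rightarrow> real \<Rightarrow> real" where
  "kappa n i U a = (\<Sum>j\<in>{1..n} - {i}. omega n (a + U j))"

definition Z :: "nat \<Rightarrow> nat \<Rightarrow> (nat \<Rightarrow> real) \<Rightarrow> real" where
  "Z n i U = (LINT a:{- U i..real n - U i}|lborel. kappa n i U a * F n i U a)"

definition nu :: "nat \<Rightarrow> nat \<Rightarrow> (nat \<Rightarrow> real) \<Rightarrow> real measure" where
  "nu n i U =
     (if Z n i U > 0
      then density lborel (\<lambda>a. ennreal
             (indicator {- U i..real n - U i} a * (kappa n i U a * F n i U a) / Z n i U))
      else return borel (- U i))"

text \<open>The joint law \<open>M(dU) \<Otimes>\<^sub>i \<nu>\<^bsub>i,U\<^esub>(dA\<^sub>i)\<close>.\<close>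

definition joint_law :: "nat \<Rightarrow> (nat \<Rightarrow> real) measure \<Rightarrow> ((nat \<Rightarrow> real) \<times> (nat \<Rightarrow> real)) measure" where
  "joint_law n M =
     bind M (\<lambda>U. distr (PiM {1..n} (\<lambda>i. nu n i U)) (M \<Otimes>\<^sub>M Rn_borel n) (\<lambda>A. (U, A)))"

definition Z_ad :: "nat \<Rightarrow> real" where
  "Z_ad n = (\<integral>U. (\<Prod>i\<in>{1..n}. Z n i U) \<partial>H0_measure n)"

definition P_ad :: "nat \<Rightarrow> ((nat \<Rightarrow> real) \<times> (nat \<Rightarrow> real)) measure" where
  "P_ad n = joint_law n
     (density (H0_measure n) (\<lambda>U. ennreal ((\<Prod>i\<in>{1..n}. Z n i U) / Z_ad n)))"

definition gap_weight :: "nat \<Rightarrow> (nat \<Rightarrow> real) \<Rightarrow> real" where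
  "gap_weight n U = exp (- (1 / real n) * (\<Sum>i\<in>{1..n}. \<Sum>j\<in>{i<..n}. \<bar>U i - U j\<bar>))"

definition Z_gap :: "nat \<Rightarrow> real" where
  "Z_gap n = (\<integral>U. gap_weight n U \<partial>H0_measure n)"

definition P_gap :: "nat \<Rightarrow> (nat \<Rightarrow> real) measure" where
  "P_gap n = density (H0_measure n) (\<lambda>U. ennreal (gap_weight n U / Z_gap n))"

definition P_ref :: "nat \<Rightarrow> ((nat \<Rightarrow> real) \<times> (nat \<Rightarrow> real)) measure" where
  "P_ref n = joint_law n (P_gap n)"

definition is_maximizer :: "nat \<Rightarrow> (nat \<Rightarrow> real) \<Rightarrow> nat \<Rightarrow> bool" where
  "is_maximizer n U m \<longleftrightarrow> m \<in> {1..n} \<and> (\<forall>j\<in>{1..n}. U j \<le> U m)"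

definition q_cap :: "nat \<Rightarrow> (nat \<Rightarrow> real) \<Rightarrow> real" where
  "q_cap n U =
     (if osc n U < real n \<and> (\<exists>!m. is_maximizer n U m)
      then let m = (THE m. is_maximizer n U m) in \<Prod>j\<in>{1..n} - {m}. (U m - U j) / real n
      else 0)"

definition R :: "nat \<Rightarrow> (nat \<Rightarrow> real) \<Rightarrow> real" where
  "R n U = (\<Sum>i\<in>{1..n}. \<Sum>j\<in>{i<..n}.
     - ln (1 - \<bar>U i - U j\<bar> / real n) - \<bar>U i - U j\<bar> / real n)"

text \<open>The logarithms in \<open>R n U\<close> are meaningful only for \<open>osc n U < n\<close>;
  otherwise \<open>exp (- R n U)\<close> is read as \<open>0\<close>.\<close>

definition exp_neg_R :: "nat \<Rightarrow> (nat \<Rightarrow> real) \<Rightarrow> real" where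
  "exp_neg_R n U = (if osc n U < real n then exp (- R n U) else 0)"

definition W :: "nat \<Rightarrow> (nat \<Rightarrow> real) \<Rightarrow> real" where
  "W n U = exp_neg_R n U * (1 - q_cap n U)"

definition W_bar :: "nat \<Rightarrow> real" where
  "W_bar n = (\<integral>U. W n U \<partial>P_gap n)"

definition zeta :: "real \<Rightarrow> real" where
  "zeta s = (\<Sum>k. 1 / real (Suc k) powr s)"

text \<open>Meant for finite measures on the same \<open>\<sigma>\<close>-algebra.\<close>

definition tv_dist :: "'a measure \<Rightarrow> 'a measure \<Rightarrow> real" where
  "tv_dist P Q = (SUP B\<in>sets P. \<bar>measure P B - measure Q B\<bar>)"

end

theory Submission
  imports Defs
begin

text \<open>
Two facts carry the theorem.

The first is an exact identity.  Off the kinks, \<open>kappa n i U * F n i U\<close> is the derivative of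
\<open>- n * F n i U\<close>, so \<open>Z n i U\<close> is \<open>n\<close> times the difference of two boundary values of \<open>F\<close>.  The right
one vanishes unless \<open>i\<close> is the unique maximizer.  Multiplying over \<open>i\<close> gives
\<open>(\<Prod>i. Z n i U) = n ^ n * (gap_weight n U * W n U)\<close> (lemma \<open>prod_Z\<close>).  Hence the \<open>U\<close>-marginals of
the adaptive and of the reference law differ by the density \<open>W / W_bar\<close>.  Both joint laws attach the
same kernel to their marginals, so this is also the density of the joint laws, and the total
variation distance is controlled by the mean deviation of \<open>W\<close> from a constant
(\<open>P_ad_density\<close>, \<open>tv_dist_P_ad_P_ref_le\<close>).

The second is the concentration of \<open>W\<close> at \<open>exp (- zeta 2)\<close> under the gap law.  Gap \<open>k\<close> of the sorted
vector separates \<open>k * (n - k)\<close> pairs, so the exponent of the gap weight is linear in the gaps, and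
the gaps are independent exponential variables with rates \<open>k * (n - k) / n\<close> (\<open>nn_integral_P_gap\<close>).
Replacing \<open>R\<close> in \<open>exp (- R)\<close> by its second-order term, the spread
\<open>\<Sum>i<j. (U i - U j)^2 / (2 * n^2)\<close>, and dropping \<open>q_cap\<close> both cost at most a multiple of \<open>osc n U / n\<close> (\<open>W_deviation_le\<close>), whose mean is \<open>2 * H(n-1) / n\<close>
for the harmonic number \<open>H(n-1)\<close>.  The spread is a quadratic form in standard exponential variables
with coefficients \<open>b k l / 2\<close>, where \<open>b k l = 1 / (max k l * (n - min k l))\<close>.  Its mean is exactly
\<open>\<Sum>k<n. 1 / k^2\<close>, within \<open>1 / (n - 1)\<close> of \<open>zeta 2\<close>.  Its variance is at most a constant times the
largest row sum of \<open>b\<close>, which is at most \<open>2 * H(n-1) / n\<close> (\<open>variance_spread_le\<close>).  The square root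
of this variance dominates the other errors and gives the rate \<open>sqrt (ln n / n)\<close>.
\<close>

section \<open>Lebesgue measure on finite products\<close>

interpretation lebesgue_product: product_sigma_finite "\<lambda>_::nat. lborel :: real measure"
  by standard

abbreviation lebesgue_Pi :: "nat set \<Rightarrow> (nat \<Rightarrow> real) measure" where
  "lebesgue_Pi I \<equiv> PiM I (\<lambda>_. lborel)"

text \<open>On each line parallel to the \<open>i\<close>-th axis this substitution is a translation, because \<open>c\<close> is
constant there.  Apart from permutations of the coordinates, translations and compositions of shears
are the only changes of variables below, so no determinant is ever computed.\<close>

lemma nn_integral_shear:
  fixes c :: "(nat \<Rightarrow> real) \<Rightarrow> real"
  assumes "finite I" "i \<in> I"
    and [measurable]: "f \<in> borel_measurable (lebesgue_Pi I)" "c \<in> borel_measurable (lebesgue_Pi I)"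
    and c: "\<And>x y. c (x(i := y)) = c x"
  shows "(\<integral>\<^sup>+x. f (x(i := x i + c x)) \<partial>lebesgue_Pi I) = (\<integral>\<^sup>+x. f x \<partial>lebesgue_Pi I)"
proof -
  define J where "J = I - {i}"
  have J: "finite J" "i \<notin> J" "I = insert i J"
    using assms(1,2) by (auto simp: J_def)
  have [measurable]: "(\<lambda>x. x(i := x i + c x)) \<in> measurable (lebesgue_Pi I) (lebesgue_Pi I)"
    using assms(2) by (intro measurable_fun_upd[where J = I]) auto
  have "(\<integral>\<^sup>+x. f (x(i := x i + c x)) \<partial>lebesgue_Pi I)
      = (\<integral>\<^sup>+x. (\<integral>\<^sup>+y. f (x(i := y + c x)) \<partial>lborel) \<partial>lebesgue_Pi J)"
    unfolding J(3) using J
    by (subst lebesgue_product.product_nn_integral_insert) (auto simp: c simp flip: J(3))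
  also have "\<dots> = (\<integral>\<^sup>+x. (\<integral>\<^sup>+y. f (x(i := y)) \<partial>lborel) \<partial>lebesgue_Pi J)"
  proof (rule nn_integral_cong)
    fix x assume x: "x \<in> space (lebesgue_Pi J)"
    have "(\<lambda>y. x(i := y)) \<in> measurable lborel (lebesgue_Pi I)"
      using x by (intro measurable_fun_upd[where J = J]) (auto simp: J)
    then have "(\<lambda>y. f (x(i := y))) \<in> borel_measurable lborel"
      by measurable
    then show "(\<integral>\<^sup>+y. f (x(i := y + c x)) \<partial>lborel) = (\<integral>\<^sup>+y. f (x(i := y)) \<partial>lborel)"
      by (subst (2) nn_integral_real_affine[where c = 1 and t = "c x"]) (auto simp: add.commute)
  qed
  also have "\<dots> = (\<integral>\<^sup>+x. f x \<partial>lebesgue_Pi I)"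
    unfolding J(3) using J
    by (subst lebesgue_product.product_nn_integral_insert) (auto simp flip: J(3))
  finally show ?thesis .
qed

lemma nn_integral_translate:
  fixes c :: real
  assumes "finite I" and [measurable]: "f \<in> borel_measurable (lebesgue_Pi I)"
  shows "(\<integral>\<^sup>+x. f (\<lambda>i\<in>I. x i + c) \<partial>lebesgue_Pi I) = (\<integral>\<^sup>+x. f x \<partial>lebesgue_Pi I)"
proof -
  have [measurable]: "(\<lambda>x. \<lambda>i\<in>I. x i + c) \<in> measurable (lebesgue_Pi I) (lebesgue_Pi I)"
    by (intro measurable_restrict) simp
  have "distr (lebesgue_Pi I) (lebesgue_Pi I) (\<lambda>x. \<lambda>i\<in>I. x i + c) = lebesgue_Pi I"
  proof (rule lebesgue_product.PiM_eqI)
    fix A :: "nat \<Rightarrow> real set" assume A: "\<And>i. i \<in> I \<Longrightarrow> A i \<in> sets lborel"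
    have A': "(\<lambda>y. y + c) -` A i \<in> sets lborel" if "i \<in> I" for i
      using measurable_sets[of "\<lambda>y. y + c" lborel borel "A i"] A[OF that] by simp
    have "emeasure (distr (lebesgue_Pi I) (lebesgue_Pi I) (\<lambda>x. \<lambda>i\<in>I. x i + c)) (Pi\<^sub>E I A)
        = emeasure (lebesgue_Pi I) ((\<lambda>x. \<lambda>i\<in>I. x i + c) -` Pi\<^sub>E I A \<inter> space (lebesgue_Pi I))"
      using A assms(1) by (intro emeasure_distr) (auto intro!: sets_PiM_I_finite)
    also have "(\<lambda>x. \<lambda>i\<in>I. x i + c) -` Pi\<^sub>E I A \<inter> space (lebesgue_Pi I) = (\<Pi>\<^sub>E i\<in>I. (\<lambda>y. y + c) -` A i)"
      by (auto simp: space_PiM PiE_iff)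
    also have "emeasure (lebesgue_Pi I) \<dots> = (\<Prod>i\<in>I. emeasure lborel ((\<lambda>y. y + c) -` A i))"
      using A' assms(1) by (intro lebesgue_product.emeasure_PiM) auto
    also have "\<dots> = (\<Prod>i\<in>I. emeasure lborel (A i))"
    proof (rule prod.cong[OF refl])
      fix i assume i: "i \<in> I"
      have "emeasure (distr lborel borel ((+) c)) (A i) = emeasure lborel (((+) c) -` A i)"
        using A[OF i] by (subst emeasure_distr) auto
      then show "emeasure lborel ((\<lambda>y. y + c) -` A i) = emeasure lborel (A i)"
        by (simp add: lborel_distr_plus add.commute[of _ c])
    qed
    finally show "emeasure (distr (lebesgue_Pi I) (lebesgue_Pi I) (\<lambda>x. \<lambda>i\<in>I. x i + c)) (Pi\<^sub>E I A)
        = (\<Prod>i\<in>I. emeasure lborel (A i))" .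
  qed (use assms in auto)
  then have "(\<integral>\<^sup>+x. f x \<partial>lebesgue_Pi I)
      = (\<integral>\<^sup>+x. f x \<partial>distr (lebesgue_Pi I) (lebesgue_Pi I) (\<lambda>x. \<lambda>i\<in>I. x i + c))"
    by simp
  also have "\<dots> = (\<integral>\<^sup>+x. f (\<lambda>i\<in>I. x i + c) \<partial>lebesgue_Pi I)"
    by (subst nn_integral_distr) auto
  finally show ?thesis by simp
qed

lemma nn_integral_permute_coordinates:
  assumes "finite I" "\<sigma> permutes I" and [measurable]: "f \<in> borel_measurable (lebesgue_Pi I)"
  shows "(\<integral>\<^sup>+x. f (\<lambda>i\<in>I. x (\<sigma> i)) \<partial>lebesgue_Pi I) = (\<integral>\<^sup>+x. f x \<partial>lebesgue_Pi I)"
proof -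
  have \<sigma>: "\<sigma> i \<in> I" if "i \<in> I" for i
    using assms(2) that by (simp add: permutes_in_image)
  have [measurable]: "(\<lambda>x. \<lambda>i\<in>I. x (\<sigma> i)) \<in> measurable (lebesgue_Pi I) (lebesgue_Pi I)"
    using \<sigma> by (intro measurable_restrict measurable_component_singleton)
  have "distr (lebesgue_Pi I) (lebesgue_Pi I) (\<lambda>x. \<lambda>i\<in>I. x (\<sigma> i)) = lebesgue_Pi I"
  proof (rule lebesgue_product.PiM_eqI)
    fix A :: "nat \<Rightarrow> real set" assume A: "\<And>i. i \<in> I \<Longrightarrow> A i \<in> sets lborel"
    have "emeasure (distr (lebesgue_Pi I) (lebesgue_Pi I) (\<lambda>x. \<lambda>i\<in>I. x (\<sigma> i))) (Pi\<^sub>E I A)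
        = emeasure (lebesgue_Pi I) ((\<lambda>x. \<lambda>i\<in>I. x (\<sigma> i)) -` Pi\<^sub>E I A \<inter> space (lebesgue_Pi I))"
      using A assms(1) by (intro emeasure_distr) (auto intro!: sets_PiM_I_finite)
    also have "(\<lambda>x. \<lambda>i\<in>I. x (\<sigma> i)) -` Pi\<^sub>E I A \<inter> space (lebesgue_Pi I) = (\<Pi>\<^sub>E i\<in>I. A (inv \<sigma> i))"
      using assms(2) \<sigma>
      by (auto simp: space_PiM PiE_iff permutes_inverses permutes_in_image[OF permutes_inv])
         (metis permutes_def permutes_inv permutes_inverses)+
    also have "emeasure (lebesgue_Pi I) \<dots> = (\<Prod>i\<in>I. emeasure lborel (A (inv \<sigma> i)))"
      using A assms(1) permutes_in_image[OF permutes_inv[OF assms(2)]]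
      by (intro lebesgue_product.emeasure_PiM) auto
    also have "\<dots> = (\<Prod>i\<in>I. emeasure lborel (A i))"
      using permutes_inv[OF assms(2)] by (intro prod.permute[symmetric, unfolded o_def])
    finally show "emeasure (distr (lebesgue_Pi I) (lebesgue_Pi I) (\<lambda>x. \<lambda>i\<in>I. x (\<sigma> i))) (Pi\<^sub>E I A)
        = (\<Prod>i\<in>I. emeasure lborel (A i))" .
  qed (use assms in auto)
  then have "(\<integral>\<^sup>+x. f x \<partial>lebesgue_Pi I)
      = (\<integral>\<^sup>+x. f x \<partial>distr (lebesgue_Pi I) (lebesgue_Pi I) (\<lambda>x. \<lambda>i\<in>I. x (\<sigma> i)))"
    by simp
  also have "\<dots> = (\<integral>\<^sup>+x. f (\<lambda>i\<in>I. x (\<sigma> i)) \<partial>lebesgue_Pi I)"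
    by (subst nn_integral_distr) auto
  finally show ?thesis by simp
qed

text \<open>A tie \<open>x i = x j\<close> is met in a single point by each line parallel to the \<open>i\<close>-th axis.\<close>

lemma AE_distinct_coordinates:
  assumes "finite I"
  shows "AE x in lebesgue_Pi I. inj_on x I"
proof -
  have "AE x in lebesgue_Pi I. x i \<noteq> x j" if ij: "i \<in> I" "j \<in> I" "i \<noteq> j" for i j
  proof -
    define J where "J = I - {i}"
    have J: "finite J" "i \<notin> J" "I = insert i J" "j \<in> J"
      using assms ij by (auto simp: J_def)
    have m[measurable]: "{x \<in> space (lebesgue_Pi I). x i = x j} \<in> sets (lebesgue_Pi I)"
      using ij by measurable
    have "emeasure (lebesgue_Pi I) {x \<in> space (lebesgue_Pi I). x i = x j}
        = (\<integral>\<^sup>+x. indicator {x \<in> space (lebesgue_Pi I). x i = x j} x \<partial>lebesgue_Pi I)"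
      using m by simp
    also have "\<dots> = (\<integral>\<^sup>+x. (\<integral>\<^sup>+y. indicator {x \<in> space (lebesgue_Pi I). x i = x j} (x(i := y)) \<partial>lborel)
        \<partial>lebesgue_Pi J)"
      unfolding J(3) using J m
      by (subst lebesgue_product.product_nn_integral_insert) (auto simp flip: J(3))
    also have "\<dots> \<le> (\<integral>\<^sup>+x. (\<integral>\<^sup>+y. indicator {x j} y \<partial>lborel) \<partial>lebesgue_Pi J)"
      using ij by (intro nn_integral_mono) (auto split: split_indicator)
    also have "\<dots> = 0" by simp
    finally have "{x \<in> space (lebesgue_Pi I). x i = x j} \<in> null_sets (lebesgue_Pi I)"
      using m by (intro null_setsI) auto
    then show ?thesis
      by (rule AE_I') auto
  qed
  then have "AE x in lebesgue_Pi I. \<forall>i\<in>I. \<forall>j\<in>I. i \<noteq> j \<longrightarrow> x i \<noteq> x j"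
    using assms by (intro AE_finite_allI) auto
  then show ?thesis
    by eventually_elim (auto simp: inj_on_def)
qed

section \<open>Symmetric integrals over the hyperplane in terms of gaps\<close>

lemma coordinate_measurable:
  "i \<in> I \<Longrightarrow> (\<lambda>x. x i) \<in> borel_measurable (lebesgue_Pi I)"
  using measurable_component_singleton[of i I "\<lambda>_. lborel"] by simp

lemma slab_measurable:
  fixes h :: "(nat \<Rightarrow> real) \<Rightarrow> ennreal"
  assumes [measurable]: "h \<in> borel_measurable (lebesgue_Pi I)"
  shows "(\<lambda>x. h x * indicator {0..1} (\<Sum>i\<in>I. x i)) \<in> borel_measurable (lebesgue_Pi I)"
proof -
  have [measurable]: "(\<lambda>x. \<Sum>i\<in>I. x i) \<in> borel_measurable (lebesgue_Pi I)"
    by (intro borel_measurable_sum coordinate_measurable)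
  show ?thesis by measurable
qed

definition decreasing_vectors :: "nat \<Rightarrow> (nat \<Rightarrow> real) set" where
  "decreasing_vectors n = {x. \<forall>i\<in>{1..n}. \<forall>j\<in>{1..n}. i \<le> j \<longrightarrow> x j \<le> x i}"

text \<open>The sorting permutation is the inverse of the rank function, where the rank of \<open>i\<close> is the number
of entries that are at least \<open>x i\<close>.\<close>

lemma unique_sorting_permutation:
  assumes inj: "inj_on x {1..n}"
  shows "\<exists>!\<sigma>. \<sigma> permutes {1..n} \<and> (\<lambda>i\<in>{1..n}. x (\<sigma> i)) \<in> decreasing_vectors n"
proof -
  define r where "r i = (if i \<in> {1..n} then card {j\<in>{1..n}. x i \<le> x j} else i)" for i
  have r_less: "r i < r j" if "i \<in> {1..n}" "j \<in> {1..n}" "x j < x i" for i j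
  proof -
    have "{k\<in>{1..n}. x i \<le> x k} \<subset> {k\<in>{1..n}. x j \<le> x k}"
      using that by (intro psubsetI) (auto dest: order.strict_trans2)
    then have "card {k\<in>{1..n}. x i \<le> x k} < card {k\<in>{1..n}. x j \<le> x k}"
      by (intro psubset_card_mono) auto
    then show ?thesis using that by (simp add: r_def)
  qed
  have r_range: "r i \<in> {1..n}" if "i \<in> {1..n}" for i
  proof -
    have "card {j\<in>{1..n}. x i \<le> x j} \<le> card {1..n}" by (intro card_mono) auto
    moreover have "card {j\<in>{1..n}. x i \<le> x j} > 0" using that by (auto simp: card_gt_0_iff)
    ultimately show ?thesis using that by (simp add: r_def)
  qed
  have r_inj: "inj_on r {1..n}"
  proof (rule inj_onI)
    fix i j assume ij: "i \<in> {1..n}" "j \<in> {1..n}" "r i = r j"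
    then have "x i = x j"
      using r_less[of i j] r_less[of j i] by (metis less_irrefl not_less_iff_gr_or_eq)
    then show "i = j" using inj ij by (auto dest: inj_onD)
  qed
  have "r ` {1..n} = {1..n}"
    using r_inj r_range by (intro endo_inj_surj) auto
  then have "bij_betw r {1..n} {1..n}" using r_inj by (simp add: bij_betw_def)
  then have r: "r permutes {1..n}"
    by (rule bij_imp_permutes) (auto simp: r_def)
  show ?thesis
  proof (rule ex1I[of _ "inv r"], intro conjI)
    show inv: "inv r permutes {1..n}" using r by (rule permutes_inv)
    show "(\<lambda>i\<in>{1..n}. x (inv r i)) \<in> decreasing_vectors n"
    proof (clarsimp simp: decreasing_vectors_def)
      fix i j assume ij: "Suc 0 \<le> i" "j \<le> n" "i \<le> j"
      then have "inv r i \<in> {1..n}" "inv r j \<in> {1..n}"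
        using permutes_in_image[OF inv] by auto
      moreover have "r (inv r i) = i" "r (inv r j) = j" using permutes_inverses(1)[OF r] by auto
      ultimately show "x (inv r j) \<le> x (inv r i)"
        using r_less[of "inv r j" "inv r i"] ij by (metis leD leI)
    qed
  next
    fix \<sigma> assume \<sigma>: "\<sigma> permutes {1..n} \<and> (\<lambda>i\<in>{1..n}. x (\<sigma> i)) \<in> decreasing_vectors n"
    have r\<sigma>: "r (\<sigma> i) = i" for i
    proof (cases "i \<in> {1..n}")
      case True
      then have \<sigma>i: "\<sigma> i \<in> {1..n}" using \<sigma> permutes_in_image[of \<sigma>] by blast
      have "{j\<in>{1..n}. x (\<sigma> i) \<le> x j} = \<sigma> ` {1..i}"
      proof (intro equalityI subsetI)
        fix j assume j: "j \<in> {j\<in>{1..n}. x (\<sigma> i) \<le> x j}"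
        then have j': "j \<in> {1..n}" "x (\<sigma> i) \<le> x j" by auto
        moreover have "\<sigma> ` {1..n} = {1..n}" using \<sigma> permutes_image by blast
        ultimately obtain k where k: "k \<in> {1..n}" "j = \<sigma> k" by blast
        have "k \<le> i"
        proof (rule ccontr)
          assume "\<not> k \<le> i"
          then have "x (\<sigma> k) \<le> x (\<sigma> i)"
            using \<sigma> k True by (auto simp: decreasing_vectors_def)
          then have "x (\<sigma> k) = x (\<sigma> i)" using j' k by auto
          then have "\<sigma> k = \<sigma> i" using inj \<sigma>i j' k by (auto dest: inj_onD)
          then have "k = i" using \<sigma> permutes_inj[of \<sigma>] by (auto dest: injD)
          with \<open>\<not> k \<le> i\<close> show False by simp
        qed
        then show "j \<in> \<sigma> ` {1..i}" using k by auto
      next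
        fix j assume "j \<in> \<sigma> ` {1..i}"
        then obtain k where k: "1 \<le> k" "k \<le> i" "j = \<sigma> k" by auto
        then have "k \<in> {1..n}" using True by auto
        then have "\<sigma> k \<in> {1..n}" using \<sigma> permutes_in_image[of \<sigma>] by blast
        then show "j \<in> {j\<in>{1..n}. x (\<sigma> i) \<le> x j}"
          using k \<sigma> True by (auto simp: decreasing_vectors_def)
      qed
      then have "r (\<sigma> i) = card (\<sigma> ` {1..i})" using \<sigma>i by (simp add: r_def)
      also have "\<dots> = i" using \<sigma> permutes_inj_on[of \<sigma>] by (subst card_image) auto
      finally show ?thesis .
    next
      case False
      then show ?thesis using \<sigma> r by (simp add: permutes_def)
    qed
    have "\<sigma> i = inv r i" for i
      using permutes_inverses(2)[OF r, of "\<sigma> i"] r\<sigma>[of i] by simp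
    then show "\<sigma> = inv r" by (rule ext)
  qed
qed

lemma decreasing_vectors_measurable [measurable]:
  "decreasing_vectors n \<inter> space (lebesgue_Pi {1..n}) \<in> sets (lebesgue_Pi {1..n})"
proof -
  have "{x \<in> space (lebesgue_Pi {1..n}). \<forall>i\<in>{1..n}. \<forall>j\<in>{1..n}. i \<le> j \<longrightarrow> x j \<le> x i}
      \<in> sets (lebesgue_Pi {1..n})"
    by (intro sets.sets_Collect_finite_All sets.sets_Collect_imp sets.sets_Collect_const
          borel_measurable_le coordinate_measurable finite_atLeastAtMost)
  also have "{x \<in> space (lebesgue_Pi {1..n}). \<forall>i\<in>{1..n}. \<forall>j\<in>{1..n}. i \<le> j \<longrightarrow> x j \<le> x i}
      = decreasing_vectors n \<inter> space (lebesgue_Pi {1..n})"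
    by (auto simp: decreasing_vectors_def)
  finally show ?thesis .
qed

lemma indicator_decreasing_measurable [measurable]:
  "indicator (decreasing_vectors n) \<in> borel_measurable (lebesgue_Pi {1..n})"
proof -
  have "indicator (decreasing_vectors n \<inter> space (lebesgue_Pi {1..n})) \<in> borel_measurable (lebesgue_Pi {1..n})"
    by measurable
  then show ?thesis
    by (rule measurable_cong[THEN iffD1, rotated]) (auto simp: indicator_def)
qed

text \<open>Away from ties the space splits into \<open>n!\<close> chambers, one for each sorting permutation.
Permuting coordinates carries each chamber to the decreasing one and leaves \<open>h\<close> unchanged.\<close>

lemma nn_integral_symmetric:
  fixes h :: "(nat \<Rightarrow> real) \<Rightarrow> ennreal"
  assumes h[measurable]: "h \<in> borel_measurable (lebesgue_Pi {1..n})"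
    and sym: "\<And>x \<sigma>. \<sigma> permutes {1..n} \<Longrightarrow> h (\<lambda>i\<in>{1..n}. x (\<sigma> i)) = h x"
  shows "(\<integral>\<^sup>+x. h x \<partial>lebesgue_Pi {1..n})
    = fact n * (\<integral>\<^sup>+x. h x * indicator (decreasing_vectors n) x \<partial>lebesgue_Pi {1..n})"
proof -
  let ?L = "lebesgue_Pi {1..n}"
  let ?D = "indicator (decreasing_vectors n) :: _ \<Rightarrow> ennreal"
  let ?P = "{\<sigma>. \<sigma> permutes {1..n}}"
  have fin: "finite ?P" by (rule finite_permutations) simp
  have m: "(\<lambda>x. \<lambda>i\<in>{1..n}. x (\<sigma> i)) \<in> measurable ?L ?L" if "\<sigma> \<in> ?P" for \<sigma>
    using that permutes_in_image[of \<sigma> "{1..n}"]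
    by (intro measurable_restrict measurable_component_singleton) blast
  have one: "AE x in ?L. (\<Sum>\<sigma>\<in>?P. ?D (\<lambda>i\<in>{1..n}. x (\<sigma> i))) = 1"
    using AE_distinct_coordinates[OF finite_atLeastAtMost]
  proof (rule AE_mp, intro AE_I2 impI)
    fix x :: "nat \<Rightarrow> real" assume "inj_on x {1..n}"
    from unique_sorting_permutation[OF this] obtain \<tau> where
      perm: "\<tau> permutes {1..n} \<and> (\<lambda>i\<in>{1..n}. x (\<tau> i)) \<in> decreasing_vectors n" and
      uniq: "\<forall>\<sigma>. \<sigma> permutes {1..n} \<and> (\<lambda>i\<in>{1..n}. x (\<sigma> i)) \<in> decreasing_vectors n \<longrightarrow> \<sigma> = \<tau>"
      by (rule ex1E)
    have \<tau>: "\<tau> \<in> ?P" "\<And>\<sigma>. \<sigma> \<in> ?P \<Longrightarrow> (\<lambda>i\<in>{1..n}. x (\<sigma> i)) \<in> decreasing_vectors n \<longleftrightarrow> \<sigma> = \<tau>"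
      using perm uniq by blast+
    have "(\<Sum>\<sigma>\<in>?P. ?D (\<lambda>i\<in>{1..n}. x (\<sigma> i))) = (\<Sum>\<sigma>\<in>?P. if \<sigma> = \<tau> then 1 else 0)"
      by (intro sum.cong refl) (simp only: indicator_def of_bool_def \<tau>(2))
    also have "\<dots> = 1" using \<tau>(1) fin by (simp add: sum.delta)
    finally show "(\<Sum>\<sigma>\<in>?P. ?D (\<lambda>i\<in>{1..n}. x (\<sigma> i))) = 1" .
  qed
  have "(\<integral>\<^sup>+x. h x \<partial>?L) = (\<integral>\<^sup>+x. (\<Sum>\<sigma>\<in>?P. h x * ?D (\<lambda>i\<in>{1..n}. x (\<sigma> i))) \<partial>?L)"
    using one by (intro nn_integral_cong_AE) (auto simp flip: sum_distrib_left)
  also have "\<dots> = (\<Sum>\<sigma>\<in>?P. \<integral>\<^sup>+x. h x * ?D (\<lambda>i\<in>{1..n}. x (\<sigma> i)) \<partial>?L)"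
  proof (rule nn_integral_sum)
    fix \<sigma> assume "\<sigma> \<in> ?P"
    then have [measurable]: "(\<lambda>x. \<lambda>i\<in>{1..n}. x (\<sigma> i)) \<in> measurable ?L ?L" by (rule m)
    show "(\<lambda>x. h x * ?D (\<lambda>i\<in>{1..n}. x (\<sigma> i))) \<in> borel_measurable ?L" by measurable
  qed
  also have "\<dots> = (\<Sum>\<sigma>\<in>?P. \<integral>\<^sup>+x. h x * ?D x \<partial>?L)"
  proof (rule sum.cong[OF refl])
    fix \<sigma> assume \<sigma>: "\<sigma> \<in> ?P"
    then have h\<sigma>: "h x = h (\<lambda>i\<in>{1..n}. x (\<sigma> i))" for x
      using sym[of \<sigma> x] by (simp only: mem_Collect_eq)
    have "(\<integral>\<^sup>+x. h x * ?D (\<lambda>i\<in>{1..n}. x (\<sigma> i)) \<partial>?L)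
        = (\<integral>\<^sup>+x. h (\<lambda>i\<in>{1..n}. x (\<sigma> i)) * ?D (\<lambda>i\<in>{1..n}. x (\<sigma> i)) \<partial>?L)"
      by (intro nn_integral_cong arg_cong2[where f = "(*)"] h\<sigma> refl)
    also have "\<dots> = (\<integral>\<^sup>+x. h x * ?D x \<partial>?L)"
      using \<sigma> by (intro nn_integral_permute_coordinates[where f = "\<lambda>x. h x * ?D x"]) (auto simp del: One_nat_def)
    finally show "(\<integral>\<^sup>+x. h x * ?D (\<lambda>i\<in>{1..n}. x (\<sigma> i)) \<partial>?L) = (\<integral>\<^sup>+x. h x * ?D x \<partial>?L)" .
  qed
  also have "\<dots> = fact n * (\<integral>\<^sup>+x. h x * ?D x \<partial>?L)"
    by (simp add: card_permutations)
  finally show ?thesis .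
qed

text \<open>Taking tail sums is a composition of shears: \<open>T m\<close> below sums only the coordinates from \<open>m\<close> on,
and it arises from \<open>T (m + 1)\<close> by adding coordinate \<open>m + 1\<close> to coordinate \<open>m\<close>.\<close>

lemma nn_integral_tail_sums:
  fixes f :: "(nat \<Rightarrow> real) \<Rightarrow> ennreal"
  assumes f: "f \<in> borel_measurable (lebesgue_Pi {1..n})" and "n \<ge> 1"
  shows "(\<integral>\<^sup>+x. f x \<partial>lebesgue_Pi {1..n})
    = (\<integral>\<^sup>+y. f (\<lambda>i\<in>{1..n}. \<Sum>k\<in>{i..n}. y k) \<partial>lebesgue_Pi {1..n})"
proof -
  let ?L = "lebesgue_Pi {1..n}"
  define T where "T m y = (\<lambda>i\<in>{1..n}. if m \<le> i then \<Sum>k\<in>{i..n}. y k else y i)"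
    for m and y :: "nat \<Rightarrow> real"
  have "(\<integral>\<^sup>+y. f (T m y) \<partial>?L) = (\<integral>\<^sup>+x. f x \<partial>?L)"
    if "m \<le> n" "1 \<le> m" "f \<in> borel_measurable ?L" for m and f :: "(nat \<Rightarrow> real) \<Rightarrow> ennreal"
    using that
  proof (induction arbitrary: f rule: inc_induct)
    case base
    have "T n y = y" if "y \<in> space ?L" for y
      using that by (auto simp: T_def space_PiM PiE_def extensional_def fun_eq_iff dest: antisym)
    then show ?case by (intro nn_integral_cong) simp
  next
    case (step m)
    note [measurable] = step.prems(2)
    have m: "m \<in> {1..n}" "Suc m \<in> {1..n}" using step by auto
    have [measurable]: "(\<lambda>x. x(m := x m + x (Suc m))) \<in> measurable ?L ?L"
      using m by (intro measurable_fun_upd[where J = "{1..n}"]) auto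
    have "T m y = (T (Suc m) y)(m := T (Suc m) y m + T (Suc m) y (Suc m))" for y
      using m by (auto simp: T_def fun_eq_iff sum.atLeast_Suc_atMost)
    then have "(\<integral>\<^sup>+y. f (T m y) \<partial>?L)
        = (\<integral>\<^sup>+y. (\<lambda>x. f (x(m := x m + x (Suc m)))) (T (Suc m) y) \<partial>?L)"
      by simp
    also have "\<dots> = (\<integral>\<^sup>+x. f (x(m := x m + x (Suc m))) \<partial>?L)"
    proof (rule step.IH)
      show "(\<lambda>x. f (x(m := x m + x (Suc m)))) \<in> borel_measurable ?L" by measurable
    qed simp
    also have "\<dots> = (\<integral>\<^sup>+x. f x \<partial>?L)"
      using m by (intro nn_integral_shear) (auto simp del: One_nat_def)
    finally show ?case .
  qed
  from this[of 1 f] f assms show ?thesis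
    by (simp add: T_def cong: restrict_cong)
qed

text \<open>The decreasing vector with successive gaps \<open>y\<close>.  Its last entry, rather than its total, is \<open>0\<close>;
the choice is immaterial for translation-invariant functions.\<close>

definition gap_profile :: "nat \<Rightarrow> (nat \<Rightarrow> real) \<Rightarrow> nat \<Rightarrow> real" where
  "gap_profile n y = (\<lambda>i\<in>{1..n}. \<Sum>k\<in>{i..<n}. y k)"

text \<open>The transformed vectors are restricted to \<open>{1..n}\<close> since vectors are extensional functions.\<close>

definition translation_invariant :: "nat \<Rightarrow> ((nat \<Rightarrow> real) \<Rightarrow> 'b) \<Rightarrow> bool" where
  "translation_invariant n h \<longleftrightarrow> (\<forall>x c. h (\<lambda>i\<in>{1..n}. x i + c) = h x)"

definition permutation_invariant :: "nat \<Rightarrow> ((nat \<Rightarrow> real) \<Rightarrow> 'b) \<Rightarrow> bool" where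
  "permutation_invariant n h \<longleftrightarrow> (\<forall>x \<sigma>. \<sigma> permutes {1..n} \<longrightarrow> h (\<lambda>i\<in>{1..n}. x (\<sigma> i)) = h x)"

lemma H0_parametrization_measurable:
  assumes "n \<ge> 1"
  shows "(\<lambda>V. V(n := - (\<Sum>i\<in>{1..<n}. V i)))
    \<in> measurable (lebesgue_Pi {1..<n}) (restrict_space (Rn_borel n) (H0 n))"
proof (rule measurable_restrict_space2)
  have n: "{1..n} = {1..<n} \<union> {n}" using assms by auto
  show "(\<lambda>V. V(n := - (\<Sum>i\<in>{1..<n}. V i))) \<in> space (lebesgue_Pi {1..<n}) \<rightarrow> H0 n"
  proof (rule Pi_I)
    fix V assume "V \<in> space (lebesgue_Pi {1..<n})"
    moreover have "(\<Sum>i\<in>{1..n}. (V(n := - (\<Sum>i\<in>{1..<n}. V i))) i) = 0"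
      unfolding n by (subst sum.union_disjoint) auto
    ultimately show "V(n := - (\<Sum>i\<in>{1..<n}. V i)) \<in> H0 n"
      using assms unfolding H0_def by (auto simp: space_PiM PiE_def extensional_def)
  qed
  have "(\<lambda>V. V(n := - (\<Sum>i\<in>{1..<n}. V i))) \<in> measurable (lebesgue_Pi {1..<n}) (lebesgue_Pi {1..n})"
    by (intro measurable_fun_upd[OF n]) auto
  then show "(\<lambda>V. V(n := - (\<Sum>i\<in>{1..<n}. V i))) \<in> measurable (lebesgue_Pi {1..<n}) (Rn_borel n)"
    by (subst measurable_cong_sets[OF refl, where N' = "lebesgue_Pi {1..n}"])
       (auto simp: Rn_borel_def simp del: One_nat_def intro!: sets_PiM_cong)
qed

lemma nn_integral_H0_measure:
  assumes "n \<ge> 1" and h: "h \<in> borel_measurable (lebesgue_Pi {1..n})"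
  shows "(\<integral>\<^sup>+U. h U \<partial>H0_measure n) = (\<integral>\<^sup>+V. h (V(n := - (\<Sum>i\<in>{1..<n}. V i))) \<partial>lebesgue_Pi {1..<n})"
proof -
  have "sets (lebesgue_Pi {1..n}) = sets (Rn_borel n)"
    by (auto simp: Rn_borel_def intro!: sets_PiM_cong)
  with h have "h \<in> borel_measurable (Rn_borel n)" by (simp cong: measurable_cong_sets)
  then have "h \<in> borel_measurable (restrict_space (Rn_borel n) (H0 n))"
    by (rule measurable_restrict_space1)
  then show ?thesis
    unfolding H0_measure_def using H0_parametrization_measurable[OF assms(1)]
    by (intro nn_integral_distr) auto
qed

text \<open>The measure on \<open>H0 n\<close> singles out the last coordinate, which hides its symmetry.  For a
translation-invariant integrand, the hyperplane can be thickened to the slab of vectors with total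
between \<open>0\<close> and \<open>1\<close>: a shear makes the total a coordinate of its own, and the slices
are translates of the hyperplane.  Lebesgue measure on the slab is visibly symmetric.\<close>

lemma nn_integral_H0_eq_slab:
  fixes h :: "(nat \<Rightarrow> real) \<Rightarrow> ennreal"
  assumes n: "n \<ge> 1" and h[measurable]: "h \<in> borel_measurable (lebesgue_Pi {1..n})"
    and inv: "translation_invariant n h"
  shows "(\<integral>\<^sup>+x. h x * indicator {0..1} (\<Sum>i\<in>{1..n}. x i) \<partial>lebesgue_Pi {1..n})
    = (\<integral>\<^sup>+U. h U \<partial>H0_measure n)"
proof -
  let ?L = "lebesgue_Pi {1..n}" and ?L' = "lebesgue_Pi {1..<n}"
  let ?\<phi> = "indicator {0..1} :: real \<Rightarrow> ennreal"
  define c where "c x = - (\<Sum>i\<in>{1..<n}. x i)" for x :: "nat \<Rightarrow> real"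
  have I: "{1..n} = insert n {1..<n}" using n by auto
  have c_upd: "c (x(n := y)) = c x" for x y by (auto simp: c_def intro!: sum.cong)
  have c_meas[measurable]: "c \<in> borel_measurable ?L" "c \<in> borel_measurable ?L'"
    unfolding c_def by (intro borel_measurable_uminus borel_measurable_sum coordinate_measurable; simp)+
  have "n \<in> {1..n}" using n by simp
  have xn[measurable]: "(\<lambda>x. x n) \<in> borel_measurable ?L"
    by (rule coordinate_measurable) fact
  have [measurable]: "(\<lambda>x. x n + c x) \<in> borel_measurable ?L"
    by (intro borel_measurable_add xn c_meas)
  have upd[measurable]: "(\<lambda>x. x(n := x n + c x)) \<in> measurable ?L ?L"
    using n by (intro measurable_fun_upd[where J = "{1..n}"]) (auto simp del: One_nat_def)
  have "(\<lambda>z. (fst z)(n := snd z + c (fst z))) \<in> measurable (?L' \<Otimes>\<^sub>M lborel) ?L"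
    using n by (intro measurable_fun_upd[where J = "{1..<n}"]) (auto simp del: One_nat_def)
  then have joint[measurable]: "(\<lambda>z. h ((fst z)(n := snd z + c (fst z)))) \<in> borel_measurable (?L' \<Otimes>\<^sub>M lborel)"
    by measurable
  interpret P: pair_sigma_finite ?L' "lborel :: real measure"
    by (intro pair_sigma_finite.intro lborel.sigma_finite_measure_axioms
          lebesgue_product.sigma_finite) auto
  have "(\<integral>\<^sup>+x. h x * ?\<phi> (\<Sum>i\<in>{1..n}. x i) \<partial>?L)
      = (\<integral>\<^sup>+x. h (x(n := x n + c x)) * ?\<phi> (\<Sum>i\<in>{1..n}. (x(n := x n + c x)) i) \<partial>?L)"
  proof (rule nn_integral_shear[symmetric, where f = "\<lambda>x. h x * ?\<phi> (\<Sum>i\<in>{1..n}. x i)"])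
    show "(\<lambda>x. h x * ?\<phi> (\<Sum>i\<in>{1..n}. x i)) \<in> borel_measurable ?L"
      using h by (rule slab_measurable)
  qed (fact | simp add: c_upd)+
  also have "\<dots> = (\<integral>\<^sup>+x. h (x(n := x n + c x)) * ?\<phi> (x n) \<partial>?L)"
  proof -
    have "(\<Sum>i\<in>{1..n}. (x(n := x n + c x)) i) = x n" for x
      unfolding I by (simp add: c_def)
    then show ?thesis by simp
  qed
  also have "\<dots> = (\<integral>\<^sup>+V. (\<integral>\<^sup>+s. h (V(n := s + c V)) * ?\<phi> s \<partial>lborel) \<partial>?L')"
  proof -
    have "(\<lambda>x. h (x(n := x n + c x)) * ?\<phi> (x n)) \<in> borel_measurable ?L"
      by (intro borel_measurable_times_ennreal measurable_compose[OF upd h] measurable_compose[OF xn]) simp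
    then have "(\<integral>\<^sup>+x. h (x(n := x n + c x)) * ?\<phi> (x n) \<partial>?L)
        = (\<integral>\<^sup>+V. (\<integral>\<^sup>+s. h ((V(n := s))(n := (V(n := s)) n + c (V(n := s)))) * ?\<phi> ((V(n := s)) n)
            \<partial>lborel) \<partial>?L')"
      unfolding I by (intro lebesgue_product.product_nn_integral_insert) auto
    then show ?thesis by (simp add: c_upd)
  qed
  also have "\<dots> = (\<integral>\<^sup>+s. (\<integral>\<^sup>+V. h (V(n := s + c V)) * ?\<phi> s \<partial>?L') \<partial>lborel)"
    using joint by (intro P.Fubini'[symmetric]) (simp add: split_beta')
  also have "\<dots> = (\<integral>\<^sup>+s. (\<integral>\<^sup>+V. h (V(n := c V)) \<partial>?L') * ?\<phi> s \<partial>lborel)"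
  proof (rule nn_integral_cong)
    fix s :: real
    have m1: "(\<lambda>V. h (V(n := s + c V))) \<in> borel_measurable ?L'"
      using measurable_compose[OF _ joint, of "\<lambda>V. (V, s)"] by simp
    (* A total of s is the same as adding s / n to every coordinate of a vector with total 0. *)
    have shift: "h ((\<lambda>i\<in>{1..<n}. V i + s / n)(n := s + c (\<lambda>i\<in>{1..<n}. V i + s / n))) = h (V(n := c V))" for V
    proof -
      have "c (\<lambda>i\<in>{1..<n}. V i + s / n) = c V - (real n - 1) * (s / n)"
        using n by (simp add: c_def sum.distrib of_nat_diff)
      then have "(\<lambda>i\<in>{1..<n}. V i + s / n)(n := s + c (\<lambda>i\<in>{1..<n}. V i + s / n))
          = (\<lambda>i\<in>{1..n}. (V(n := c V)) i + s / n)"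
        using n by (auto simp: fun_eq_iff field_simps)
      moreover have "h (\<lambda>i\<in>{1..n}. (V(n := c V)) i + s / n) = h (V(n := c V))"
        using inv unfolding translation_invariant_def by blast
      ultimately show ?thesis by (simp only:)
    qed
    have "(\<integral>\<^sup>+V. h (V(n := s + c V)) * ?\<phi> s \<partial>?L') = (\<integral>\<^sup>+V. h (V(n := s + c V)) \<partial>?L') * ?\<phi> s"
      using m1 by (rule nn_integral_multc)
    also have "(\<integral>\<^sup>+V. h (V(n := s + c V)) \<partial>?L') = (\<integral>\<^sup>+V. h (V(n := c V)) \<partial>?L')"
      using nn_integral_translate[OF _ m1, of "s / n"] by (simp only: shift finite_atLeastLessThan)
    finally show "(\<integral>\<^sup>+V. h (V(n := s + c V)) * ?\<phi> s \<partial>?L') = (\<integral>\<^sup>+V. h (V(n := c V)) \<partial>?L') * ?\<phi> s" .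
  qed
  also have "\<dots> = (\<integral>\<^sup>+V. h (V(n := c V)) \<partial>?L')"
    by (simp add: nn_integral_cmult)
  also have "\<dots> = (\<integral>\<^sup>+U. h U \<partial>H0_measure n)"
    using nn_integral_H0_measure[OF n h] by (simp add: c_def)
  finally show ?thesis .
qed

lemma gap_profile_measurable [measurable]:
  assumes "n \<ge> 1"
  shows "gap_profile n \<in> measurable (lebesgue_Pi {1..<n}) (lebesgue_Pi {1..n})"
  unfolding gap_profile_def using assms by (intro measurable_restrict) auto

text \<open>On the decreasing chamber of the slab, pass to tail sums of \<open>y\<close>.  The integrand depends on the
offset \<open>y n\<close> only through the total, which is affine in \<open>y n\<close> with slope \<open>n\<close>; integrating the
offset out produces the factor \<open>1 / n\<close>, and the chambers produce \<open>n!\<close>.\<close>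

lemma nn_integral_H0_eq_gaps:
  fixes h :: "(nat \<Rightarrow> real) \<Rightarrow> ennreal"
  assumes n: "n \<ge> 1" and h[measurable]: "h \<in> borel_measurable (lebesgue_Pi {1..n})"
    and trans: "translation_invariant n h" and perm: "permutation_invariant n h"
  shows "(\<integral>\<^sup>+U. h U \<partial>H0_measure n)
    = fact n / of_nat n * (\<integral>\<^sup>+y. h (gap_profile n y) * (\<Prod>k\<in>{1..<n}. indicator {0..} (y k)) \<partial>lebesgue_Pi {1..<n})"
proof -
  let ?L = "lebesgue_Pi {1..n}" and ?L' = "lebesgue_Pi {1..<n}"
  let ?\<phi> = "indicator {0..1} :: real \<Rightarrow> ennreal"
  let ?D = "indicator (decreasing_vectors n) :: _ \<Rightarrow> ennreal"
  let ?T = "\<lambda>y. \<lambda>i\<in>{1..n}. \<Sum>k\<in>{i..n}. y k :: real"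
  note [measurable] = gap_profile_measurable[OF n]
  have I: "{1..n} = insert n {1..<n}" using n by auto
  have mT[measurable]: "?T \<in> measurable ?L ?L"
    by (intro measurable_restrict) auto
  have T_upd: "?T (y(n := t)) = (\<lambda>i\<in>{1..n}. gap_profile n y i + t)" for y t
  proof
    fix i show "?T (y(n := t)) i = (\<lambda>i\<in>{1..n}. gap_profile n y i + t) i"
    proof (cases "i \<in> {1..n}")
      case True
      then have "{i..n} = insert n {i..<n}" by auto
      then show ?thesis using True by (simp add: gap_profile_def)
    qed auto
  qed
  have D_T: "?D (?T (y(n := t))) = (\<Prod>k\<in>{1..<n}. indicator {0..} (y k))" for y t
  proof -
    have "(\<lambda>i\<in>{1..n}. gap_profile n y i + t) \<in> decreasing_vectors n \<longleftrightarrow> (\<forall>k\<in>{1..<n}. 0 \<le> y k)"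
      (is "?l \<longleftrightarrow> ?r")
    proof
      assume ?l
      show ?r
      proof
        fix k assume k: "k \<in> {1..<n}"
        then have "gap_profile n y (Suc k) + t \<le> gap_profile n y k + t"
          using \<open>?l\<close> by (auto simp: decreasing_vectors_def)
        then show "0 \<le> y k" using k by (simp add: gap_profile_def sum.atLeast_Suc_lessThan)
      qed
    next
      assume ?r
      then show ?l
        by (auto simp: decreasing_vectors_def gap_profile_def intro!: sum_mono2)
    qed
    then show ?thesis unfolding T_upd
      by (auto simp: indicator_def prod_zero_iff)
  qed
  have "permutation_invariant n (\<lambda>x. h x * ?\<phi> (\<Sum>i\<in>{1..n}. x i))"
    unfolding permutation_invariant_def
  proof (intro allI impI)
    fix x :: "nat \<Rightarrow> real" and \<sigma> assume \<sigma>: "\<sigma> permutes {1..n}"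
    have "(\<Sum>i\<in>{1..n}. (\<lambda>i\<in>{1..n}. x (\<sigma> i)) i) = (\<Sum>i\<in>{1..n}. x i)"
      using sum.permute[OF \<sigma>, of x] by (simp add: o_def)
    then show "h (\<lambda>i\<in>{1..n}. x (\<sigma> i)) * ?\<phi> (\<Sum>i\<in>{1..n}. (\<lambda>i\<in>{1..n}. x (\<sigma> i)) i)
        = h x * ?\<phi> (\<Sum>i\<in>{1..n}. x i)"
      using perm \<sigma> by (simp add: permutation_invariant_def)
  qed
  then have "(\<integral>\<^sup>+x. h x * ?\<phi> (\<Sum>i\<in>{1..n}. x i) \<partial>?L)
      = fact n * (\<integral>\<^sup>+x. h x * ?\<phi> (\<Sum>i\<in>{1..n}. x i) * ?D x \<partial>?L)"
    by (intro nn_integral_symmetric) (auto simp: permutation_invariant_def simp del: One_nat_def)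
  also have "(\<integral>\<^sup>+x. h x * ?\<phi> (\<Sum>i\<in>{1..n}. x i) * ?D x \<partial>?L)
      = (\<integral>\<^sup>+y. h (?T y) * ?\<phi> (\<Sum>i\<in>{1..n}. ?T y i) * ?D (?T y) \<partial>?L)"
    using n by (intro nn_integral_tail_sums[where f = "\<lambda>x. h x * ?\<phi> (\<Sum>i\<in>{1..n}. x i) * ?D x"])
      (auto simp del: One_nat_def)
  also have "\<dots> = (\<integral>\<^sup>+y. (\<integral>\<^sup>+t. h (?T (y(n := t))) * ?\<phi> (\<Sum>i\<in>{1..n}. ?T (y(n := t)) i) * ?D (?T (y(n := t))) \<partial>lborel) \<partial>?L')"
  proof -
    have "(\<lambda>y. h (?T y) * ?\<phi> (\<Sum>i\<in>{1..n}. ?T y i) * ?D (?T y)) \<in> borel_measurable ?L"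
    proof (rule measurable_compose[OF mT])
      show "(\<lambda>x. h x * ?\<phi> (\<Sum>i\<in>{1..n}. x i) * ?D x) \<in> borel_measurable ?L" by measurable
    qed
    then show ?thesis
      using lebesgue_product.product_nn_integral_insert[of "{1..<n}" n] I by simp
  qed
  also have "\<dots> = (\<integral>\<^sup>+y. (1 / of_nat n) * (h (gap_profile n y) * (\<Prod>k\<in>{1..<n}. indicator {0..} (y k))) \<partial>?L')"
  proof (rule nn_integral_cong)
    fix y assume "y \<in> space ?L'"
    define s where "s = (\<Sum>i\<in>{1..n}. gap_profile n y i)"
    have hT: "h (?T (y(n := t))) = h (gap_profile n y)" for t
      unfolding T_upd using trans by (simp add: translation_invariant_def)
    have sT: "(\<Sum>i\<in>{1..n}. ?T (y(n := t)) i) = s + real n * t" for t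
      unfolding T_upd by (simp add: sum.distrib s_def)
    have one: "(\<integral>\<^sup>+t. ?\<phi> (s + real n * t) \<partial>lborel) = 1 / of_nat n"
    proof -
      have "1 = of_nat n * (\<integral>\<^sup>+t. ?\<phi> (s + real n * t) \<partial>lborel)"
        using nn_integral_real_affine[of ?\<phi> "real n" s] n by (simp add: ennreal_of_nat_eq_real_of_nat)
      then show ?thesis using n
        by (metis divide_right_mono_ennreal ennreal_mult_divide_eq of_nat_eq_0_iff not_one_le_zero
              mult.commute ennreal_of_nat_neq_top)
    qed
    have "(\<integral>\<^sup>+t. h (?T (y(n := t))) * ?\<phi> (\<Sum>i\<in>{1..n}. ?T (y(n := t)) i) * ?D (?T (y(n := t))) \<partial>lborel)
        = (\<integral>\<^sup>+t. (h (gap_profile n y) * (\<Prod>k\<in>{1..<n}. indicator {0..} (y k))) * ?\<phi> (s + real n * t) \<partial>lborel)"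
      unfolding hT sT D_T by (simp add: mult_ac)
    also have "\<dots> = (h (gap_profile n y) * (\<Prod>k\<in>{1..<n}. indicator {0..} (y k))) * (1 / of_nat n)"
      by (subst nn_integral_cmult) (auto simp: one)
    finally show "(\<integral>\<^sup>+t. h (?T (y(n := t))) * ?\<phi> (\<Sum>i\<in>{1..n}. ?T (y(n := t)) i) * ?D (?T (y(n := t))) \<partial>lborel)
        = (1 / of_nat n) * (h (gap_profile n y) * (\<Prod>k\<in>{1..<n}. indicator {0..} (y k)))"
      by (simp only: mult.commute)
  qed
  also have "\<dots> = (1 / of_nat n) * (\<integral>\<^sup>+y. h (gap_profile n y) * (\<Prod>k\<in>{1..<n}. indicator {0..} (y k)) \<partial>?L')"
    by (intro nn_integral_cmult) measurable
  finally show ?thesis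
    using nn_integral_H0_eq_slab[OF n h trans]
    by (simp add: ennreal_times_divide mult.assoc[symmetric])
qed

section \<open>Sums over pairs as functions of the gaps\<close>

text \<open>A sum over \<open>i < j\<close> becomes manifestly invariant under permutations once it is written as half of
the sum over all ordered pairs.\<close>

lemma sum_pairs_eq_half_sum:
  fixes a :: "nat \<Rightarrow> nat \<Rightarrow> real"
  assumes sym: "\<And>i j. a i j = a j i" and diag: "\<And>i. a i i = 0"
  shows "(\<Sum>i\<in>{1..n}. \<Sum>j\<in>{i<..n}. a i j) = (1/2) * (\<Sum>i\<in>{1..n}. \<Sum>j\<in>{1..n}. a i j)"
proof -
  have up: "(\<Sum>j\<in>{i<..n}. a i j) = (\<Sum>j\<in>{1..n}. if i < j then a i j else 0)" if "i \<in> {1..n}" for i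
    using that by (intro sum.mono_neutral_cong_left) auto
  have "(\<Sum>i\<in>{1..n}. \<Sum>j\<in>{1..n}. a i j)
      = (\<Sum>i\<in>{1..n}. \<Sum>j\<in>{1..n}. (if i < j then a i j else 0) + (if j < i then a j i else 0))"
  proof (intro sum.cong refl)
    fix i j show "a i j = (if i < j then a i j else 0) + (if j < i then a j i else 0)"
      using sym[of i j] diag[of i] by (cases i j rule: linorder_cases) auto
  qed
  also have "\<dots> = (\<Sum>i\<in>{1..n}. \<Sum>j\<in>{1..n}. if i < j then a i j else 0)
      + (\<Sum>i\<in>{1..n}. \<Sum>j\<in>{1..n}. if j < i then a j i else 0)"
    by (simp add: sum.distrib)
  also have "(\<Sum>i\<in>{1..n}. \<Sum>j\<in>{1..n}. if j < i then a j i else 0)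
      = (\<Sum>i\<in>{1..n}. \<Sum>j\<in>{1..n}. if i < j then a i j else 0)"
    by (rule sum.swap)
  finally show ?thesis using up by simp
qed

definition pair_sum :: "nat \<Rightarrow> (real \<Rightarrow> real) \<Rightarrow> (nat \<Rightarrow> real) \<Rightarrow> real" where
  "pair_sum n g U = (\<Sum>i\<in>{1..n}. \<Sum>j\<in>{i<..n}. g \<bar>U i - U j\<bar>)"

lemma pair_sum_translation_invariant: "translation_invariant n (pair_sum n g)"
  by (auto simp: translation_invariant_def pair_sum_def intro!: sum.cong)

lemma pair_sum_permutation_invariant:
  assumes "g 0 = 0"
  shows "permutation_invariant n (pair_sum n g)"
  unfolding permutation_invariant_def
proof (intro allI impI)
  fix x :: "nat \<Rightarrow> real" and \<sigma> assume \<sigma>: "\<sigma> permutes {1..n}"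
  have half: "pair_sum n g U = (1/2) * (\<Sum>i\<in>{1..n}. \<Sum>j\<in>{1..n}. g \<bar>U i - U j\<bar>)" for U
    unfolding pair_sum_def using assms by (intro sum_pairs_eq_half_sum) (auto simp: abs_minus_commute)
  have "(\<Sum>i\<in>{1..n}. \<Sum>j\<in>{1..n}. g \<bar>x (\<sigma> i) - x (\<sigma> j)\<bar>)
      = (\<Sum>i\<in>{1..n}. \<Sum>j\<in>{1..n}. g \<bar>x (\<sigma> i) - x j\<bar>)"
    using sum.permute[OF \<sigma>, of "\<lambda>j. g \<bar>x (\<sigma> i) - x j\<bar>" for i] by (simp add: o_def)
  also have "\<dots> = (\<Sum>i\<in>{1..n}. \<Sum>j\<in>{1..n}. g \<bar>x i - x j\<bar>)"
    using sum.permute[OF \<sigma>, of "\<lambda>i. \<Sum>j\<in>{1..n}. g \<bar>x i - x j\<bar>"] by (simp add: o_def)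
  finally show "pair_sum n g (\<lambda>i\<in>{1..n}. x (\<sigma> i)) = pair_sum n g x"
    by (simp add: half)
qed

lemma pair_sum_measurable:
  assumes [measurable]: "g \<in> borel_measurable borel"
  shows "pair_sum n g \<in> borel_measurable (lebesgue_Pi {1..n})"
  unfolding pair_sum_def
  by (intro borel_measurable_sum measurable_compose[OF _ assms] borel_measurable_abs
        borel_measurable_diff coordinate_measurable) auto

lemma sum_pairs_swap:
  fixes f :: "nat \<Rightarrow> nat \<Rightarrow> nat \<Rightarrow> real"
  shows "(\<Sum>i\<in>A. \<Sum>j\<in>B i. \<Sum>k\<in>C. f i j k) = (\<Sum>k\<in>C. \<Sum>i\<in>A. \<Sum>j\<in>B i. f i j k)"
proof -
  have "(\<Sum>i\<in>A. \<Sum>j\<in>B i. \<Sum>k\<in>C. f i j k) = (\<Sum>i\<in>A. \<Sum>k\<in>C. \<Sum>j\<in>B i. f i j k)"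
    by (intro sum.cong refl sum.swap)
  also have "\<dots> = (\<Sum>k\<in>C. \<Sum>i\<in>A. \<Sum>j\<in>B i. f i j k)"
    by (rule sum.swap)
  finally show ?thesis .
qed

text \<open>For \<open>p = q = k\<close> these are the pairs separated by gap \<open>k\<close>; for \<open>p < q\<close> they are the pairs whose
difference contains both gap \<open>p\<close> and gap \<open>q\<close>.\<close>

lemma sum_pairs_straddling:
  fixes p q n :: nat
  assumes "1 \<le> p" "p \<le> q" "q < n"
  shows "(\<Sum>i\<in>{1..n}. \<Sum>j\<in>{i<..n}. if i \<le> p \<and> q < j then 1 else 0 :: real) = real p * (real n - real q)"
proof -
  have "(\<Sum>i\<in>{1..n}. \<Sum>j\<in>{i<..n}. if i \<le> p \<and> q < j then 1 else 0 :: real)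
      = (\<Sum>i\<in>{1..n}. if i \<le> p then real n - real q else 0)"
  proof (rule sum.cong[OF refl])
    fix i assume "i \<in> {1..n}"
    show "(\<Sum>j\<in>{i<..n}. if i \<le> p \<and> q < j then 1 else 0 :: real) = (if i \<le> p then real n - real q else 0)"
    proof (cases "i \<le> p")
      case True
      then have "(\<Sum>j\<in>{i<..n}. if i \<le> p \<and> q < j then 1 else 0 :: real) = (\<Sum>j\<in>{q<..n}. 1)"
        using assms by (intro sum.mono_neutral_cong_right) auto
      then show ?thesis using True assms by (simp add: of_nat_diff)
    qed simp
  qed
  also have "\<dots> = (\<Sum>i\<in>{1..p}. real n - real q)"
    using assms by (intro sum.mono_neutral_cong_right) auto
  finally show ?thesis by simp
qed

lemma gap_profile_diff:
  assumes "i \<in> {1..n}" "j \<in> {1..n}" "i \<le> j"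
  shows "gap_profile n y i - gap_profile n y j = (\<Sum>k\<in>{1..<n}. if i \<le> k \<and> k < j then y k else 0)"
proof -
  have "(\<Sum>k\<in>{i..<n}. y k) = (\<Sum>k\<in>{i..<j}. y k) + (\<Sum>k\<in>{j..<n}. y k)"
    using assms by (intro sum.atLeastLessThan_concat[symmetric]) auto
  moreover have "(\<Sum>k\<in>{1..<n}. if i \<le> k \<and> k < j then y k else 0) = (\<Sum>k\<in>{i..<j}. y k)"
    using assms by (intro sum.mono_neutral_cong_right) auto
  ultimately show ?thesis using assms by (simp add: gap_profile_def)
qed

lemma gap_profile_abs_diff:
  assumes "i \<in> {1..n}" "j \<in> {i<..n}" "\<And>k. k \<in> {1..<n} \<Longrightarrow> 0 \<le> y k"
  shows "\<bar>gap_profile n y i - gap_profile n y j\<bar> = (\<Sum>k\<in>{1..<n}. if i \<le> k \<and> k < j then y k else 0)"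
proof -
  have "gap_profile n y i - gap_profile n y j = (\<Sum>k\<in>{1..<n}. if i \<le> k \<and> k < j then y k else 0)"
    using assms by (intro gap_profile_diff) auto
  moreover have "\<dots> \<ge> 0" using assms by (intro sum_nonneg) auto
  ultimately show ?thesis by simp
qed

lemma pair_sum_abs_gap_profile:
  assumes "\<And>k. k \<in> {1..<n} \<Longrightarrow> 0 \<le> y k"
  shows "pair_sum n (\<lambda>t. t) (gap_profile n y) = (\<Sum>k\<in>{1..<n}. real k * (real n - real k) * y k)"
proof -
  have "pair_sum n (\<lambda>t. t) (gap_profile n y)
      = (\<Sum>i\<in>{1..n}. \<Sum>j\<in>{i<..n}. \<Sum>k\<in>{1..<n}. if i \<le> k \<and> k < j then y k else 0)"
    unfolding pair_sum_def using assms by (intro sum.cong refl gap_profile_abs_diff) auto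
  also have "\<dots> = (\<Sum>k\<in>{1..<n}. \<Sum>i\<in>{1..n}. \<Sum>j\<in>{i<..n}. if i \<le> k \<and> k < j then y k else 0)"
    by (rule sum_pairs_swap)
  also have "\<dots> = (\<Sum>k\<in>{1..<n}. (\<Sum>i\<in>{1..n}. \<Sum>j\<in>{i<..n}. if i \<le> k \<and> k < j then 1 else 0) * y k)"
    by (intro sum.cong refl) (auto simp: sum_distrib_right intro!: sum.cong)
  also have "\<dots> = (\<Sum>k\<in>{1..<n}. real k * (real n - real k) * y k)"
    by (intro sum.cong refl, subst sum_pairs_straddling) auto
  finally show ?thesis .
qed

lemma pair_sum_square_gap_profile:
  "pair_sum n (\<lambda>t. t\<^sup>2) (gap_profile n y)
    = (\<Sum>k\<in>{1..<n}. \<Sum>l\<in>{1..<n}. real (min k l) * (real n - real (max k l)) * (y k * y l))"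
proof -
  let ?c = "\<lambda>i j k l. if i \<le> min k l \<and> max k l < j then 1 else 0 :: real"
  have "pair_sum n (\<lambda>t. t\<^sup>2) (gap_profile n y)
      = (\<Sum>i\<in>{1..n}. \<Sum>j\<in>{i<..n}. \<Sum>k\<in>{1..<n}. \<Sum>l\<in>{1..<n}. ?c i j k l * (y k * y l))"
    unfolding pair_sum_def
  proof (intro sum.cong refl)
    fix i j assume ij: "i \<in> {1..n}" "j \<in> {i<..n}"
    let ?t = "\<lambda>k. if i \<le> k \<and> k < j then y k else 0"
    have "\<bar>gap_profile n y i - gap_profile n y j\<bar>\<^sup>2 = (\<Sum>k\<in>{1..<n}. ?t k)\<^sup>2"
      using ij by (subst gap_profile_diff) auto
    also have "\<dots> = (\<Sum>k\<in>{1..<n}. \<Sum>l\<in>{1..<n}. ?t k * ?t l)"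
      by (simp add: power2_eq_square sum_product)
    also have "\<dots> = (\<Sum>k\<in>{1..<n}. \<Sum>l\<in>{1..<n}. ?c i j k l * (y k * y l))"
      by (intro sum.cong refl) auto
    finally show "\<bar>gap_profile n y i - gap_profile n y j\<bar>\<^sup>2
        = (\<Sum>k\<in>{1..<n}. \<Sum>l\<in>{1..<n}. ?c i j k l * (y k * y l))" .
  qed
  also have "\<dots> = (\<Sum>k\<in>{1..<n}. \<Sum>i\<in>{1..n}. \<Sum>j\<in>{i<..n}. \<Sum>l\<in>{1..<n}. ?c i j k l * (y k * y l))"
    by (rule sum_pairs_swap)
  also have "\<dots> = (\<Sum>k\<in>{1..<n}. \<Sum>l\<in>{1..<n}. \<Sum>i\<in>{1..n}. \<Sum>j\<in>{i<..n}. ?c i j k l * (y k * y l))"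
    by (intro sum.cong refl sum_pairs_swap)
  also have "\<dots> = (\<Sum>k\<in>{1..<n}. \<Sum>l\<in>{1..<n}. (\<Sum>i\<in>{1..n}. \<Sum>j\<in>{i<..n}. ?c i j k l) * (y k * y l))"
    by (simp only: sum_distrib_right)
  also have "\<dots> = (\<Sum>k\<in>{1..<n}. \<Sum>l\<in>{1..<n}. real (min k l) * (real n - real (max k l)) * (y k * y l))"
    by (intro sum.cong refl, subst sum_pairs_straddling) auto
  finally show ?thesis .
qed

lemma osc_gap_profile:
  assumes n: "n \<ge> 1" and y: "\<And>k. k \<in> {1..<n} \<Longrightarrow> 0 \<le> y k"
  shows "osc n (gap_profile n y) = (\<Sum>k\<in>{1..<n}. y k)"
proof -
  have le: "gap_profile n y i \<le> gap_profile n y 1" "gap_profile n y n \<le> gap_profile n y i"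
    if "i \<in> {1..n}" for i
    using that y by (auto simp: gap_profile_def intro!: sum_mono2 sum_nonneg)
  have "Max (gap_profile n y ` {1..n}) = gap_profile n y 1"
    using n le by (intro Max_eqI) auto
  moreover have "Min (gap_profile n y ` {1..n}) = gap_profile n y n"
    using n le by (intro Min_eqI) auto
  ultimately show ?thesis using n by (simp add: osc_def gap_profile_def)
qed

lemma osc_translation_invariant:
  assumes "n \<ge> 1"
  shows "translation_invariant n (osc n)"
proof -
  have "Max ((\<lambda>i\<in>{1..n}. x i + c) ` {1..n}) = Max (x ` {1..n}) + c"
       "Min ((\<lambda>i\<in>{1..n}. x i + c) ` {1..n}) = Min (x ` {1..n}) + c" for x :: "nat \<Rightarrow> real" and c
  proof -
    have "(\<lambda>i\<in>{1..n}. x i + c) ` {1..n} = (\<lambda>i. x i + c) ` {1..n}" by (intro image_cong) auto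
    then show "Max ((\<lambda>i\<in>{1..n}. x i + c) ` {1..n}) = Max (x ` {1..n}) + c"
       "Min ((\<lambda>i\<in>{1..n}. x i + c) ` {1..n}) = Min (x ` {1..n}) + c"
      using assms by (simp_all add: Max_add_commute Min_add_commute)
  qed
  then show ?thesis by (simp add: translation_invariant_def osc_def)
qed

lemma osc_permutation_invariant: "permutation_invariant n (osc n)"
proof -
  have "(\<lambda>i\<in>{1..n}. x (\<sigma> i)) ` {1..n} = x ` {1..n}" if "\<sigma> permutes {1..n}" for x :: "nat \<Rightarrow> real" and \<sigma>
  proof -
    have "(\<lambda>i\<in>{1..n}. x (\<sigma> i)) ` {1..n} = x ` (\<sigma> ` {1..n})" by (auto simp: image_image)
    then show ?thesis using that by (simp add: permutes_image)
  qed
  then show ?thesis by (simp add: permutation_invariant_def osc_def)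
qed

lemma osc_measurable: "osc n \<in> borel_measurable (lebesgue_Pi {1..n})"
  unfolding osc_def
  by (intro borel_measurable_diff borel_measurable_Max borel_measurable_Min coordinate_measurable) auto

lemma abs_diff_le_osc:
  assumes "i \<in> {1..n}" "j \<in> {1..n}"
  shows "\<bar>U i - U j\<bar> \<le> osc n U"
proof -
  have "U i \<le> Max (U ` {1..n})" "U j \<le> Max (U ` {1..n})"
       "Min (U ` {1..n}) \<le> U i" "Min (U ` {1..n}) \<le> U j"
    using assms by auto
  then show ?thesis by (auto simp: osc_def)
qed

section \<open>The gap law as a product of exponential laws\<close>

text \<open>Gap \<open>k\<close> separates \<open>k * (n - k)\<close> pairs, each of which enters the exponent of the gap weight with
weight \<open>1 / n\<close>.
The value \<open>1\<close> elsewhere makes every factor of the product below a probability measure.\<close>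

definition gap_rate :: "nat \<Rightarrow> nat \<Rightarrow> real" where
  "gap_rate n k = (if k \<in> {1..<n} then real k * (real n - real k) / real n else 1)"

lemma gap_rate_pos: "gap_rate n k > 0"
  by (auto simp: gap_rate_def)

text \<open>The joint law of the gaps of a sorted vector that is distributed according to \<open>P_gap n\<close>.\<close>

definition gap_law :: "nat \<Rightarrow> (nat \<Rightarrow> real) measure" where
  "gap_law n = PiM {1..<n} (\<lambda>k. density lborel (exponential_density (gap_rate n k)))"

lemma prob_space_gap: "prob_space (density lborel (exponential_density (gap_rate n k)))"
  using gap_rate_pos by (rule prob_space_exponential_density)

interpretation gap_product: product_prob_space
  "\<lambda>k. density lborel (exponential_density (gap_rate n k))" I for n I
  by (intro product_prob_space.intro product_prob_space_axioms.intro product_sigma_finite.intro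
        prob_space_imp_sigma_finite prob_space_gap)

lemma prob_space_gap_law: "prob_space (gap_law n)"
  unfolding gap_law_def by (intro prob_space_PiM prob_space_gap)

lemma sets_gap_law [measurable_cong]: "sets (gap_law n) = sets (lebesgue_Pi {1..<n})"
  unfolding gap_law_def by (intro sets_PiM_cong) auto

lemma gap_law_eq_density:
  "gap_law n = density (lebesgue_Pi {1..<n})
     (\<lambda>y. \<Prod>k\<in>{1..<n}. ennreal (exponential_density (gap_rate n k) (y k)))"
proof (rule sym, unfold gap_law_def, rule gap_product.PiM_eqI)
  let ?f = "\<lambda>k. \<lambda>t. ennreal (exponential_density (gap_rate n k) t)"
  have meas: "(\<lambda>y. \<Prod>k\<in>{1..<n}. ?f k (y k)) \<in> borel_measurable (lebesgue_Pi {1..<n})"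
    by (intro borel_measurable_prod_ennreal measurable_compose[OF coordinate_measurable]) auto
  fix A :: "nat \<Rightarrow> real set"
  assume "\<And>k. k \<in> {1..<n} \<Longrightarrow> A k \<in> sets (density lborel (exponential_density (gap_rate n k)))"
  then have A: "\<And>k. k \<in> {1..<n} \<Longrightarrow> A k \<in> sets borel" by simp
  have "emeasure (density (lebesgue_Pi {1..<n}) (\<lambda>y. \<Prod>k\<in>{1..<n}. ?f k (y k))) (Pi\<^sub>E {1..<n} A)
      = (\<integral>\<^sup>+y. (\<Prod>k\<in>{1..<n}. ?f k (y k)) * indicator (Pi\<^sub>E {1..<n} A) y \<partial>lebesgue_Pi {1..<n})"
    using A by (intro emeasure_density meas sets_PiM_I_finite) auto
  also have "\<dots> = (\<integral>\<^sup>+y. (\<Prod>k\<in>{1..<n}. ?f k (y k) * indicator (A k) (y k)) \<partial>lebesgue_Pi {1..<n})"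
  proof (rule nn_integral_cong)
    fix y assume "y \<in> space (lebesgue_Pi {1..<n})"
    then have "indicator (Pi\<^sub>E {1..<n} A) y = (\<Prod>k\<in>{1..<n}. indicator (A k) (y k) :: ennreal)"
      by (auto simp: indicator_def space_PiM PiE_iff prod_zero_iff)
    then show "(\<Prod>k\<in>{1..<n}. ?f k (y k)) * indicator (Pi\<^sub>E {1..<n} A) y
        = (\<Prod>k\<in>{1..<n}. ?f k (y k) * indicator (A k) (y k))"
      by (simp add: prod.distrib)
  qed
  also have "\<dots> = (\<Prod>k\<in>{1..<n}. \<integral>\<^sup>+t. ?f k t * indicator (A k) t \<partial>lborel)"
  proof (rule lebesgue_product.product_nn_integral_prod)
    fix k assume "k \<in> {1..<n}"
    with A have [measurable]: "A k \<in> sets borel" by simp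
    show "(\<lambda>t. ?f k t * indicator (A k) t) \<in> borel_measurable lborel" by measurable
  qed simp
  also have "\<dots> = (\<Prod>k\<in>{1..<n}. emeasure (density lborel (exponential_density (gap_rate n k))) (A k))"
    using A by (intro prod.cong refl emeasure_density[symmetric]) auto
  finally show "emeasure (density (lebesgue_Pi {1..<n}) (\<lambda>y. \<Prod>k\<in>{1..<n}. ?f k (y k))) (Pi\<^sub>E {1..<n} A)
      = (\<Prod>k\<in>{1..<n}. emeasure (density lborel (exponential_density (gap_rate n k))) (A k))" .
qed (auto intro!: sets_PiM_cong)

lemma gap_weight_pair_sum: "gap_weight n U = exp (- (1 / real n) * pair_sum n (\<lambda>t. t) U)"
  by (simp add: gap_weight_def pair_sum_def)

lemma gap_weight_measurable: "gap_weight n \<in> borel_measurable (lebesgue_Pi {1..n})"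
proof -
  have [measurable]: "pair_sum n (\<lambda>t. t) \<in> borel_measurable (lebesgue_Pi {1..n})"
    by (intro pair_sum_measurable) simp
  show ?thesis unfolding gap_weight_pair_sum by measurable
qed

text \<open>The exponent is linear in the gaps, so the weight is a product of exponential densities up to
normalization.\<close>

lemma gap_weight_gap_profile:
  assumes "\<And>k. k \<in> {1..<n} \<Longrightarrow> 0 \<le> y k"
  shows "gap_weight n (gap_profile n y)
    = (\<Prod>k\<in>{1..<n}. exponential_density (gap_rate n k) (y k) / gap_rate n k)"
proof -
  have "pair_sum n (\<lambda>t. t) (gap_profile n y) = (\<Sum>k\<in>{1..<n}. real k * (real n - real k) * y k)"
    using assms by (rule pair_sum_abs_gap_profile)
  then have "gap_weight n (gap_profile n y) = exp (\<Sum>k\<in>{1..<n}. - (gap_rate n k * y k))"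
    unfolding gap_weight_pair_sum
    by (auto simp: gap_rate_def sum_distrib_left sum_negf intro!: sum.cong)
  also have "\<dots> = (\<Prod>k\<in>{1..<n}. exp (- (gap_rate n k * y k)))"
    by (rule exp_sum) simp
  also have "\<dots> = (\<Prod>k\<in>{1..<n}. exponential_density (gap_rate n k) (y k) / gap_rate n k)"
  proof (rule prod.cong[OF refl])
    fix k assume "k \<in> {1..<n}"
    then show "exp (- (gap_rate n k * y k)) = exponential_density (gap_rate n k) (y k) / gap_rate n k"
      using assms[of k] gap_rate_pos[of n k] by (simp add: exponential_density_def mult.commute)
  qed
  finally show ?thesis .
qed

lemma nn_integral_H0_gap_weight:
  fixes h :: "(nat \<Rightarrow> real) \<Rightarrow> ennreal"
  assumes n: "n \<ge> 1" and h[measurable]: "h \<in> borel_measurable (lebesgue_Pi {1..n})"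
    and trans: "translation_invariant n h" and perm: "permutation_invariant n h"
  shows "(\<integral>\<^sup>+U. h U * ennreal (gap_weight n U) \<partial>H0_measure n)
    = ennreal (fact n / (real n * (\<Prod>k\<in>{1..<n}. gap_rate n k))) * (\<integral>\<^sup>+y. h (gap_profile n y) \<partial>gap_law n)"
proof -
  let ?L' = "lebesgue_Pi {1..<n}"
  let ?P = "\<Prod>k\<in>{1..<n}. gap_rate n k"
  let ?e = "\<lambda>y. \<Prod>k\<in>{1..<n}. ennreal (exponential_density (gap_rate n k) (y k))"
  have P: "?P > 0" by (intro prod_pos) (simp add: gap_rate_pos)
  note [measurable] = gap_weight_measurable gap_profile_measurable[OF n]
  have e[measurable]: "?e \<in> borel_measurable ?L'"
    by (intro borel_measurable_prod_ennreal measurable_compose[OF coordinate_measurable]) auto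
  have hp[measurable]: "(\<lambda>y. h (gap_profile n y)) \<in> borel_measurable ?L'" by measurable
  have "translation_invariant n (gap_weight n)" "permutation_invariant n (gap_weight n)"
    using pair_sum_translation_invariant[of n "\<lambda>t. t"] pair_sum_permutation_invariant[of "\<lambda>t. t" n]
    by (auto simp: translation_invariant_def permutation_invariant_def gap_weight_pair_sum)
  moreover have "(\<lambda>U. h U * ennreal (gap_weight n U)) \<in> borel_measurable (lebesgue_Pi {1..n})"
    by measurable
  ultimately have "(\<integral>\<^sup>+U. h U * ennreal (gap_weight n U) \<partial>H0_measure n)
      = fact n / of_nat n * (\<integral>\<^sup>+y. h (gap_profile n y) * ennreal (gap_weight n (gap_profile n y))
          * (\<Prod>k\<in>{1..<n}. indicator {0..} (y k)) \<partial>?L')"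
    using trans perm
    by (intro nn_integral_H0_eq_gaps[OF n])
       (auto simp: translation_invariant_def permutation_invariant_def simp del: One_nat_def)
  also have "(\<integral>\<^sup>+y. h (gap_profile n y) * ennreal (gap_weight n (gap_profile n y))
          * (\<Prod>k\<in>{1..<n}. indicator {0..} (y k)) \<partial>?L')
      = (\<integral>\<^sup>+y. ennreal (1 / ?P) * (?e y * h (gap_profile n y)) \<partial>?L')"
  proof (rule nn_integral_cong)
    fix y :: "nat \<Rightarrow> real"
    have "ennreal (gap_weight n (gap_profile n y)) * (\<Prod>k\<in>{1..<n}. indicator {0..} (y k))
        = ennreal (1 / ?P) * ?e y"
    proof (cases "\<forall>k\<in>{1..<n}. 0 \<le> y k")
      case True
      have "gap_weight n (gap_profile n y) = (1 / ?P) * (\<Prod>k\<in>{1..<n}. exponential_density (gap_rate n k) (y k))"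
        using True by (subst gap_weight_gap_profile) (auto simp: prod_dividef)
      moreover have "(\<Prod>k\<in>{1..<n}. indicator {0..} (y k)) = (1::ennreal)"
        using True by (intro prod.neutral) (auto simp: indicator_def)
      moreover have "?e y = ennreal (\<Prod>k\<in>{1..<n}. exponential_density (gap_rate n k) (y k))"
        using gap_rate_pos by (intro prod_ennreal) (auto simp: less_imp_le)
      ultimately show ?thesis
        using P gap_rate_pos by (simp add: ennreal_mult[symmetric] prod_nonneg less_imp_le)
    next
      case False
      then obtain k where k: "k \<in> {1..<n}" "y k < 0" by (auto simp: not_le)
      have "(\<Prod>k\<in>{1..<n}. indicator {0..} (y k)) = (0::ennreal)"
        using k by (intro prod_zero bexI[of _ k]) auto
      moreover have "?e y = 0"
        using k by (intro prod_zero bexI[of _ k]) (auto simp: exponential_density_def)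
      ultimately show ?thesis by (simp only: mult_zero_right)
    qed
    then show "h (gap_profile n y) * ennreal (gap_weight n (gap_profile n y))
          * (\<Prod>k\<in>{1..<n}. indicator {0..} (y k)) = ennreal (1 / ?P) * (?e y * h (gap_profile n y))"
      by (simp only: mult.assoc) (simp only: mult_ac)
  qed
  also have "\<dots> = ennreal (1 / ?P) * (\<integral>\<^sup>+y. ?e y * h (gap_profile n y) \<partial>?L')"
    by (intro nn_integral_cmult) measurable
  also have "(\<integral>\<^sup>+y. ?e y * h (gap_profile n y) \<partial>?L') = (\<integral>\<^sup>+y. h (gap_profile n y) \<partial>gap_law n)"
    unfolding gap_law_eq_density using e hp by (intro nn_integral_density[symmetric])
  finally have "(\<integral>\<^sup>+U. h U * ennreal (gap_weight n U) \<partial>H0_measure n)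
      = fact n / of_nat n * ennreal (1 / ?P) * (\<integral>\<^sup>+y. h (gap_profile n y) \<partial>gap_law n)"
    by (simp only: mult.assoc)
  also have "fact n / of_nat n * ennreal (1 / ?P) = ennreal (fact n / (real n * ?P))"
  proof -
    have "fact n / of_nat n = ennreal (fact n / real n)"
    proof -
      have "(fact n :: ennreal) = ennreal (fact n)"
        by (metis ennreal_of_nat_eq_real_of_nat of_nat_fact)
      then show ?thesis using n by (simp only: ennreal_of_nat_eq_real_of_nat) (simp add: divide_ennreal)
    qed
    then show ?thesis using P n by (simp add: ennreal_mult[symmetric])
  qed
  finally show ?thesis .
qed

lemma sets_H0_measure: "sets (H0_measure n) = sets (restrict_space (Rn_borel n) (H0 n))"
  by (simp add: H0_measure_def)

lemma measurable_H0_measure: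
  assumes "h \<in> borel_measurable (lebesgue_Pi {1..n})"
  shows "h \<in> borel_measurable (H0_measure n)"
proof -
  have "sets (lebesgue_Pi {1..n}) = sets (Rn_borel n)"
    by (auto simp: Rn_borel_def intro!: sets_PiM_cong)
  with assms have "h \<in> borel_measurable (Rn_borel n)" by (simp cong: measurable_cong_sets)
  then show ?thesis
    by (simp add: measurable_restrict_space1 sets_H0_measure cong: measurable_cong_sets)
qed

lemma gap_weight_measurable_H0 [measurable]: "gap_weight n \<in> borel_measurable (H0_measure n)"
  by (intro measurable_H0_measure gap_weight_measurable)

lemma Z_gap_eq:
  assumes n: "n \<ge> 1"
  shows "Z_gap n = fact n / (real n * (\<Prod>k\<in>{1..<n}. gap_rate n k))" (is "_ = ?C") and "Z_gap n > 0"
    and "integrable (H0_measure n) (gap_weight n)"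
proof -
  interpret prob_space "gap_law n" by (rule prob_space_gap_law)
  have C: "?C > 0" using n gap_rate_pos by (auto intro!: divide_pos_pos mult_pos_pos prod_pos)
  have nn: "(\<integral>\<^sup>+U. ennreal (gap_weight n U) \<partial>H0_measure n) = ennreal ?C"
    using nn_integral_H0_gap_weight[OF n, of "\<lambda>_. 1"] emeasure_space_1
    by (simp add: translation_invariant_def permutation_invariant_def)
  then show "Z_gap n = ?C"
    unfolding Z_gap_def using C by (subst integral_eq_nn_integral) (auto simp: gap_weight_def)
  with C show "Z_gap n > 0" by simp
  show "integrable (H0_measure n) (gap_weight n)"
    using nn by (intro integrableI_nonneg) (auto simp: gap_weight_def)
qed

text \<open>Under the gap law the gaps of the sorted vector are independent exponential variables.  The
combinatorial constant cancels because the normalizing constant is the case \<open>h = 1\<close>.\<close>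

lemma nn_integral_P_gap:
  fixes h :: "(nat \<Rightarrow> real) \<Rightarrow> ennreal"
  assumes n: "n \<ge> 1" and h[measurable]: "h \<in> borel_measurable (lebesgue_Pi {1..n})"
    and inv: "translation_invariant n h" "permutation_invariant n h"
  shows "(\<integral>\<^sup>+U. h U \<partial>P_gap n) = (\<integral>\<^sup>+y. h (gap_profile n y) \<partial>gap_law n)"
proof -
  note [measurable] = measurable_H0_measure[OF h]
  have "(\<integral>\<^sup>+U. h U \<partial>P_gap n) = (\<integral>\<^sup>+U. ennreal (gap_weight n U / Z_gap n) * h U \<partial>H0_measure n)"
    unfolding P_gap_def by (intro nn_integral_density) measurable
  also have "\<dots> = (\<integral>\<^sup>+U. ennreal (1 / Z_gap n) * (h U * ennreal (gap_weight n U)) \<partial>H0_measure n)"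
    using Z_gap_eq(2)[OF n]
    by (intro nn_integral_cong) (auto simp: gap_weight_def divide_inverse ennreal_mult mult_ac)
  also have "\<dots> = ennreal (1 / Z_gap n) * (\<integral>\<^sup>+U. h U * ennreal (gap_weight n U) \<partial>H0_measure n)"
    by (intro nn_integral_cmult) measurable
  also have "\<dots> = ennreal (1 / Z_gap n) * (ennreal (Z_gap n) * (\<integral>\<^sup>+y. h (gap_profile n y) \<partial>gap_law n))"
    using nn_integral_H0_gap_weight[OF n h inv] Z_gap_eq(1)[OF n] by simp
  also have "\<dots> = (\<integral>\<^sup>+y. h (gap_profile n y) \<partial>gap_law n)"
    using Z_gap_eq(2)[OF n] by (simp add: ennreal_mult[symmetric] flip: mult.assoc)
  finally show ?thesis .
qed

lemma prob_space_P_gap: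
  assumes "n \<ge> 1"
  shows "prob_space (P_gap n)"
proof
  interpret prob_space "gap_law n" by (rule prob_space_gap_law)
  show "emeasure (P_gap n) (space (P_gap n)) = 1"
    using nn_integral_P_gap[OF assms, of "\<lambda>_. 1"] emeasure_space_1
    by (simp add: translation_invariant_def permutation_invariant_def)
qed

section \<open>Moments of the gaps and the spread\<close>

lemma scaled_exponential_moment:
  assumes "l > 0"
  shows "integrable (density lborel (exponential_density l)) (\<lambda>x. (l * x) ^ m)"
    and "(\<integral>x. (l * x) ^ m \<partial>density lborel (exponential_density l)) = fact m"
proof -
  interpret prob_space "density lborel (exponential_density l)"
    using assms by (rule prob_space_exponential_density)
  have "distributed (density lborel (exponential_density l)) lborel (\<lambda>x. x) (exponential_density l)"
    unfolding distributed_def by (auto intro!: measure_eqI simp: emeasure_distr)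
  from has_bochner_integral_erlang_ith_moment[OF assms this, of m]
  have "has_bochner_integral (density lborel (exponential_density l)) (\<lambda>x. (l * x) ^ m) (fact m)"
    using has_bochner_integral_mult_right[of "l ^ m" _ "\<lambda>x. x ^ m"] assms
    by (fastforce simp: power_mult_distrib)
  then show "integrable (density lborel (exponential_density l)) (\<lambda>x. (l * x) ^ m)"
    "(\<integral>x. (l * x) ^ m \<partial>density lborel (exponential_density l)) = fact m"
    by (auto simp: has_bochner_integral_iff)
qed

definition scaled_gap :: "nat \<Rightarrow> nat \<Rightarrow> (nat \<Rightarrow> real) \<Rightarrow> real" where
  "scaled_gap n k y = gap_rate n k * y k"

lemma scaled_gap_monomial_moment:
  shows "integrable (gap_law n) (\<lambda>y. \<Prod>k\<in>{1..<n}. scaled_gap n k y ^ m k)"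
    and "(\<integral>y. (\<Prod>k\<in>{1..<n}. scaled_gap n k y ^ m k) \<partial>gap_law n) = (\<Prod>k\<in>{1..<n}. fact (m k))"
  unfolding gap_law_def scaled_gap_def
  using gap_product.product_integrable_prod[of "{1..<n}" n "\<lambda>k x. (gap_rate n k * x) ^ m k"]
    gap_product.product_integral_prod[of "{1..<n}" n "\<lambda>k x. (gap_rate n k * x) ^ m k"]
    scaled_exponential_moment[OF gap_rate_pos]
  by (simp_all del: One_nat_def)

lemma prod_of_bool_power:
  fixes x :: "nat \<Rightarrow> real"
  assumes "finite I" "k \<in> I"
  shows "(\<Prod>j\<in>I. x j ^ of_bool (j = k)) = x k"
proof -
  have "(\<Prod>j\<in>I. x j ^ of_bool (j = k)) = (\<Prod>j\<in>I. if j = k then x j else 1)"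
    by (intro prod.cong) auto
  then show ?thesis using assms by (simp add: prod.delta)
qed

lemma sum_of_bool_eq:
  "finite I \<Longrightarrow> k \<in> I \<Longrightarrow> (\<Sum>j\<in>I. of_bool (j = k)) = (1::nat)"
  by (simp add: of_bool_def sum.delta)

lemma prod_fact_le_fact_sum:
  "finite I \<Longrightarrow> (\<Prod>j\<in>I. fact (m j)) \<le> (fact (\<Sum>j\<in>I. m j) :: nat)"
proof (induction I rule: finite_induct)
  case (insert i I)
  then have "(\<Prod>j\<in>insert i I. fact (m j)) \<le> fact (m i) * (fact (\<Sum>j\<in>I. m j) :: nat)"
    by simp
  also have "\<dots> \<le> fact (m i + (\<Sum>j\<in>I. m j))"
    by (intro dvd_imp_le fact_fact_dvd_fact) simp
  finally show ?case using insert by simp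
qed simp

text \<open>A product of scaled gaps is a monomial in independent standard exponential variables, so its
expectation is the product of the factorials of the multiplicities.  Four factors give at most
\<open>4! = 24\<close>, and multiplicities of disjoint index sets do not interact.\<close>

lemma scaled_gap_moments:
  assumes "k \<in> {1..<n}" "l \<in> {1..<n}" "p \<in> {1..<n}" "q \<in> {1..<n}"
  shows integrable_scaled_gap: "integrable (gap_law n) (scaled_gap n k)"
    and expectation_scaled_gap: "(\<integral>y. scaled_gap n k y \<partial>gap_law n) = 1"
    and integrable_scaled_gap_2: "integrable (gap_law n) (\<lambda>y. scaled_gap n k y * scaled_gap n l y)"
    and expectation_scaled_gap_2:
      "(\<integral>y. scaled_gap n k y * scaled_gap n l y \<partial>gap_law n) = 1 + of_bool (k = l)"
    and integrable_scaled_gap_4: "integrable (gap_law n)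
      (\<lambda>y. scaled_gap n k y * scaled_gap n l y * (scaled_gap n p y * scaled_gap n q y))"
    and expectation_scaled_gap_4_le:
      "(\<integral>y. scaled_gap n k y * scaled_gap n l y * (scaled_gap n p y * scaled_gap n q y) \<partial>gap_law n) \<le> 24"
    and expectation_scaled_gap_4_disjoint: "{k, l} \<inter> {p, q} = {} \<Longrightarrow>
      (\<integral>y. scaled_gap n k y * scaled_gap n l y * (scaled_gap n p y * scaled_gap n q y) \<partial>gap_law n)
      = (\<integral>y. scaled_gap n k y * scaled_gap n l y \<partial>gap_law n)
        * (\<integral>y. scaled_gap n p y * scaled_gap n q y \<partial>gap_law n)"
proof -
  let ?I = "{1..<n}" and ?d = "\<lambda>k j. of_bool (j = k) :: nat"
  note single = prod_of_bool_power[OF finite_atLeastLessThan, of _ 1 n, symmetric]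
  have eq1: "scaled_gap n k y = (\<Prod>j\<in>?I. scaled_gap n j y ^ ?d k j)" for y
    using assms by (intro single)
  have eq2: "scaled_gap n k y * scaled_gap n l y = (\<Prod>j\<in>?I. scaled_gap n j y ^ (?d k j + ?d l j))"
    if "k \<in> ?I" "l \<in> ?I" for k l y
    using single[OF that(1), of "\<lambda>j. scaled_gap n j y"] single[OF that(2), of "\<lambda>j. scaled_gap n j y"]
    by (simp add: power_add prod.distrib del: One_nat_def)
  have eq4: "scaled_gap n k y * scaled_gap n l y * (scaled_gap n p y * scaled_gap n q y)
      = (\<Prod>j\<in>?I. scaled_gap n j y ^ (?d k j + ?d l j + (?d p j + ?d q j)))" for y
    using assms by (simp add: eq2 power_add prod.distrib del: One_nat_def)
  note moment = scaled_gap_monomial_moment[of n]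
  show "integrable (gap_law n) (scaled_gap n k)"
  proof -
    have "integrable (gap_law n) (\<lambda>y. scaled_gap n k y)" unfolding eq1 by (rule moment(1))
    then show ?thesis by simp
  qed
  show "(\<integral>y. scaled_gap n k y \<partial>gap_law n) = 1"
    unfolding eq1 moment(2) by (intro prod.neutral) auto
  show "integrable (gap_law n) (\<lambda>y. scaled_gap n k y * scaled_gap n l y)"
    unfolding eq2[OF assms(1,2)] by (rule moment(1))
  have E2: "(\<integral>y. scaled_gap n k y * scaled_gap n l y \<partial>gap_law n) = (\<Prod>j\<in>?I. fact (?d k j + ?d l j))"
    if "k \<in> ?I" "l \<in> ?I" for k l
    unfolding eq2[OF that] by (rule moment(2))
  show "(\<integral>y. scaled_gap n k y * scaled_gap n l y \<partial>gap_law n) = 1 + of_bool (k = l)"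
  proof (cases "k = l")
    case True
    have "(\<Prod>j\<in>?I. fact (?d k j + ?d l j) :: real) = (\<Prod>j\<in>?I. if j = k then 2 else 1)"
      using True by (intro prod.cong) (auto simp: fact_numeral numeral_2_eq_2[symmetric])
    then show ?thesis using True assms by (simp add: E2 prod.delta)
  next
    case False
    then have "(\<Prod>j\<in>?I. fact (?d k j + ?d l j) :: real) = 1"
      by (intro prod.neutral) auto
    then show ?thesis using False assms by (simp add: E2)
  qed
  show "integrable (gap_law n)
      (\<lambda>y. scaled_gap n k y * scaled_gap n l y * (scaled_gap n p y * scaled_gap n q y))"
    unfolding eq4 by (rule moment(1))
  have E4: "(\<integral>y. scaled_gap n k y * scaled_gap n l y * (scaled_gap n p y * scaled_gap n q y) \<partial>gap_law n)
      = (\<Prod>j\<in>?I. fact (?d k j + ?d l j + (?d p j + ?d q j)))"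
    unfolding eq4 by (rule moment(2))
  have "(\<Prod>j\<in>?I. fact (?d k j + ?d l j + (?d p j + ?d q j)))
      \<le> (fact (\<Sum>j\<in>?I. ?d k j + ?d l j + (?d p j + ?d q j)) :: nat)"
    by (intro prod_fact_le_fact_sum) simp
  also have "(\<Sum>j\<in>?I. ?d k j + ?d l j + (?d p j + ?d q j)) = 4"
    using assms by (simp add: sum.distrib sum_of_bool_eq del: One_nat_def)
  finally have "real (\<Prod>j\<in>?I. fact (?d k j + ?d l j + (?d p j + ?d q j))) \<le> real 24"
    by (intro of_nat_mono) (simp add: fact_numeral)
  then show "(\<integral>y. scaled_gap n k y * scaled_gap n l y * (scaled_gap n p y * scaled_gap n q y) \<partial>gap_law n) \<le> 24"
    unfolding E4 by simp
  assume disj: "{k, l} \<inter> {p, q} = {}"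
  have "(\<Prod>j\<in>?I. fact (?d k j + ?d l j + (?d p j + ?d q j)) :: real)
      = (\<Prod>j\<in>?I. fact (?d k j + ?d l j) * fact (?d p j + ?d q j))"
    using disj by (intro prod.cong) auto
  then show "(\<integral>y. scaled_gap n k y * scaled_gap n l y * (scaled_gap n p y * scaled_gap n q y) \<partial>gap_law n)
      = (\<integral>y. scaled_gap n k y * scaled_gap n l y \<partial>gap_law n)
        * (\<integral>y. scaled_gap n p y * scaled_gap n q y \<partial>gap_law n)"
    using assms by (simp only: E4 E2 prod.distrib)
qed

text \<open>The coefficients of the spread as a quadratic form in the scaled gaps.\<close>

definition spread_coeff :: "nat \<Rightarrow> nat \<Rightarrow> nat \<Rightarrow> real" where
  "spread_coeff n k l = 1 / (real (max k l) * (real n - real (min k l)))"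

text \<open>The second-order Taylor term of \<open>R\<close>.\<close>

definition spread :: "nat \<Rightarrow> (nat \<Rightarrow> real) \<Rightarrow> real" where
  "spread n U = pair_sum n (\<lambda>t. t\<^sup>2) U / (2 * (real n)\<^sup>2)"

lemma spread_coeff_sym: "spread_coeff n k l = spread_coeff n l k"
  by (simp add: spread_coeff_def max.commute min.commute)

lemma spread_coeff_nonneg: "k \<in> {1..<n} \<Longrightarrow> spread_coeff n k l \<ge> 0"
  by (auto simp: spread_coeff_def min_def)

lemma spread_gap_profile:
  "spread n (gap_profile n y)
    = (1/2) * (\<Sum>k\<in>{1..<n}. \<Sum>l\<in>{1..<n}. spread_coeff n k l * (scaled_gap n k y * scaled_gap n l y))"
proof -
  have "real (min k l) * (real n - real (max k l)) * (y k * y l) / (real n)\<^sup>2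
      = spread_coeff n k l * (scaled_gap n k y * scaled_gap n l y)" if "k \<in> {1..<n}" "l \<in> {1..<n}" for k l
  proof (cases "k \<le> l")
    case True
    then show ?thesis using that
      by (simp add: spread_coeff_def scaled_gap_def gap_rate_def max_def min_def field_simps power2_eq_square)
  next
    case False
    then show ?thesis using that
      by (simp add: spread_coeff_def scaled_gap_def gap_rate_def max_def min_def field_simps power2_eq_square)
  qed
  then have "(\<Sum>k\<in>{1..<n}. \<Sum>l\<in>{1..<n}. real (min k l) * (real n - real (max k l)) * (y k * y l) / (real n)\<^sup>2)
      = (\<Sum>k\<in>{1..<n}. \<Sum>l\<in>{1..<n}. spread_coeff n k l * (scaled_gap n k y * scaled_gap n l y))"
    by (intro sum.cong refl)
  then show ?thesis
    by (simp add: spread_def pair_sum_square_gap_profile sum_divide_distrib[symmetric])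
qed

text \<open>Raising \<open>N\<close> by one shifts the index \<open>k\<close> in each row.  By partial fractions the shift changes the
total by \<open>- H(N) / (N + 1)\<close>, the new row contributes \<open>H(N + 1) / (N + 1)\<close>, and
\<open>1 / (N + 1)^2\<close> remains.  This is where \<open>\<zeta>(2)\<close> comes from: the left-hand side turns out to be the
expected spread.\<close>

lemma sum_inverse_products_triangle:
  "(\<Sum>l\<in>{1..N}. \<Sum>k\<in>{1..l}. 1 / (real l * (real N + 1 - real k))) = (\<Sum>k\<in>{1..N}. 1 / (real k)\<^sup>2)"
proof (induction N)
  case (Suc N)
  let ?N = "real N + 1"
  define H where "H m = (\<Sum>k\<in>{1..m}. 1 / real k)" for m
  have shift: "(\<Sum>k\<in>{1..l}. 1 / (?N + 1 - real k)) = (\<Sum>k\<in>{1..l}. 1 / (?N - real k)) + 1 / ?N - 1 / (?N - real l)" for l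
    by (induction l) (auto simp: algebra_simps)
  have row: "(\<Sum>k\<in>{1..l}. 1 / (real l * (?N + 1 - real k)))
      = (\<Sum>k\<in>{1..l}. 1 / (real l * (?N - real k))) - 1 / (?N * (?N - real l))" if "l \<in> {1..N}" for l
  proof -
    have "(\<Sum>k\<in>{1..l}. 1 / (real l * (?N + 1 - real k))) = (1 / real l) * (\<Sum>k\<in>{1..l}. 1 / (?N + 1 - real k))"
      by (simp add: sum_distrib_left)
    also have "\<dots> = (1 / real l) * (\<Sum>k\<in>{1..l}. 1 / (?N - real k)) + (1 / real l) * (1 / ?N - 1 / (?N - real l))"
      unfolding shift by (simp add: algebra_simps)
    also have "(1 / real l) * (1 / ?N - 1 / (?N - real l)) = - 1 / (?N * (?N - real l))"
      using that by (simp add: divide_simps) 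
    also have "(1 / real l) * (\<Sum>k\<in>{1..l}. 1 / (?N - real k)) = (\<Sum>k\<in>{1..l}. 1 / (real l * (?N - real k)))"
      by (simp add: sum_distrib_left)
    finally show ?thesis by simp
  qed
  have rev: "(\<Sum>l\<in>{1..m}. 1 / (real m + 1 - real l)) = H m" for m
    unfolding H_def
    by (rule sum.reindex_bij_witness[of _ "\<lambda>k. m + 1 - k" "\<lambda>k. m + 1 - k"]) (auto simp: of_nat_diff)
  have "(\<Sum>l\<in>{1..Suc N}. \<Sum>k\<in>{1..l}. 1 / (real l * (real (Suc N) + 1 - real k)))
      = (\<Sum>l\<in>{1..N}. \<Sum>k\<in>{1..l}. 1 / (real l * (?N + 1 - real k)))
        + (\<Sum>k\<in>{1..Suc N}. 1 / (real (Suc N) * (real (Suc N) + 1 - real k)))"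
    by (simp add: algebra_simps)
  also have "(\<Sum>k\<in>{1..Suc N}. 1 / (real (Suc N) * (real (Suc N) + 1 - real k))) = (1 / ?N) * H (Suc N)"
    unfolding rev[of "Suc N", symmetric] sum_distrib_left
    by (intro sum.cong refl) (simp add: add.commute)
  also have "(\<Sum>l\<in>{1..N}. \<Sum>k\<in>{1..l}. 1 / (real l * (?N + 1 - real k)))
      = (\<Sum>l\<in>{1..N}. (\<Sum>k\<in>{1..l}. 1 / (real l * (?N - real k))) - 1 / (?N * (?N - real l)))"
    by (intro sum.cong refl row)
  also have "\<dots> = (\<Sum>k\<in>{1..N}. 1 / (real k)\<^sup>2) - (1 / ?N) * (\<Sum>l\<in>{1..N}. 1 / (?N - real l))"
    using Suc.IH by (simp add: sum_subtractf sum_distrib_left)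
  also have "(\<Sum>l\<in>{1..N}. 1 / (?N - real l)) = H N" by (rule rev)
  also have "(\<Sum>k\<in>{1..N}. 1 / (real k)\<^sup>2) - (1 / ?N) * H N + (1 / ?N) * H (Suc N)
      = (\<Sum>k\<in>{1..Suc N}. 1 / (real k)\<^sup>2)"
  proof -
    have "H (Suc N) = H N + 1 / ?N" by (simp add: H_def add.commute)
    then show ?thesis by (simp add: algebra_simps power2_eq_square)
  qed
  finally show ?case .
qed simp

section \<open>Mean and variance of the spread\<close>

text \<open>The harmonic number of index \<open>N - 1\<close>, matching the index range of the gaps.\<close>

definition harmonic :: "nat \<Rightarrow> real" where
  "harmonic N = (\<Sum>k\<in>{1..<N}. 1 / real k)"

definition spread_mean :: "nat \<Rightarrow> real" where
  "spread_mean n = (\<Sum>k\<in>{1..<n}. 1 / (real k)\<^sup>2)"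

lemma harmonic_reflect: "(\<Sum>k\<in>{1..<n}. 1 / (real n - real k)) = harmonic n"
  unfolding harmonic_def
  by (rule sum.reindex_bij_witness[of _ "\<lambda>k. n - k" "\<lambda>k. n - k"]) (auto simp: of_nat_diff)

text \<open>The tail is compared with the telescoping series of \<open>1 / (k * (k + 1))\<close>.\<close>

lemma sum_inverse_squares_le:
  assumes "N \<ge> 1"
  shows "(\<Sum>k<M. 1 / (real (Suc k))\<^sup>2) \<le> (\<Sum>k<N. 1 / (real (Suc k))\<^sup>2) + 1 / real N"
proof (cases "M \<le> N")
  case True
  then have "(\<Sum>k<M. 1 / (real (Suc k))\<^sup>2) \<le> (\<Sum>k<N. 1 / (real (Suc k))\<^sup>2)"
    by (intro sum_mono2) auto
  then show ?thesis by (rule order_trans) simp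
next
  case False
  have "(\<Sum>k<N + d. 1 / (real (Suc k))\<^sup>2) \<le> (\<Sum>k<N. 1 / (real (Suc k))\<^sup>2) + 1 / real N - 1 / real (N + d)" for d
  proof (induction d)
    case (Suc d)
    define x where "x = real (N + d)"
    have x: "x > 0" using assms by (simp add: x_def)
    have "1 / (x + 1)\<^sup>2 \<le> 1 / (x * (x + 1))"
      using x by (intro divide_left_mono) (auto simp: power2_eq_square)
    also have "\<dots> = 1 / x - 1 / (x + 1)" using x by (simp add: field_simps)
    finally show ?case using Suc.IH by (simp add: x_def add_ac)
  qed simp
  from this[of "M - N"] False have "(\<Sum>k<M. 1 / (real (Suc k))\<^sup>2)
      \<le> (\<Sum>k<N. 1 / (real (Suc k))\<^sup>2) + 1 / real N - 1 / real M" by simp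
  also have "\<dots> \<le> (\<Sum>k<N. 1 / (real (Suc k))\<^sup>2) + 1 / real N" by simp
  finally show ?thesis .
qed

lemma spread_mean_shift: "spread_mean n = (\<Sum>k<n - 1. 1 / (real (Suc k))\<^sup>2)"
  unfolding spread_mean_def
  by (rule sum.reindex_bij_witness[of _ Suc "\<lambda>k. k - 1"]) auto

lemma spread_mean_bounds: "0 \<le> spread_mean n" "spread_mean n \<le> 2"
  using sum_inverse_squares_le[of 1 "n - 1"]
  by (simp_all add: spread_mean_shift sum_nonneg)

lemma spread_mean_zeta:
  assumes "n \<ge> 2"
  shows "\<bar>spread_mean n - zeta 2\<bar> \<le> 1 / (real n - 1)"
proof -
  let ?f = "\<lambda>k. 1 / (real (Suc k))\<^sup>2"
  have zeta: "zeta 2 = suminf ?f" by (simp add: zeta_def)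
  have summable: "summable ?f"
    using sum_inverse_squares_le[of 1] by (intro summableI_nonneg_bounded) auto
  have "spread_mean n \<le> zeta 2"
    unfolding zeta spread_mean_shift using summable by (intro sum_le_suminf) auto
  moreover have "zeta 2 \<le> spread_mean n + 1 / (real n - 1)"
    unfolding zeta spread_mean_shift
    using summable sum_inverse_squares_le[of "n - 1"] assms
    by (intro suminf_le_const) (auto simp: of_nat_diff)
  ultimately show ?thesis by simp
qed

definition spread_row :: "nat \<Rightarrow> nat \<Rightarrow> real" where
  "spread_row n k = (\<Sum>l\<in>{1..<n}. spread_coeff n k l)"

text \<open>With \<open>x = max k l\<close> and \<open>d = n - min k l\<close>, partial fractions give
\<open>1 / (x * d) = (1 / x + 1 / d) / (x + d)\<close>, and \<open>x + d \<ge> n\<close>.\<close>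

lemma spread_coeff_le:
  assumes "k \<in> {1..<n}" "l \<in> {1..<n}"
  shows "spread_coeff n k l \<le> (1 / real n) * (1 / real l + 1 / (real n - real l))"
proof -
  define x d where "x = real (max k l)" and "d = real n - real (min k l)"
  have pos: "x > 0" "d > 0" "x + d \<ge> real n" "real n > 0" "x \<ge> real l" "d \<ge> real n - real l"
    using assms by (auto simp: x_def d_def max_def min_def)
  have "spread_coeff n k l = (1 / (x + d)) * (1 / x + 1 / d)"
    using pos by (simp add: spread_coeff_def divide_simps flip: x_def d_def)
  also have "\<dots> \<le> (1 / real n) * (1 / real l + 1 / (real n - real l))"
    using pos assms by (intro mult_mono add_mono divide_left_mono add_nonneg_nonneg) auto
  finally show ?thesis .
qed

text \<open>The upper bound is of order \<open>log n / n\<close>, although the rows add up to a bounded total.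
This is the source of the rate in the theorem.\<close>

lemma spread_row_bounds:
  assumes "k \<in> {1..<n}"
  shows "0 \<le> spread_row n k" "spread_row n k \<le> 2 * harmonic n / real n"
proof -
  show "0 \<le> spread_row n k"
    unfolding spread_row_def using assms by (intro sum_nonneg spread_coeff_nonneg)
  have "spread_row n k \<le> (\<Sum>l\<in>{1..<n}. (1 / real n) * (1 / real l + 1 / (real n - real l)))"
    unfolding spread_row_def using assms by (intro sum_mono spread_coeff_le)
  also have "\<dots> = 2 * harmonic n / real n"
    unfolding sum_distrib_left[symmetric] sum.distrib harmonic_reflect by (simp add: harmonic_def)
  finally show "spread_row n k \<le> 2 * harmonic n / real n" .
qed

text \<open>By symmetry, and since the diagonal is counted twice, the sum is twice the sum over \<open>k \<le> l\<close>.\<close>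

lemma spread_mean_eq_sum:
  assumes "n \<ge> 1"
  shows "(1/2) * (\<Sum>k\<in>{1..<n}. \<Sum>l\<in>{1..<n}. spread_coeff n k l * (1 + of_bool (k = l))) = spread_mean n"
proof -
  let ?I = "{1..<n}"
  let ?u = "\<lambda>k l. if k \<le> l then spread_coeff n k l else 0"
  have "(\<Sum>k\<in>?I. \<Sum>l\<in>?I. spread_coeff n k l * (1 + of_bool (k = l))) = (\<Sum>k\<in>?I. \<Sum>l\<in>?I. ?u k l + ?u l k)"
    by (intro sum.cong refl) (auto simp: spread_coeff_sym)
  also have "\<dots> = (\<Sum>k\<in>?I. \<Sum>l\<in>?I. ?u k l) + (\<Sum>k\<in>?I. \<Sum>l\<in>?I. ?u l k)"
    by (simp only: sum.distrib)
  also have "(\<Sum>k\<in>?I. \<Sum>l\<in>?I. ?u k l) = (\<Sum>k\<in>?I. \<Sum>l\<in>?I. ?u l k)"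
    by (rule sum.swap)
  also have "(\<Sum>l\<in>?I. \<Sum>k\<in>?I. ?u k l) = (\<Sum>l\<in>{1..n - 1}. \<Sum>k\<in>{1..l}. 1 / (real l * (real (n - 1) + 1 - real k)))"
  proof (rule sum.cong)
    fix l assume l: "l \<in> {1..n - 1}"
    then have "(\<Sum>k\<in>?I. ?u k l) = (\<Sum>k\<in>{1..l}. spread_coeff n k l)"
      by (intro sum.mono_neutral_cong_right) auto
    also have "\<dots> = (\<Sum>k\<in>{1..l}. 1 / (real l * (real (n - 1) + 1 - real k)))"
      using l by (intro sum.cong refl) (auto simp: spread_coeff_def of_nat_diff max_def min_def)
    finally show "(\<Sum>k\<in>?I. ?u k l) = (\<Sum>k\<in>{1..l}. 1 / (real l * (real (n - 1) + 1 - real k)))" .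
  qed (use assms in auto)
  also have "\<dots> = (\<Sum>k\<in>{1..n - 1}. 1 / (real k)\<^sup>2)"
    by (rule sum_inverse_products_triangle)
  also have "\<dots> = spread_mean n"
    unfolding spread_mean_def using assms by (intro sum.cong) auto
  finally show ?thesis by simp
qed

lemma sum_spread_row_le:
  assumes "n \<ge> 1"
  shows "(\<Sum>k\<in>{1..<n}. spread_row n k) \<le> 4"
proof -
  have "(\<Sum>k\<in>{1..<n}. spread_row n k) \<le> (\<Sum>k\<in>{1..<n}. \<Sum>l\<in>{1..<n}. spread_coeff n k l * (1 + of_bool (k = l)))"
    unfolding spread_row_def
    by (intro sum_mono) (use spread_coeff_nonneg in force)
  also have "\<dots> = 2 * spread_mean n" using spread_mean_eq_sum[OF assms] by simp
  finally show ?thesis using spread_mean_bounds(2)[of n] by simp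
qed

lemma expectation_spread:
  assumes "n \<ge> 1"
  shows "integrable (gap_law n) (\<lambda>y. spread n (gap_profile n y))"
    and "(\<integral>y. spread n (gap_profile n y) \<partial>gap_law n) = spread_mean n"
proof -
  let ?I = "{1..<n}"
  have int: "integrable (gap_law n) (\<lambda>y. spread_coeff n k l * (scaled_gap n k y * scaled_gap n l y))"
    if "k \<in> ?I" "l \<in> ?I" for k l
    using integrable_scaled_gap_2[OF that that] by simp
  show "integrable (gap_law n) (\<lambda>y. spread n (gap_profile n y))"
    unfolding spread_gap_profile
    by (rule integrable_mult_right) (intro Bochner_Integration.integrable_sum int)
  have "(\<integral>y. spread n (gap_profile n y) \<partial>gap_law n)
      = (1/2) * (\<Sum>k\<in>?I. \<Sum>l\<in>?I. spread_coeff n k l * (\<integral>y. scaled_gap n k y * scaled_gap n l y \<partial>gap_law n))"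
    unfolding spread_gap_profile integral_mult_right_zero
    by (intro arg_cong2[where f = "(*)"] refl,
        (subst Bochner_Integration.integral_sum, (intro Bochner_Integration.integrable_sum int; assumption),
          intro sum.cong refl)+, rule integral_mult_right_zero)
  also have "\<dots> = (1/2) * (\<Sum>k\<in>?I. \<Sum>l\<in>?I. spread_coeff n k l * (1 + of_bool (k = l)))"
    by (intro arg_cong2[where f = "(*)"] sum.cong refl) (simp add: expectation_scaled_gap_2 del: One_nat_def)
  finally show "(\<integral>y. spread n (gap_profile n y) \<partial>gap_law n) = spread_mean n"
    using spread_mean_eq_sum[OF assms] by simp
qed

lemma spread_square_gap_profile:
  "(spread n (gap_profile n y))\<^sup>2 = (1/4) * (\<Sum>k\<in>{1..<n}. \<Sum>l\<in>{1..<n}. \<Sum>p\<in>{1..<n}. \<Sum>q\<in>{1..<n}.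
    spread_coeff n k l * spread_coeff n p q
      * (scaled_gap n k y * scaled_gap n l y * (scaled_gap n p y * scaled_gap n q y)))"
proof -
  let ?s = "\<Sum>k\<in>{1..<n}. \<Sum>l\<in>{1..<n}. spread_coeff n k l * (scaled_gap n k y * scaled_gap n l y)"
  have "?s * ?s = (\<Sum>k\<in>{1..<n}. \<Sum>l\<in>{1..<n}. \<Sum>p\<in>{1..<n}. \<Sum>q\<in>{1..<n}.
    spread_coeff n k l * spread_coeff n p q
      * (scaled_gap n k y * scaled_gap n l y * (scaled_gap n p y * scaled_gap n q y)))"
    unfolding sum_distrib_right
    by (intro sum.cong refl) (simp add: sum_distrib_left mult_ac)
  moreover have "(spread n (gap_profile n y))\<^sup>2 = (1/4) * (?s * ?s)"
    unfolding spread_gap_profile by (simp add: power2_eq_square)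
  ultimately show ?thesis by (simp only:)
qed

text \<open>Expand the square.  Pairs \<open>(k, l)\<close> and \<open>(p, q)\<close> without a common index are uncorrelated, and the
others have covariance at most \<open>24\<close>.  Since \<open>(k, l)\<close> and \<open>(p, q)\<close> can share an index in four ways,
the variance is at most \<open>24\<close> times the sum of the squared row sums, hence at most \<open>24\<close> times the
largest row sum times the total.\<close>

lemma variance_spread_le:
  assumes n: "n \<ge> 1"
  shows "integrable (gap_law n) (\<lambda>y. (spread n (gap_profile n y) - spread_mean n)\<^sup>2)"
    and "(\<integral>y. (spread n (gap_profile n y) - spread_mean n)\<^sup>2 \<partial>gap_law n) \<le> 192 * harmonic n / real n"
proof -
  interpret prob_space "gap_law n" by (rule prob_space_gap_law)
  let ?I = "{1..<n}" and ?b = "spread_coeff n" and ?m = "spread_mean n"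
  let ?S = "\<lambda>y. spread n (gap_profile n y)"
  let ?Q2 = "\<lambda>k l y. scaled_gap n k y * scaled_gap n l y"
  let ?Q4 = "\<lambda>k l p q y. ?Q2 k l y * ?Q2 p q y"
  note S = expectation_spread[OF n]
  have int4: "integrable (gap_law n) (\<lambda>y. ?b k l * ?b p q * ?Q4 k l p q y)"
    if "k \<in> ?I" "l \<in> ?I" "p \<in> ?I" "q \<in> ?I" for k l p q
    using integrable_scaled_gap_4[OF that] by simp
  have S2_int: "integrable (gap_law n) (\<lambda>y. (?S y)\<^sup>2)"
    unfolding spread_square_gap_profile
    by (rule integrable_mult_right) (intro Bochner_Integration.integrable_sum int4)
  have S2: "(\<integral>y. (?S y)\<^sup>2 \<partial>gap_law n)
      = (1/4) * (\<Sum>k\<in>?I. \<Sum>l\<in>?I. \<Sum>p\<in>?I. \<Sum>q\<in>?I. ?b k l * ?b p q * (\<integral>y. ?Q4 k l p q y \<partial>gap_law n))"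
    unfolding spread_square_gap_profile integral_mult_right_zero
    by (intro arg_cong2[where f = "(*)"] refl,
        (subst Bochner_Integration.integral_sum, (intro Bochner_Integration.integrable_sum int4; assumption),
          intro sum.cong refl)+, rule integral_mult_right_zero)
  have m: "?m = (1/2) * (\<Sum>k\<in>?I. \<Sum>l\<in>?I. ?b k l * (\<integral>y. ?Q2 k l y \<partial>gap_law n))"
    unfolding spread_mean_eq_sum[OF n, symmetric]
    by (intro arg_cong2[where f = "(*)"] sum.cong refl) (simp add: expectation_scaled_gap_2 del: One_nat_def)
  have m2: "?m\<^sup>2 = (1/4) * (\<Sum>k\<in>?I. \<Sum>l\<in>?I. \<Sum>p\<in>?I. \<Sum>q\<in>?I. ?b k l * ?b p q
      * ((\<integral>y. ?Q2 k l y \<partial>gap_law n) * (\<integral>y. ?Q2 p q y \<partial>gap_law n)))"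
  proof -
    let ?s = "\<Sum>k\<in>?I. \<Sum>l\<in>?I. ?b k l * (\<integral>y. ?Q2 k l y \<partial>gap_law n)"
    have "?s * ?s = (\<Sum>k\<in>?I. \<Sum>l\<in>?I. \<Sum>p\<in>?I. \<Sum>q\<in>?I. ?b k l * ?b p q
      * ((\<integral>y. ?Q2 k l y \<partial>gap_law n) * (\<integral>y. ?Q2 p q y \<partial>gap_law n)))"
      unfolding sum_distrib_right
      by (intro sum.cong refl) (simp add: sum_distrib_left mult_ac)
    moreover have "?m\<^sup>2 = (1/4) * (?s * ?s)"
      unfolding m by (simp add: power2_eq_square)
    ultimately show ?thesis by (simp only:)
  qed
  have dev: "(?S y - ?m)\<^sup>2 = (?S y)\<^sup>2 - 2 * ?m * ?S y + ?m\<^sup>2" for y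
    by (simp add: power2_eq_square algebra_simps)
  show "integrable (gap_law n) (\<lambda>y. (?S y - ?m)\<^sup>2)"
    unfolding dev using S(1) S2_int by simp
  have "(\<integral>y. (?S y - ?m)\<^sup>2 \<partial>gap_law n) = (\<integral>y. (?S y)\<^sup>2 \<partial>gap_law n) - ?m\<^sup>2"
    unfolding dev using S S2_int prob_space by (simp add: power2_eq_square)
  also have "\<dots> = (1/4) * (\<Sum>k\<in>?I. \<Sum>l\<in>?I. \<Sum>p\<in>?I. \<Sum>q\<in>?I. ?b k l * ?b p q
      * ((\<integral>y. ?Q4 k l p q y \<partial>gap_law n) - (\<integral>y. ?Q2 k l y \<partial>gap_law n) * (\<integral>y. ?Q2 p q y \<partial>gap_law n)))"
    unfolding S2 m2 by (simp add: sum_subtractf right_diff_distrib)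
  also have "\<dots> \<le> (1/4) * (\<Sum>k\<in>?I. \<Sum>l\<in>?I. \<Sum>p\<in>?I. \<Sum>q\<in>?I. ?b k l * ?b p q
      * (24 * (of_bool (p = k) + of_bool (q = k) + of_bool (p = l) + of_bool (q = l))))"
  proof (intro mult_left_mono sum_mono mult_nonneg_nonneg spread_coeff_nonneg)
    fix k l p q assume I: "k \<in> ?I" "l \<in> ?I" "p \<in> ?I" "q \<in> ?I"
    show "(\<integral>y. ?Q4 k l p q y \<partial>gap_law n) - (\<integral>y. ?Q2 k l y \<partial>gap_law n) * (\<integral>y. ?Q2 p q y \<partial>gap_law n)
        \<le> 24 * (of_bool (p = k) + of_bool (q = k) + of_bool (p = l) + of_bool (q = l))"
    proof (cases "{k, l} \<inter> {p, q} = {}")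
      case True
      then show ?thesis using expectation_scaled_gap_4_disjoint[OF I True] by simp
    next
      case False
      then have "1 \<le> (of_bool (p = k) + of_bool (q = k) + of_bool (p = l) + of_bool (q = l) :: real)"
        by auto
      moreover have "0 \<le> (\<integral>y. ?Q2 k l y \<partial>gap_law n) * (\<integral>y. ?Q2 p q y \<partial>gap_law n)"
        using I by (simp add: expectation_scaled_gap_2 del: One_nat_def)
      moreover have "a - b \<le> 24 * x" if "a \<le> 24" "0 \<le> b" "1 \<le> x" for a b x :: real
        using that by linarith
      ultimately show ?thesis using expectation_scaled_gap_4_le[OF I] by blast
    qed
  qed auto
  also have "\<dots> = 24 * (\<Sum>k\<in>?I. (spread_row n k)\<^sup>2)"
  proof -
    have row: "(\<Sum>p\<in>?I. \<Sum>q\<in>?I. ?b p q * of_bool (p = k)) = spread_row n k"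
      "(\<Sum>p\<in>?I. \<Sum>q\<in>?I. ?b p q * of_bool (q = k)) = spread_row n k" if "k \<in> ?I" for k
    proof -
      have "(\<Sum>p\<in>?I. \<Sum>q\<in>?I. ?b p q * of_bool (p = k)) = (\<Sum>p\<in>?I. if p = k then spread_row n p else 0)"
        by (intro sum.cong refl) (auto simp: spread_row_def)
      then show "(\<Sum>p\<in>?I. \<Sum>q\<in>?I. ?b p q * of_bool (p = k)) = spread_row n k"
        using that by (simp add: sum.delta)
      have "(\<Sum>p\<in>?I. \<Sum>q\<in>?I. ?b p q * of_bool (q = k)) = (\<Sum>p\<in>?I. ?b k p)"
      proof (rule sum.cong[OF refl])
        fix p
        have "(\<Sum>q\<in>?I. ?b p q * of_bool (q = k)) = (\<Sum>q\<in>?I. if q = k then ?b p q else 0)"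
          by (intro sum.cong refl) auto
        then show "(\<Sum>q\<in>?I. ?b p q * of_bool (q = k)) = ?b k p"
          using that spread_coeff_sym[of n p k] by (simp add: sum.delta)
      qed
      then show "(\<Sum>p\<in>?I. \<Sum>q\<in>?I. ?b p q * of_bool (q = k)) = spread_row n k"
        by (simp add: spread_row_def)
    qed
    have inner: "(\<Sum>p\<in>?I. \<Sum>q\<in>?I. ?b k l * ?b p q
        * (24 * (of_bool (p = k) + of_bool (q = k) + of_bool (p = l) + of_bool (q = l))))
        = 48 * (?b k l * spread_row n k + ?b k l * spread_row n l)" if kl: "k \<in> ?I" "l \<in> ?I" for k l
    proof -
      have "(\<Sum>p\<in>?I. \<Sum>q\<in>?I. ?b k l * ?b p q
        * (24 * (of_bool (p = k) + of_bool (q = k) + of_bool (p = l) + of_bool (q = l))))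
        = (24 * ?b k l) * (\<Sum>p\<in>?I. \<Sum>q\<in>?I. ?b p q * of_bool (p = k) + ?b p q * of_bool (q = k)
            + ?b p q * of_bool (p = l) + ?b p q * of_bool (q = l))"
        unfolding sum_distrib_left by (intro sum.cong refl) (simp add: algebra_simps)
      also have "\<dots> = (24 * ?b k l) * (2 * spread_row n k + 2 * spread_row n l)"
        unfolding sum.distrib using row[OF kl(1)] row[OF kl(2)] by simp
      finally show ?thesis by (simp add: algebra_simps)
    qed
    have 1: "(\<Sum>k\<in>?I. \<Sum>l\<in>?I. ?b k l * spread_row n k) = (\<Sum>k\<in>?I. (spread_row n k)\<^sup>2)"
      unfolding sum_distrib_right[symmetric] spread_row_def[symmetric] power2_eq_square ..
    have 2: "(\<Sum>k\<in>?I. \<Sum>l\<in>?I. ?b k l * spread_row n l) = (\<Sum>k\<in>?I. (spread_row n k)\<^sup>2)"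
    proof -
      have "(\<Sum>k\<in>?I. \<Sum>l\<in>?I. ?b k l * spread_row n l) = (\<Sum>l\<in>?I. \<Sum>k\<in>?I. ?b k l * spread_row n l)"
        by (rule sum.swap)
      also have "\<dots> = (\<Sum>l\<in>?I. \<Sum>k\<in>?I. ?b l k * spread_row n l)"
        by (intro sum.cong refl) (simp only: spread_coeff_sym)
      finally show ?thesis by (simp only: 1)
    qed
    have "(\<Sum>k\<in>?I. \<Sum>l\<in>?I. \<Sum>p\<in>?I. \<Sum>q\<in>?I. ?b k l * ?b p q
        * (24 * (of_bool (p = k) + of_bool (q = k) + of_bool (p = l) + of_bool (q = l))))
        = (\<Sum>k\<in>?I. \<Sum>l\<in>?I. 48 * (?b k l * spread_row n k + ?b k l * spread_row n l))"
      by (intro sum.cong refl inner)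
    also have "\<dots> = 96 * (\<Sum>k\<in>?I. (spread_row n k)\<^sup>2)"
      unfolding sum_distrib_left[symmetric] sum.distrib 1 2 by simp
    finally show ?thesis by simp
  qed
  also have "\<dots> \<le> 24 * (\<Sum>k\<in>?I. 2 * harmonic n / real n * spread_row n k)"
    unfolding power2_eq_square
    by (intro mult_left_mono sum_mono mult_right_mono spread_row_bounds) auto
  also have "\<dots> = 48 * harmonic n / real n * (\<Sum>k\<in>?I. spread_row n k)"
    by (simp add: sum_distrib_left mult.assoc)
  also have "\<dots> \<le> 48 * harmonic n / real n * 4"
    using sum_spread_row_le[OF n] by (intro mult_left_mono) (auto simp: harmonic_def sum_nonneg)
  finally show "(\<integral>y. (?S y - ?m)\<^sup>2 \<partial>gap_law n) \<le> 192 * harmonic n / real n" by simp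
qed

lemma expectation_abs_spread_deviation_le:
  assumes n: "n \<ge> 2"
  shows "integrable (gap_law n) (\<lambda>y. \<bar>spread n (gap_profile n y) - spread_mean n\<bar>)"
    and "(\<integral>y. \<bar>spread n (gap_profile n y) - spread_mean n\<bar> \<partial>gap_law n) \<le> sqrt (192 * harmonic n / real n)"
proof -
  interpret prob_space "gap_law n" by (rule prob_space_gap_law)
  have n': "n \<ge> 1" using n by simp
  let ?Y = "\<lambda>y. spread n (gap_profile n y) - spread_mean n"
  note var = variance_spread_le[OF n']
  show int: "integrable (gap_law n) (\<lambda>y. \<bar>?Y y\<bar>)"
    using expectation_spread(1)[OF n'] by simp
  (* The bound 2 * e * |Y| <= e^2 + Y^2 is optimal for e of the size of the standard deviation. *)
  define e where "e = sqrt (192 * harmonic n / real n)"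
  have "harmonic n \<ge> (\<Sum>k\<in>{1::nat}. 1 / real k)"
    unfolding harmonic_def using n by (intro sum_mono2) auto
  then have "192 * harmonic n / real n > 0" using n by simp
  then have e: "e > 0" "e\<^sup>2 = 192 * harmonic n / real n" by (auto simp: e_def)
  have "(\<integral>y. \<bar>?Y y\<bar> \<partial>gap_law n) \<le> (\<integral>y. (e + (?Y y)\<^sup>2 / e) / 2 \<partial>gap_law n)"
  proof (rule integral_mono)
    show "integrable (gap_law n) (\<lambda>y. (e + (?Y y)\<^sup>2 / e) / 2)" using var(1) by simp
    fix y
    have "0 \<le> (\<bar>?Y y\<bar> - e)\<^sup>2" by simp
    then have "2 * e * \<bar>?Y y\<bar> \<le> e\<^sup>2 + (?Y y)\<^sup>2" by (simp add: power2_diff algebra_simps)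
    then show "\<bar>?Y y\<bar> \<le> (e + (?Y y)\<^sup>2 / e) / 2"
      using e(1) by (simp add: field_simps power2_eq_square)
  qed (rule int)
  also have "\<dots> = (e + (\<integral>y. (?Y y)\<^sup>2 \<partial>gap_law n) / e) / 2"
    using var(1) prob_space by simp
  also have "\<dots> \<le> (e + e\<^sup>2 / e) / 2"
    using var(2) e by (intro divide_right_mono add_left_mono) auto
  also have "\<dots> = e" using e(1) by (simp add: power2_eq_square)
  finally show "(\<integral>y. \<bar>?Y y\<bar> \<partial>gap_law n) \<le> sqrt (192 * harmonic n / real n)"
    by (simp only: e_def)
qed

lemma expectation_osc:
  assumes n: "n \<ge> 2"
  shows "integrable (gap_law n) (\<lambda>y. \<Sum>k\<in>{1..<n}. y k)"
    and "(\<integral>y. (\<Sum>k\<in>{1..<n}. y k) \<partial>gap_law n) = 2 * harmonic n"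
proof -
  have eq: "y k = (1 / real k + 1 / (real n - real k)) * scaled_gap n k y" if "k \<in> {1..<n}" for k y
    using that by (simp add: scaled_gap_def gap_rate_def field_simps)
  have int: "integrable (gap_law n) (\<lambda>y. y k)" if "k \<in> {1..<n}" for k
  proof -
    have "integrable (gap_law n) (\<lambda>y. (1 / real k + 1 / (real n - real k)) * scaled_gap n k y)"
      using integrable_scaled_gap[OF that that that that] by simp
    then show ?thesis by (simp only: eq[OF that, symmetric])
  qed
  then show "integrable (gap_law n) (\<lambda>y. \<Sum>k\<in>{1..<n}. y k)"
    by (intro Bochner_Integration.integrable_sum)
  have "(\<integral>y. y k \<partial>gap_law n) = 1 / real k + 1 / (real n - real k)" if "k \<in> {1..<n}" for k
  proof -
    have "(\<integral>y. (1 / real k + 1 / (real n - real k)) * scaled_gap n k y \<partial>gap_law n)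
        = 1 / real k + 1 / (real n - real k)"
      using expectation_scaled_gap[OF that that that that] by simp
    then show ?thesis by (simp only: eq[OF that, symmetric])
  qed
  then have "(\<integral>y. (\<Sum>k\<in>{1..<n}. y k) \<partial>gap_law n) = (\<Sum>k\<in>{1..<n}. 1 / real k + 1 / (real n - real k))"
    using int by (simp add: Bochner_Integration.integral_sum del: One_nat_def)
  then show "(\<integral>y. (\<Sum>k\<in>{1..<n}. y k) \<partial>gap_law n) = 2 * harmonic n"
    unfolding sum.distrib harmonic_reflect by (simp add: harmonic_def)
qed

section \<open>The product of the normalizing integrals\<close>

lemma rho_nonneg: "rho n t \<ge> 0"
  by (simp add: rho_def)

lemma omega_nonneg: "omega n t \<ge> 0"
  by (auto simp: omega_def)

lemma continuous_on_rho: "continuous_on A (\<lambda>a. rho n (a + c))"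
  unfolding rho_def divide_inverse by (intro continuous_intros)

lemma rho_measurable [measurable]: "rho n \<in> borel_measurable borel"
  unfolding rho_def by measurable

lemma omega_measurable [measurable]: "omega n \<in> borel_measurable borel"
  unfolding omega_def by measurable

lemma rho_has_derivative:
  assumes n: "n \<ge> 1" and t: "t \<noteq> 0" "t \<noteq> real n"
  shows "(rho n has_real_derivative - (omega n t * rho n t / real n)) (at t)"
proof -
  consider "t < 0" | "0 < t" "t < real n" | "t > real n" using t by linarith
  then show ?thesis
  proof cases
    case 1
    have "((\<lambda>_. 1) has_real_derivative 0) (at t)" by simp
    then have "(rho n has_real_derivative 0) (at t)"
      by (rule has_field_derivative_transform_within_open[of _ _ _ "{..<0}"]) (use 1 in \<open>auto simp: rho_def\<close>)
    then show ?thesis using 1 by (simp add: omega_def)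
  next
    case 2
    have "((\<lambda>t. 1 - t / real n) has_real_derivative - (1 / real n)) (at t)"
      using n by (auto intro!: derivative_eq_intros)
    then have "(rho n has_real_derivative - (1 / real n)) (at t)"
      by (rule has_field_derivative_transform_within_open[of _ _ _ "{0<..<real n}"])
         (use 2 n in \<open>auto simp: rho_def max_def field_simps\<close>)
    moreover have "omega n t * rho n t = 1"
      using 2 n by (auto simp: omega_def rho_def max_def field_simps)
    ultimately show ?thesis by simp
  next
    case 3
    have "((\<lambda>_. 0) has_real_derivative 0) (at t)" by simp
    then have "(rho n has_real_derivative 0) (at t)"
      by (rule has_field_derivative_transform_within_open[of _ _ _ "{real n<..}"])
         (use 3 n in \<open>auto simp: rho_def max_def field_simps\<close>)
    then show ?thesis using 3 by (simp add: omega_def)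
  qed
qed

text \<open>On \<open>0 < t < n\<close> the function \<open>omega\<close> is the reciprocal of \<open>rho\<close> and \<open>rho\<close> has slope \<open>- 1 / n\<close>;
elsewhere, off the kinks \<open>0\<close> and \<open>n\<close>, both \<open>omega * rho\<close> and the slope vanish.
Hence \<open>kappa\<close> is \<open>- n\<close> times the logarithmic derivative of \<open>F\<close>, without a division by \<open>F\<close>.\<close>

lemma F_has_derivative:
  assumes n: "n \<ge> 1" and a: "\<And>j. j \<in> {1..n} \<Longrightarrow> a + U j \<noteq> 0 \<and> a + U j \<noteq> real n"
  shows "(F n i U has_real_derivative - (kappa n i U a * F n i U a / real n)) (at a)"
proof -
  let ?J = "{1..n} - {i}"
  have "((\<lambda>a. rho n (a + U j)) has_real_derivative - (omega n (a + U j) * rho n (a + U j) / real n)) (at a)"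
    if "j \<in> ?J" for j
    using rho_has_derivative[OF n, of "a + U j"] a that by (auto simp: DERIV_shift)
  then have "((\<lambda>a. \<Prod>j\<in>?J. rho n (a + U j)) has_real_derivative
      (\<Sum>j\<in>?J. - (omega n (a + U j) * rho n (a + U j) / real n) * (\<Prod>k\<in>?J - {j}. rho n (a + U k)))) (at a)"
    by (rule has_field_derivative_prod)
  also have "(\<Sum>j\<in>?J. - (omega n (a + U j) * rho n (a + U j) / real n) * (\<Prod>k\<in>?J - {j}. rho n (a + U k)))
      = (\<Sum>j\<in>?J. omega n (a + U j) * (- F n i U a / real n))"
  proof (rule sum.cong[OF refl])
    fix j assume "j \<in> ?J"
    then have "F n i U a = rho n (a + U j) * (\<Prod>k\<in>?J - {j}. rho n (a + U k))"
      unfolding F_def by (intro prod.remove) auto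
    then show "- (omega n (a + U j) * rho n (a + U j) / real n) * (\<Prod>k\<in>?J - {j}. rho n (a + U k))
        = omega n (a + U j) * (- F n i U a / real n)" by simp
  qed
  also have "\<dots> = - (kappa n i U a * F n i U a / real n)"
    unfolding kappa_def sum_distrib_right[symmetric] by simp
  finally show ?thesis by (simp add: F_def[abs_def])
qed

lemma kappa_F_nonneg: "kappa n i U a * F n i U a \<ge> 0"
  unfolding kappa_def F_def by (intro mult_nonneg_nonneg sum_nonneg prod_nonneg) (simp_all add: omega_nonneg rho_nonneg)

text \<open>The integrand is the derivative of \<open>- n * F\<close> except at the finitely many kinks.\<close>

lemma Z_eq:
  assumes n: "n \<ge> 1"
  shows "Z n i U = real n * (F n i U (- U i) - F n i U (real n - U i))"
proof -
  let ?A = "{- U i..real n - U i}"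
  let ?g = "\<lambda>a. kappa n i U a * F n i U a"
  let ?S = "(\<lambda>j. - U j) ` {1..n} \<union> (\<lambda>j. real n - U j) ` {1..n}"
  have [measurable]: "kappa n i U \<in> borel_measurable borel" "F n i U \<in> borel_measurable borel"
    unfolding kappa_def[abs_def] F_def[abs_def] by measurable
  have "(?g has_integral - real n * F n i U (real n - U i) - - real n * F n i U (- U i)) ?A"
  proof (rule fundamental_theorem_of_calculus_interior_strong[where S = ?S])
    fix x assume "x \<in> {- U i<..<real n - U i} - ?S"
    then have "x + U j \<noteq> 0 \<and> x + U j \<noteq> real n" if "j \<in> {1..n}" for j
    proof -
      have "x \<noteq> - U j" "x \<noteq> real n - U j" using \<open>x \<in> _\<close> that by auto
      then show ?thesis by auto
    qed
    then have "((\<lambda>a. - real n * F n i U a) has_real_derivative - real n * - (?g x / real n)) (at x)"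
      using DERIV_cmult[OF F_has_derivative[OF n]] by blast
    then show "((\<lambda>a. - real n * F n i U a) has_vector_derivative ?g x) (at x)"
      using n by (simp add: has_real_derivative_iff_has_vector_derivative)
  next
    show "continuous_on ?A (\<lambda>a. - real n * F n i U a)"
      unfolding F_def by (intro continuous_intros continuous_on_rho)
  qed (use n in auto)
  then have "(?g has_integral real n * (F n i U (- U i) - F n i U (real n - U i))) ?A"
    by (simp add: algebra_simps)
  then have "(\<integral>\<^sup>+a. ennreal (indicator ?A a * ?g a) \<partial>lborel)
      = ennreal (real n * (F n i U (- U i) - F n i U (real n - U i)))"
  proof (intro nn_integral_has_integral_lborel)
    assume I: "(?g has_integral real n * (F n i U (- U i) - F n i U (real n - U i))) ?A"
    have "(\<lambda>a. indicator ?A a * ?g a) = (\<lambda>a. if a \<in> ?A then ?g a else 0)"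
      by (auto simp: indicator_def)
    with I show "((\<lambda>a. indicator ?A a * ?g a) has_integral
        real n * (F n i U (- U i) - F n i U (real n - U i))) UNIV"
      by (simp only: has_integral_restrict_UNIV)
  qed (auto simp: kappa_F_nonneg)
  moreover have "0 \<le> real n * (F n i U (- U i) - F n i U (real n - U i))"
    using \<open>(?g has_integral real n * (F n i U (- U i) - F n i U (real n - U i))) ?A\<close> kappa_F_nonneg
    by (rule has_integral_nonneg)
  moreover have "Z n i U = enn2real (\<integral>\<^sup>+a. ennreal (indicator ?A a * ?g a) \<partial>lborel)"
    unfolding Z_def set_lebesgue_integral_def
    by (subst integral_eq_nn_integral) (auto simp: kappa_F_nonneg)
  ultimately show ?thesis by simp
qed

lemma F_at_minus: "F n i U (- U i) = (\<Prod>j\<in>{1..n} - {i}. rho n (U j - U i))"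
  by (simp add: F_def)

text \<open>The boundary term at the right end survives only when \<open>i\<close> is the unique maximizer.\<close>

lemma F_at_n_minus_eq_0:
  assumes "j \<in> {1..n} - {i}" "U i \<le> U j" 
  shows "F n i U (real n - U i) = 0"
  unfolding F_def
proof (rule prod_zero)
  have "real n \<le> real n - U i + U j" using assms by simp
  then have "rho n (real n - U i + U j) = 0"
    using assms(1) by (auto simp: rho_def max_def field_simps)
  then show "\<exists>j\<in>{1..n} - {i}. rho n (real n - U i + U j) = 0" using assms(1) by blast
qed simp

lemma osc_attained:
  assumes "n \<ge> 1"
  obtains i j where "i \<in> {1..n}" "j \<in> {1..n}" "osc n U = U j - U i" "\<And>k. k \<in> {1..n} \<Longrightarrow> U k \<le> U j"
proof -
  have "Max (U ` {1..n}) \<in> U ` {1..n}" "Min (U ` {1..n}) \<in> U ` {1..n}"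
    using assms by (auto intro!: Max_in Min_in)
  then obtain i j where ij: "i \<in> {1..n}" "j \<in> {1..n}" "Max (U ` {1..n}) = U j" "Min (U ` {1..n}) = U i"
    by (metis imageE)
  have "U k \<le> U j" if "k \<in> {1..n}" for k
    using that ij(3) Max_ge[of "U ` {1..n}" "U k"] by simp
  with ij that show thesis by (simp add: osc_def)
qed

text \<open>For each pair, one of the two factors is \<open>1\<close> and the other is \<open>1 - \<bar>U i - U j\<bar> / n\<close>.\<close>

lemma prod_rho_pairs:
  assumes n: "n \<ge> 1" and osc: "osc n U < real n"
  shows "(\<Prod>i\<in>{1..n}. \<Prod>j\<in>{1..n} - {i}. rho n (U j - U i)) = gap_weight n U * exp_neg_R n U"
proof -
  have "(\<Prod>j\<in>{1..n} - {i}. rho n (U j - U i)) = exp (\<Sum>j\<in>{1..n}. ln (rho n (U j - U i)))" if i: "i \<in> {1..n}" for i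
  proof -
    have "rho n (U j - U i) > 0" if "j \<in> {1..n}" for j
      using abs_diff_le_osc[OF that i, of U] osc n by (auto simp: rho_def max_def field_simps)
    then have "(\<Prod>j\<in>{1..n} - {i}. rho n (U j - U i)) = exp (\<Sum>j\<in>{1..n} - {i}. ln (rho n (U j - U i)))"
      by (simp add: exp_sum)
    also have "(\<Sum>j\<in>{1..n} - {i}. ln (rho n (U j - U i))) = (\<Sum>j\<in>{1..n}. ln (rho n (U j - U i)))"
      using i by (subst (2) sum.remove[of _ i]) (auto simp: rho_def)
    finally show ?thesis .
  qed
  then have "(\<Prod>i\<in>{1..n}. \<Prod>j\<in>{1..n} - {i}. rho n (U j - U i))
      = exp (\<Sum>i\<in>{1..n}. \<Sum>j\<in>{1..n}. ln (rho n (U j - U i)))"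
    by (simp add: exp_sum)
  also have "(\<Sum>i\<in>{1..n}. \<Sum>j\<in>{1..n}. ln (rho n (U j - U i)))
      = (\<Sum>i\<in>{1..n}. \<Sum>j\<in>{i<..n}. ln (1 - \<bar>U i - U j\<bar> / real n))"
  proof -
    let ?a = "\<lambda>i j. ln (rho n (U j - U i)) + ln (rho n (U i - U j))"
    have "(\<Sum>i\<in>{1..n}. \<Sum>j\<in>{i<..n}. ?a i j) = (1/2) * (\<Sum>i\<in>{1..n}. \<Sum>j\<in>{1..n}. ?a i j)"
      by (rule sum_pairs_eq_half_sum) (auto simp: rho_def)
    also have "(\<Sum>i\<in>{1..n}. \<Sum>j\<in>{1..n}. ?a i j) = 2 * (\<Sum>i\<in>{1..n}. \<Sum>j\<in>{1..n}. ln (rho n (U j - U i)))"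
      unfolding sum.distrib using sum.swap[of "\<lambda>i j. ln (rho n (U i - U j))" "{1..n}" "{1..n}"] by simp
    finally have "(\<Sum>i\<in>{1..n}. \<Sum>j\<in>{1..n}. ln (rho n (U j - U i))) = (\<Sum>i\<in>{1..n}. \<Sum>j\<in>{i<..n}. ?a i j)"
      by simp
    also have "\<dots> = (\<Sum>i\<in>{1..n}. \<Sum>j\<in>{i<..n}. ln (1 - \<bar>U i - U j\<bar> / real n))"
    proof (intro sum.cong refl)
      fix i j assume ij: "i \<in> {1..n}" "j \<in> {i<..n}"
      then have "\<bar>U i - U j\<bar> < real n" using abs_diff_le_osc[of i n j U] osc by auto
      then show "?a i j = ln (1 - \<bar>U i - U j\<bar> / real n)"
        using n by (auto simp: rho_def max_def abs_if field_simps)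
    qed
    finally show ?thesis .
  qed
  also have "\<dots> = - (1 / real n) * (\<Sum>i\<in>{1..n}. \<Sum>j\<in>{i<..n}. \<bar>U i - U j\<bar>) + - R n U"
  proof -
    have "R n U = - (\<Sum>i\<in>{1..n}. \<Sum>j\<in>{i<..n}. ln (1 - \<bar>U i - U j\<bar> / real n))
        - (\<Sum>i\<in>{1..n}. \<Sum>j\<in>{i<..n}. (1 / real n) * \<bar>U i - U j\<bar>)"
      unfolding R_def by (simp add: sum_subtractf sum_negf)
    also have "(\<Sum>i\<in>{1..n}. \<Sum>j\<in>{i<..n}. (1 / real n) * \<bar>U i - U j\<bar>)
        = (1 / real n) * (\<Sum>i\<in>{1..n}. \<Sum>j\<in>{i<..n}. \<bar>U i - U j\<bar>)"
      by (simp only: sum_distrib_left)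
    finally show ?thesis by simp
  qed
  also have "exp \<dots> = gap_weight n U * exp_neg_R n U"
    using osc by (simp only: exp_add gap_weight_def exp_neg_R_def if_True)
  finally show ?thesis .
qed

text \<open>If the oscillation is below \<open>n\<close>, the boundary term at the right end equals \<open>q_cap\<close> for a unique
maximizer and vanishes for all other indices, while \<open>F\<close> is \<open>1\<close> at the left end for the
maximizer; so the factor \<open>1 - q_cap\<close> splits off.  Otherwise both boundary terms vanish at a minimizer.\<close>

lemma prod_Z:
  assumes n: "n \<ge> 2"
  shows "(\<Prod>i\<in>{1..n}. Z n i U) = real n ^ n * (gap_weight n U * W n U)"
proof -
  have n': "n \<ge> 1" using n by simp
  obtain i0 m where m: "i0 \<in> {1..n}" "m \<in> {1..n}" "osc n U = U m - U i0" and
    max: "\<And>k. k \<in> {1..n} \<Longrightarrow> U k \<le> U m"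
    using osc_attained[OF n', of U] by blast
  show ?thesis
  proof (cases "osc n U < real n")
    case False
    then have ne: "m \<in> {1..n} - {i0}" and le: "U i0 \<le> U m" and big: "real n \<le> U m - U i0"
      using m n by auto
    have "rho n (U m - U i0) = 0" using big n by (auto simp: rho_def max_def field_simps)
    then have "F n i0 U (- U i0) = 0"
      unfolding F_at_minus using ne by (intro prod_zero bexI[of _ m]) auto
    then have "Z n i0 U = 0"
      unfolding Z_eq[OF n'] using F_at_n_minus_eq_0[where U = U, OF ne le] by simp
    then have "(\<Prod>i\<in>{1..n}. Z n i U) = 0" using m(1) by (intro prod_zero bexI[of _ i0]) auto
    then show ?thesis using False by (simp add: W_def exp_neg_R_def)
  next
    case osc: True
    have pr: "(\<Prod>i\<in>{1..n}. F n i U (- U i)) = gap_weight n U * exp_neg_R n U"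
      unfolding F_at_minus by (rule prod_rho_pairs[OF n' osc])
    show ?thesis
    proof (cases "\<exists>!i. is_maximizer n U i")
      case False
      have "F n i U (real n - U i) = 0" if i: "i \<in> {1..n}" for i
      proof -
        have "\<exists>j\<in>{1..n} - {i}. U i \<le> U j"
        proof (cases "i = m")
          case True
          have "is_maximizer n U m" using m max by (simp add: is_maximizer_def)
          then obtain i' where "is_maximizer n U i'" "i' \<noteq> m" using False by blast
          then show ?thesis using True m(2) by (intro bexI[of _ i']) (auto simp: is_maximizer_def)
        next
          case False
          then show ?thesis using m max[OF i] by auto
        qed
        then show ?thesis using F_at_n_minus_eq_0 by blast
      qed
      then have "(\<Prod>i\<in>{1..n}. Z n i U) = (\<Prod>i\<in>{1..n}. real n * F n i U (- U i))"
        by (intro prod.cong refl) (simp add: Z_eq[OF n'])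
      then show ?thesis using False pr by (simp add: prod.distrib W_def q_cap_def)
    next
      case True
      have mm: "is_maximizer n U m" using m max by (simp add: is_maximizer_def)
      have strict: "U j < U m" if "j \<in> {1..n} - {m}" for j
      proof (rule ccontr)
        assume "\<not> U j < U m"
        then have "is_maximizer n U j" using max that m
          by (auto simp: is_maximizer_def) (meson linorder_not_le max order_trans atLeastAtMost_iff One_nat_def)+
        then show False using True mm that by auto
      qed
      have q: "q_cap n U = (\<Prod>j\<in>{1..n} - {m}. (U m - U j) / real n)"
        using osc True the1_equality[OF True mm] by (simp add: q_cap_def)
      have "F n m U (real n - U m) = q_cap n U"
        unfolding q F_def
      proof (rule prod.cong[OF refl])
        fix j assume j: "j \<in> {1..n} - {m}"
        then have "U m - U j < real n" "U j < U m"
          using strict abs_diff_le_osc[of m n j U] m osc by auto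
        then show "rho n (real n - U m + U j) = (U m - U j) / real n"
          using n by (auto simp: rho_def max_def field_simps)
      qed
      moreover have "F n m U (- U m) = 1"
        unfolding F_at_minus using max by (intro prod.neutral) (auto simp: rho_def max_def)
      ultimately have Zm: "Z n m U = real n * F n m U (- U m) * (1 - q_cap n U)"
        by (simp add: Z_eq[OF n'])
      have Zi: "Z n i U = real n * F n i U (- U i)" if "i \<in> {1..n} - {m}" for i
        using that F_at_n_minus_eq_0[of m n i U] m max[of i] by (simp add: Z_eq[OF n'])
      have "(\<Prod>i\<in>{1..n}. Z n i U) = Z n m U * (\<Prod>i\<in>{1..n} - {m}. Z n i U)"
        using m(2) by (intro prod.remove) auto
      also have "(\<Prod>i\<in>{1..n} - {m}. Z n i U) = (\<Prod>i\<in>{1..n} - {m}. real n * F n i U (- U i))"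
        by (intro prod.cong refl Zi)
      also have "Z n m U * \<dots> = (1 - q_cap n U) * (\<Prod>i\<in>{1..n}. real n * F n i U (- U i))"
        using m(2) prod.remove[of "{1..n}" m "\<lambda>i. real n * F n i U (- U i)"] by (simp add: Zm)
      also have "\<dots> = (1 - q_cap n U) * (real n ^ n * (gap_weight n U * exp_neg_R n U))"
        unfolding prod.distrib pr by simp
      finally show ?thesis by (simp add: W_def)
    qed
  qed
qed

section \<open>Concentration of the weight\<close>

lemma ln_one_minus_quadratic:
  fixes t :: real
  assumes "0 \<le> t" "t < 1"
  shows "t\<^sup>2 / 2 \<le> - ln (1 - t) - t"
    and "t \<le> 1/2 \<Longrightarrow> - ln (1 - t) - t \<le> t\<^sup>2 / 2 + t ^ 3"
proof -
  let ?f = "\<lambda>t. - ln (1 - t) - t - t\<^sup>2 / 2"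
  have "?f 0 \<le> ?f t"
  proof (rule DERIV_nonneg_imp_nondecreasing[where f = ?f and a = 0 and b = t])
    fix s assume s: "0 \<le> s" "s \<le> t"
    then have "(?f has_real_derivative s\<^sup>2 / (1 - s)) (at s)"
      using assms by (auto intro!: derivative_eq_intros simp: field_simps power2_eq_square)
    then show "\<exists>d. (?f has_real_derivative d) (at s) \<and> 0 \<le> d" using s assms by auto
  qed (use assms in auto)
  then show "t\<^sup>2 / 2 \<le> - ln (1 - t) - t" by simp
  let ?g = "\<lambda>t. t\<^sup>2 / 2 + t ^ 3 + t + ln (1 - t)"
  assume half: "t \<le> 1/2"
  have "?g 0 \<le> ?g t"
  proof (rule DERIV_nonneg_imp_nondecreasing[where f = ?g and a = 0 and b = t])
    fix s assume s: "0 \<le> s" "s \<le> t"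
    then have "(?g has_real_derivative s + 3 * s\<^sup>2 + 1 - 1 / (1 - s)) (at s)"
      using assms by (auto intro!: derivative_eq_intros simp: power2_eq_square)
    moreover have "0 \<le> s + 3 * s\<^sup>2 + 1 - 1 / (1 - s)"
    proof -
      have "s + 3 * s\<^sup>2 + 1 - 1 / (1 - s) = s\<^sup>2 * (2 - 3 * s) / (1 - s)"
        using s assms by (simp add: field_simps power2_eq_square)
      also have "\<dots> \<ge> 0" using s half assms by (intro divide_nonneg_nonneg mult_nonneg_nonneg) auto
      finally show ?thesis .
    qed
    ultimately show "\<exists>d. (?g has_real_derivative d) (at s) \<and> 0 \<le> d" by blast
  qed (use assms in auto)
  then show "- ln (1 - t) - t \<le> t\<^sup>2 / 2 + t ^ 3" by simp
qed

lemma spread_eq_sum: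
  "spread n U = (\<Sum>i\<in>{1..n}. \<Sum>j\<in>{i<..n}. (\<bar>U i - U j\<bar> / real n)\<^sup>2 / 2)"
  by (simp add: spread_def pair_sum_def sum_divide_distrib power_divide mult.commute)

lemma spread_nonneg: "spread n U \<ge> 0"
  unfolding spread_eq_sum by (intro sum_nonneg) auto

lemma spread_le_R:
  assumes "osc n U < real n"
  shows "spread n U \<le> R n U"
  unfolding spread_eq_sum R_def
proof (intro sum_mono ln_one_minus_quadratic)
  fix i j assume ij: "i \<in> {1..n}" "j \<in> {i<..n}"
  then show "\<bar>U i - U j\<bar> / real n < 1"
    using abs_diff_le_osc[of i n j U] assms by auto
qed auto

text \<open>The cubic remainder of the logarithm is absorbed by one factor \<open>osc n U / n\<close>.\<close>

lemma R_le_spread: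
  assumes n: "n \<ge> 1" and "osc n U \<le> real n / 2"
  shows "R n U \<le> spread n U + 2 * (osc n U / real n) * spread n U"
proof -
  have "R n U \<le> (\<Sum>i\<in>{1..n}. \<Sum>j\<in>{i<..n}.
      (\<bar>U i - U j\<bar> / real n)\<^sup>2 / 2 + 2 * (osc n U / real n) * ((\<bar>U i - U j\<bar> / real n)\<^sup>2 / 2))"
    unfolding R_def
  proof (intro sum_mono)
    fix i j assume ij: "i \<in> {1..n}" "j \<in> {i<..n}"
    define t where "t = \<bar>U i - U j\<bar> / real n"
    have t: "0 \<le> t" "t \<le> osc n U / real n" "t \<le> 1/2"
      using abs_diff_le_osc[of i n j U] ij assms by (auto simp: t_def field_simps)
    have "- ln (1 - t) - t \<le> t\<^sup>2 / 2 + t * t\<^sup>2"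
      using ln_one_minus_quadratic(2)[of t] t by (simp add: power3_eq_cube power2_eq_square)
    also have "\<dots> \<le> t\<^sup>2 / 2 + (osc n U / real n) * t\<^sup>2"
      using t by (intro add_left_mono mult_right_mono) auto
    finally show "- ln (1 - \<bar>U i - U j\<bar> / real n) - \<bar>U i - U j\<bar> / real n
        \<le> (\<bar>U i - U j\<bar> / real n)\<^sup>2 / 2 + 2 * (osc n U / real n) * ((\<bar>U i - U j\<bar> / real n)\<^sup>2 / 2)"
      by (simp add: t_def)
  qed
  also have "\<dots> = spread n U + 2 * (osc n U / real n) * spread n U"
    unfolding spread_eq_sum sum.distrib sum_distrib_left ..
  finally show ?thesis .
qed

text \<open>Unless \<open>q_cap\<close> is \<open>0\<close> by definition, its factors lie in \<open>[0, 1]\<close>, and for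
\<open>n \<ge> 2\<close> there is at least one; it is at most \<open>osc n U / n\<close>.\<close>

lemma q_cap_bounds:
  assumes n: "n \<ge> 2"
  shows "0 \<le> q_cap n U" "q_cap n U \<le> 1" "q_cap n U \<le> osc n U / real n"
proof -
  have osc0: "0 \<le> osc n U" using abs_diff_le_osc[of 1 n 1 U] n by simp
  have "0 \<le> q_cap n U \<and> q_cap n U \<le> 1 \<and> q_cap n U \<le> osc n U / real n"
  proof (cases "osc n U < real n \<and> (\<exists>!m. is_maximizer n U m)")
    case True
    then obtain m where m: "is_maximizer n U m" by blast
    have q: "q_cap n U = (\<Prod>j\<in>{1..n} - {m}. (U m - U j) / real n)"
      using True the1_equality[of "is_maximizer n U" m] m by (simp add: q_cap_def)
    have fac: "0 \<le> (U m - U j) / real n" "(U m - U j) / real n \<le> osc n U / real n"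
        "(U m - U j) / real n \<le> 1" if "j \<in> {1..n} - {m}" for j
    proof -
      have "m \<in> {1..n}" "U j \<le> U m" using m that by (simp_all add: is_maximizer_def)
      then have d: "0 \<le> U m - U j" "U m - U j \<le> osc n U" "U m - U j \<le> real n"
        using abs_diff_le_osc[of m n j U] that True by auto
      show "0 \<le> (U m - U j) / real n" using d(1) by simp
      show "(U m - U j) / real n \<le> osc n U / real n" using d(2) by (intro divide_right_mono) auto
      show "(U m - U j) / real n \<le> 1" using d(3) n by simp
    qed
    have "\<exists>j. j \<in> {1..n} - {m}"
      using n by (intro exI[of _ "if m = 1 then 2 else 1"]) auto
    then obtain j where j: "j \<in> {1..n} - {m}" by blast
    have "q_cap n U = (U m - U j) / real n * (\<Prod>k\<in>{1..n} - {m} - {j}. (U m - U k) / real n)"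
      unfolding q using j by (intro prod.remove) auto
    also have "\<dots> \<le> (U m - U j) / real n * 1"
      using fac j by (intro mult_left_mono prod_le_1) auto
    finally have "q_cap n U \<le> (U m - U j) / real n" by simp
    moreover have "0 \<le> q_cap n U" unfolding q using fac by (intro prod_nonneg) auto
    ultimately show ?thesis using fac[OF j] by linarith
  next
    case False
    then show ?thesis using osc0 by (auto simp: q_cap_def)
  qed
  then show "0 \<le> q_cap n U" "q_cap n U \<le> 1" "q_cap n U \<le> osc n U / real n" by auto
qed

lemma exp_neg_R_bounds: "0 \<le> exp_neg_R n U" "exp_neg_R n U \<le> 1"
  using spread_le_R[of n U] spread_nonneg[of n U] by (auto simp: exp_neg_R_def)

lemma W_bounds:
  assumes "n \<ge> 2"
  shows "0 \<le> W n U" "W n U \<le> 1"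
  using exp_neg_R_bounds[of n U] q_cap_bounds[OF assms, of U] by (auto simp: W_def intro!: mult_le_one)

lemma exp_neg_lipschitz:
  fixes s t :: real
  assumes "0 \<le> s" "0 \<le> t"
  shows "\<bar>exp (- s) - exp (- t)\<bar> \<le> \<bar>s - t\<bar>"
proof -
  have aux: "exp (- s) - exp (- t) \<le> t - s" if "0 \<le> s" "s \<le> t" for s t :: real
  proof -
    have "exp (- s) - exp (- t) = exp (- s) * (1 - exp (- (t - s)))"
      by (simp add: right_diff_distrib flip: exp_add)
    also have "\<dots> \<le> 1 * (t - s)"
    proof (rule mult_mono)
      show "1 - exp (- (t - s)) \<le> t - s" using exp_ge_add_one_self[of "- (t - s)"] by linarith
    qed (use that in auto)
    finally show ?thesis by simp
  qed
  show ?thesis using aux[of s t] aux[of t s] assms by (cases "s \<le> t") auto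
qed

lemma zeta_2_nonneg: "zeta 2 \<ge> 0"
  unfolding zeta_def
  using sum_inverse_squares_le[of 1]
  by (intro suminf_nonneg summableI_nonneg_bounded[where x = 2]) auto

text \<open>Compare \<open>W\<close> with \<open>exp (- R)\<close>, then with \<open>exp (- spread)\<close>, then with the limit.  The error
\<open>R - spread\<close> may be large when the spread is, but it is multiplied by \<open>exp (- spread)\<close>, and
\<open>s * exp (- s) \<le> 1\<close>.  When the oscillation exceeds \<open>n / 2\<close>, the trivial bound \<open>1\<close> suffices.\<close>

lemma W_deviation_le:
  assumes n: "n \<ge> 2"
  shows "\<bar>W n U - exp (- zeta 2)\<bar>
    \<le> 3 * (osc n U / real n) + \<bar>spread n U - spread_mean n\<bar> + \<bar>spread_mean n - zeta 2\<bar>"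
proof (cases "osc n U \<le> real n / 2")
  case False
  have "\<bar>W n U - exp (- zeta 2)\<bar> \<le> 1"
  proof -
    have "exp (- zeta 2) \<le> 1" using zeta_2_nonneg by simp
    then show ?thesis using W_bounds[OF n, of U] exp_gt_zero[of "- zeta 2"] by linarith
  qed
  moreover have "1 \<le> 3 * (osc n U / real n)" using False n by (simp add: field_simps)
  ultimately show ?thesis by linarith
next
  case True
  let ?S = "spread n U" and ?x = "osc n U / real n"
  have osc: "osc n U < real n" and x: "0 \<le> ?x"
    using True n abs_diff_le_osc[of 1 n 1 U] by auto
  have eR: "exp_neg_R n U = exp (- R n U)" using osc by (simp add: exp_neg_R_def)
  have "\<bar>W n U - exp (- R n U)\<bar> = exp_neg_R n U * q_cap n U"
    using exp_neg_R_bounds(1)[of n U] q_cap_bounds[OF n, of U] by (simp add: W_def eR algebra_simps)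
  also have "\<dots> \<le> 1 * ?x"
    using exp_neg_R_bounds[of n U] q_cap_bounds[OF n, of U] by (intro mult_mono) auto
  finally have 1: "\<bar>W n U - exp (- R n U)\<bar> \<le> ?x" by simp
  have "\<bar>exp (- R n U) - exp (- ?S)\<bar> = exp (- ?S) * (1 - exp (- (R n U - ?S)))"
    using spread_le_R[OF osc] by (simp add: right_diff_distrib flip: exp_add)
  also have "\<dots> \<le> exp (- ?S) * (2 * ?x * ?S)"
  proof (rule mult_left_mono)
    have "R n U \<le> ?S + 2 * ?x * ?S" using n by (intro R_le_spread True) auto
    then show "1 - exp (- (R n U - ?S)) \<le> 2 * ?x * ?S"
      using exp_ge_add_one_self[of "- (R n U - ?S)"] by linarith
  qed simp
  also have "\<dots> = (2 * ?x) * (?S * exp (- ?S))" by simp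
  also have "\<dots> \<le> (2 * ?x) * 1"
  proof (rule mult_left_mono)
    have "?S \<le> exp ?S" using exp_ge_add_one_self[of ?S] by linarith
    then show "?S * exp (- ?S) \<le> 1" by (simp add: exp_minus field_simps)
  qed (use x in simp)
  finally have 2: "\<bar>exp (- R n U) - exp (- ?S)\<bar> \<le> 2 * ?x" by simp
  have 3: "\<bar>exp (- ?S) - exp (- zeta 2)\<bar> \<le> \<bar>?S - zeta 2\<bar>"
    using spread_nonneg zeta_2_nonneg by (rule exp_neg_lipschitz)
  show ?thesis using 1 2 3 by linarith
qed

lemma spread_measurable: "spread n \<in> borel_measurable (lebesgue_Pi {1..n})"
proof -
  have [measurable]: "pair_sum n (\<lambda>t. t\<^sup>2) \<in> borel_measurable (lebesgue_Pi {1..n})"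
    by (intro pair_sum_measurable) simp
  show ?thesis unfolding spread_def by measurable
qed

lemma Z_measurable:
  assumes "n \<ge> 1" "i \<in> {1..n}"
  shows "Z n i \<in> borel_measurable (lebesgue_Pi {1..n})"
proof -
  have m: "(\<lambda>U. rho n (c - U i + U j)) \<in> borel_measurable (lebesgue_Pi {1..n})"
    if "j \<in> {1..n} - {i}" for j c
    using assms that
    by (intro measurable_compose[OF _ rho_measurable] borel_measurable_add borel_measurable_diff
          coordinate_measurable borel_measurable_const) auto
  have "(\<lambda>U. real n * ((\<Prod>j\<in>{1..n} - {i}. rho n (0 - U i + U j))
      - (\<Prod>j\<in>{1..n} - {i}. rho n (real n - U i + U j)))) \<in> borel_measurable (lebesgue_Pi {1..n})"
    by (intro borel_measurable_times borel_measurable_diff borel_measurable_prod borel_measurable_const m)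
  also have "(\<lambda>U. real n * ((\<Prod>j\<in>{1..n} - {i}. rho n (0 - U i + U j))
      - (\<Prod>j\<in>{1..n} - {i}. rho n (real n - U i + U j)))) = Z n i"
    using assms by (simp add: Z_eq F_def fun_eq_iff)
  finally show ?thesis .
qed

text \<open>Measurability is read off from the product formula, which avoids the definite description in
\<open>q_cap\<close>.\<close>

lemma W_measurable:
  assumes n: "n \<ge> 2"
  shows "W n \<in> borel_measurable (lebesgue_Pi {1..n})"
proof -
  have "W n = (\<lambda>U. (\<Prod>i\<in>{1..n}. Z n i U) / (real n ^ n * gap_weight n U))"
    using n prod_Z[OF n] by (auto simp: gap_weight_def)
  moreover have "(\<lambda>U. (\<Prod>i\<in>{1..n}. Z n i U) / (real n ^ n * gap_weight n U))
      \<in> borel_measurable (lebesgue_Pi {1..n})"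
    using n
    by (intro borel_measurable_divide borel_measurable_prod borel_measurable_times borel_measurable_const
          Z_measurable gap_weight_measurable) auto
  ultimately show ?thesis by simp
qed

lemma AE_gap_law_nonneg: "AE y in gap_law n. \<forall>k\<in>{1..<n}. 0 \<le> y k"
proof -
  have m: "(\<lambda>y. \<Prod>k\<in>{1..<n}. ennreal (exponential_density (gap_rate n k) (y k))) \<in> borel_measurable (lebesgue_Pi {1..<n})"
    by (intro borel_measurable_prod_ennreal measurable_compose[OF coordinate_measurable]) auto
  have "(\<Prod>k\<in>{1..<n}. ennreal (exponential_density (gap_rate n k) (y k))) = 0" if "\<not> (\<forall>k\<in>{1..<n}. 0 \<le> y k)" for y
  proof -
    from that obtain k where "k \<in> {1..<n}" "y k < 0" by (auto simp: not_le)
    then show ?thesis by (intro prod_zero bexI[of _ k]) (auto simp: exponential_density_def)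
  qed
  then show ?thesis
    unfolding gap_law_eq_density AE_density[OF m] by (intro AE_I2) (metis less_irrefl)
qed

lemma expectation_W_deviation_le:
  assumes n: "n \<ge> 2"
  shows "(\<integral>U. \<bar>W n U - exp (- zeta 2)\<bar> \<partial>P_gap n)
    \<le> 6 * harmonic n / real n + sqrt (192 * harmonic n / real n) + 1 / (real n - 1)"
proof -
  have n': "n \<ge> 1" using n by simp
  interpret G: prob_space "gap_law n" by (rule prob_space_gap_law)
  define h where "h U = 3 * (osc n U / real n) + \<bar>spread n U - spread_mean n\<bar> + \<bar>spread_mean n - zeta 2\<bar>" for U
  define b where "b y = 3 * ((\<Sum>k\<in>{1..<n}. y k) / real n) + \<bar>spread n (gap_profile n y) - spread_mean n\<bar>
      + \<bar>spread_mean n - zeta 2\<bar>" for y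
  note [measurable] = osc_measurable[of n] spread_measurable[of n]
  have h_meas: "h \<in> borel_measurable (lebesgue_Pi {1..n})" unfolding h_def by measurable
  have h_inv: "translation_invariant n (\<lambda>U. ennreal (h U))" "permutation_invariant n (\<lambda>U. ennreal (h U))"
    using osc_translation_invariant[OF n'] osc_permutation_invariant[of n]
      pair_sum_translation_invariant[of n "\<lambda>t. t\<^sup>2"] pair_sum_permutation_invariant[of "\<lambda>t. t\<^sup>2" n]
    by (auto simp: translation_invariant_def permutation_invariant_def h_def spread_def)
  have b_int: "integrable (gap_law n) b"
    unfolding b_def using expectation_osc(1)[OF n] expectation_abs_spread_deviation_le(1)[OF n] by simp
  (* The gap profile is decreasing only if the gaps are nonnegative, which holds almost surely. *)
  have hb: "AE y in gap_law n. h (gap_profile n y) = b y"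
    using AE_gap_law_nonneg[of n] 

  proof eventually_elim
    case (elim y)
    then have "osc n (gap_profile n y) = (\<Sum>k\<in>{1..<n}. y k)"
      by (intro osc_gap_profile[OF n']) auto
    then show ?case by (simp only: h_def b_def)
  qed
  have h_nonneg: "0 \<le> h U" for U
    unfolding h_def using abs_diff_le_osc[of 1 n 1 U] n by auto
  have b_nonneg: "AE y in gap_law n. 0 \<le> b y"
    using hb by eventually_elim (metis h_nonneg)
  have "(\<integral>\<^sup>+U. ennreal \<bar>W n U - exp (- zeta 2)\<bar> \<partial>P_gap n) \<le> (\<integral>\<^sup>+U. ennreal (h U) \<partial>P_gap n)"
    unfolding h_def by (intro nn_integral_mono ennreal_leI W_deviation_le[OF n])
  also have "\<dots> = (\<integral>\<^sup>+y. ennreal (h (gap_profile n y)) \<partial>gap_law n)"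
    using h_meas by (intro nn_integral_P_gap[OF n' _ h_inv]) simp
  also have "\<dots> = (\<integral>\<^sup>+y. ennreal (b y) \<partial>gap_law n)"
    using hb by (intro nn_integral_cong_AE) auto
  also have "\<dots> = ennreal (\<integral>y. b y \<partial>gap_law n)"
    by (rule nn_integral_eq_integral[OF b_int b_nonneg])
  finally have le: "(\<integral>\<^sup>+U. ennreal \<bar>W n U - exp (- zeta 2)\<bar> \<partial>P_gap n) \<le> ennreal (\<integral>y. b y \<partial>gap_law n)" .
  have W_meas: "W n \<in> borel_measurable (P_gap n)"
    unfolding P_gap_def using measurable_H0_measure[OF W_measurable[OF n]] by simp
  have "(\<integral>U. \<bar>W n U - exp (- zeta 2)\<bar> \<partial>P_gap n) = enn2real (\<integral>\<^sup>+U. ennreal \<bar>W n U - exp (- zeta 2)\<bar> \<partial>P_gap n)"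
    using W_meas by (intro integral_eq_nn_integral) auto
  also have "\<dots> \<le> (\<integral>y. b y \<partial>gap_law n)"
    using le by (intro enn2real_leI integral_nonneg_AE b_nonneg)
  also have "\<dots> = 3 * (2 * harmonic n / real n)
      + (\<integral>y. \<bar>spread n (gap_profile n y) - spread_mean n\<bar> \<partial>gap_law n) + \<bar>spread_mean n - zeta 2\<bar>"
    unfolding b_def
    using expectation_osc[OF n] expectation_abs_spread_deviation_le(1)[OF n] G.prob_space by simp
  also have "\<dots> \<le> 3 * (2 * harmonic n / real n) + sqrt (192 * harmonic n / real n) + 1 / (real n - 1)"
    using expectation_abs_spread_deviation_le(2)[OF n] spread_mean_zeta[OF n] by (intro add_mono) auto
  finally show ?thesis by simp
qed

lemma harmonic_le:
  assumes "n \<ge> 2"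
  shows "harmonic n \<le> 1 + ln (real n)"
proof -
  have "harmonic (Suc m) \<le> 1 + ln (real m)" if "m \<ge> 1" for m
    using that
  proof (induction m rule: nat_induct_at_least)
    case (Suc m)
    have "1 / real (Suc m) \<le> ln (real (Suc m)) - ln (real m)"
    proof -
      have "ln (real m / real (Suc m)) \<le> real m / real (Suc m) - 1"
        using Suc.hyps by (intro ln_le_minus_one) auto
      also have "\<dots> = - 1 / real (Suc m)" by (simp add: field_simps)
      finally show ?thesis using Suc.hyps by (simp add: ln_div)
    qed
    then show ?case using Suc.IH by (simp add: harmonic_def)
  qed (simp add: harmonic_def)
  from this[of "n - 1"] assms have "harmonic n \<le> 1 + ln (real (n - 1))" by simp
  also have "\<dots> \<le> 1 + ln (real n)" using assms by simp
  finally show ?thesis .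
qed

section \<open>Joint laws with a common kernel\<close>

lemma semidirect_kernel_measurable:
  assumes [measurable]: "K \<in> measurable M (subprob_algebra N)"
  shows "(\<lambda>x. distr (K x) (M \<Otimes>\<^sub>M N) (Pair x)) \<in> measurable M (subprob_algebra (M \<Otimes>\<^sub>M N))"
  by (rule measurable_distr2[where M = N and L = M]) simp_all

lemma sets_semidirect:
  assumes "K \<in> measurable M (subprob_algebra N)" "space M \<noteq> {}"
  shows "sets (bind M (\<lambda>x. distr (K x) (M \<Otimes>\<^sub>M N) (Pair x))) = sets (M \<Otimes>\<^sub>M N)"
  using assms(2) by (intro sets_bind) simp

text \<open>Both sides give a set \<open>B\<close> the integral of \<open>f x * indicator B (x, y)\<close>, first over \<open>y\<close> against \<open>K x\<close> and
then over \<open>x\<close> against \<open>M\<close>.\<close>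

lemma density_semidirect:
  assumes K: "K \<in> measurable M (subprob_algebra N)" and ne: "space M \<noteq> {}"
    and f[measurable]: "f \<in> borel_measurable M"
  shows "bind (density M f) (\<lambda>x. distr (K x) (density M f \<Otimes>\<^sub>M N) (Pair x))
    = density (bind M (\<lambda>x. distr (K x) (M \<Otimes>\<^sub>M N) (Pair x))) (\<lambda>(x, y). f x)"
proof -
  let ?k = "\<lambda>x. distr (K x) (M \<Otimes>\<^sub>M N) (Pair x)"
  have k: "?k \<in> measurable M (subprob_algebra (M \<Otimes>\<^sub>M N))"
    using K by (rule semidirect_kernel_measurable)
  then have k': "?k \<in> measurable (density M f) (subprob_algebra (M \<Otimes>\<^sub>M N))"
    by simp
  have "bind (density M f) (\<lambda>x. distr (K x) (density M f \<Otimes>\<^sub>M N) (Pair x)) = bind (density M f) ?k"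
    by (intro bind_cong refl distr_cong sets_pair_measure_cong) auto
  also have "\<dots> = density (bind M ?k) (\<lambda>(x, y). f x)"
  proof (rule measure_eqI)
    show "sets (bind (density M f) ?k) = sets (density (bind M ?k) (\<lambda>(x, y). f x))"
      using ne by (simp add: sets_semidirect[OF K ne] sets_bind[of _ _ "M \<Otimes>\<^sub>M N"])
    fix B assume "B \<in> sets (bind (density M f) ?k)"
    then have B[measurable]: "B \<in> sets (M \<Otimes>\<^sub>M N)"
      using ne by (simp add: sets_bind[of _ _ "M \<Otimes>\<^sub>M N"])
    have fx: "(\<lambda>z. f (fst z)) \<in> borel_measurable (M \<Otimes>\<^sub>M N)" by measurable
    have "emeasure (bind (density M f) ?k) B = (\<integral>\<^sup>+x. emeasure (?k x) B \<partial>density M f)"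
      using ne k' B by (intro emeasure_bind) auto
    also have "\<dots> = (\<integral>\<^sup>+x. f x * emeasure (?k x) B \<partial>M)"
      using measurable_emeasure_kernel[OF k B] by (intro nn_integral_density) auto
    also have "\<dots> = (\<integral>\<^sup>+x. \<integral>\<^sup>+z. f (fst z) * indicator B z \<partial>?k x \<partial>M)"
    proof (rule nn_integral_cong)
      fix x assume x: "x \<in> space M"
      have Kx: "sets (K x) = sets N" using K x by (rule sets_kernel)
      have P: "Pair x \<in> measurable (K x) (M \<Otimes>\<^sub>M N)"
        using x by (simp add: measurable_cong_sets[OF Kx refl])
      have "(\<integral>\<^sup>+z. f (fst z) * indicator B z \<partial>?k x) = (\<integral>\<^sup>+y. f x * indicator B (x, y) \<partial>K x)"
        using P fx by (subst nn_integral_distr) auto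
      also have "\<dots> = (\<integral>\<^sup>+z. f x * indicator B z \<partial>?k x)"
        using P by (subst nn_integral_distr) auto
      also have "\<dots> = f x * emeasure (?k x) B"
        by (subst nn_integral_cmult_indicator) auto
      finally show "f x * emeasure (?k x) B = (\<integral>\<^sup>+z. f (fst z) * indicator B z \<partial>?k x)" by simp
    qed
    also have "\<dots> = (\<integral>\<^sup>+z. f (fst z) * indicator B z \<partial>bind M ?k)"
      using k fx by (intro nn_integral_bind[symmetric]) auto
    also have "\<dots> = emeasure (density (bind M ?k) (\<lambda>(x, y). f x)) B"
      using B fx sets_semidirect[OF K ne]
      by (subst emeasure_density) (simp_all add: split_beta' cong: measurable_cong_sets)
    finally show "emeasure (bind (density M f) ?k) B = emeasure (density (bind M ?k) (\<lambda>(x, y). f x)) B" .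
  qed
  finally show ?thesis .
qed

lemma distr_fst_semidirect:
  assumes K: "K \<in> measurable M (prob_algebra N)" and ne: "space M \<noteq> {}"
  shows "distr (bind M (\<lambda>x. distr (K x) (M \<Otimes>\<^sub>M N) (Pair x))) M fst = M"
proof -
  have K': "K \<in> measurable M (subprob_algebra N)" using K by (rule measurable_prob_algebraD)
  have "distr (bind M (\<lambda>x. distr (K x) (M \<Otimes>\<^sub>M N) (Pair x))) M fst
      = bind M (\<lambda>x. distr (distr (K x) (M \<Otimes>\<^sub>M N) (Pair x)) M fst)"
    by (rule distr_bind[OF semidirect_kernel_measurable[OF K'] ne]) simp
  also have "\<dots> = bind M (return M)"
  proof (intro bind_cong refl)
    fix x assume x: "x \<in> space M"
    then have Kx: "sets (K x) = sets N" "prob_space (K x)"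
      using K by (auto dest: measurable_space simp: space_prob_algebra)
    have P: "Pair x \<in> measurable (K x) (M \<Otimes>\<^sub>M N)"
      using x by (simp add: measurable_cong_sets[OF Kx(1) refl])
    have "distr (distr (K x) (M \<Otimes>\<^sub>M N) (Pair x)) M fst = distr (K x) M (\<lambda>_. x)"
      using P by (subst distr_distr) (auto simp: comp_def)
    also have "\<dots> = return M x" using x Kx(2) by (intro prob_space.distr_const) auto
    finally show "distr (distr (K x) (M \<Otimes>\<^sub>M N) (Pair x)) M fst = return M x" .
  qed
  also have "\<dots> = M" by (rule bind_return')
  finally show ?thesis .
qed

lemma sets_nu [simp]: "sets (nu n i U) = sets borel"
  by (simp add: nu_def)

text \<open>A positive value of the integral \<open>Z\<close> already forces integrability, since the integral of a
function that is not integrable is \<open>0\<close> by convention.\<close>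

lemma prob_space_nu: "prob_space (nu n i U)"
proof (cases "Z n i U > 0")
  case True
  let ?g = "\<lambda>a. indicator {- U i..real n - U i} a * (kappa n i U a * F n i U a)"
  have Z: "Z n i U = (\<integral>a. ?g a \<partial>lborel)"
    by (simp add: Z_def set_lebesgue_integral_def)
  have int: "integrable lborel ?g"
    using True not_integrable_integral_eq[of lborel ?g] unfolding Z by fastforce
  have "(\<integral>\<^sup>+a. ennreal (?g a / Z n i U) \<partial>lborel) = ennreal (\<integral>a. ?g a / Z n i U \<partial>lborel)"
    using int True kappa_F_nonneg[of n i U] by (intro nn_integral_eq_integral) auto
  also have "(\<integral>a. ?g a / Z n i U \<partial>lborel) = 1" using True by (simp flip: Z)
  finally have one: "(\<integral>\<^sup>+a. ennreal (?g a / Z n i U) \<partial>lborel) = 1" by simp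
  have "?g \<in> borel_measurable lborel" using int by (rule borel_measurable_integrable)
  then have m: "(\<lambda>a. ennreal (?g a / Z n i U)) \<in> borel_measurable lborel" by measurable
  have nu: "nu n i U = density lborel (\<lambda>a. ennreal (?g a / Z n i U))"
    using True by (simp add: nu_def)
  show ?thesis
    unfolding nu using one m by (intro prob_spaceI) (simp add: emeasure_density)
next
  case False
  then show ?thesis by (simp add: nu_def prob_space_return)
qed

lemma emeasure_nu_measurable:
  assumes n: "n \<ge> 1" and i: "i \<in> {1..n}" and X[measurable]: "X \<in> sets borel"
  shows "(\<lambda>U. emeasure (nu n i U) X) \<in> borel_measurable (lebesgue_Pi {1..n})"
proof -
  let ?L = "lebesgue_Pi {1..n}"
  let ?g = "\<lambda>U a. indicator {- U i..real n - U i} a * (kappa n i U a * F n i U a) / Z n i U"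
  note [measurable] = Z_measurable[OF n i]
  have co[measurable]: "(\<lambda>z. fst z j) \<in> borel_measurable (?L \<Otimes>\<^sub>M lborel)" if "j \<in> {1..n}" for j
    using coordinate_measurable[OF that] by measurable
  have ci: "(\<lambda>z. fst z i) \<in> borel_measurable (?L \<Otimes>\<^sub>M lborel)" using co i by blast
  have sum: "(\<lambda>z. snd z + fst z j) \<in> borel_measurable (?L \<Otimes>\<^sub>M lborel)" if "j \<in> {1..n} - {i}" for j
    using co[of j] that by (intro borel_measurable_add) auto
  have [measurable]: "(\<lambda>z. kappa n i (fst z) (snd z)) \<in> borel_measurable (?L \<Otimes>\<^sub>M lborel)"
    unfolding kappa_def by (intro borel_measurable_sum measurable_compose[OF sum omega_measurable])
  have [measurable]: "(\<lambda>z. F n i (fst z) (snd z)) \<in> borel_measurable (?L \<Otimes>\<^sub>M lborel)"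
    unfolding F_def by (intro borel_measurable_prod measurable_compose[OF sum rho_measurable])
  have [measurable]: "(\<lambda>z. indicator {- fst z i..real n - fst z i} (snd z) :: real) \<in> borel_measurable (?L \<Otimes>\<^sub>M lborel)"
  proof -
    have "(\<lambda>z. if - fst z i \<le> snd z \<and> snd z \<le> real n - fst z i then 1 else 0 :: real) \<in> borel_measurable (?L \<Otimes>\<^sub>M lborel)"
      using ci by measurable
    then show ?thesis by (simp add: indicator_def of_bool_def)
  qed
  have "(\<lambda>z. ennreal (?g (fst z) (snd z)) * indicator X (snd z)) \<in> borel_measurable (?L \<Otimes>\<^sub>M lborel)"
    by measurable
  then have "(\<lambda>U. \<integral>\<^sup>+a. ennreal (?g U a) * indicator X a \<partial>lborel) \<in> borel_measurable ?L"
    by (intro lborel.borel_measurable_nn_integral) (simp add: split_beta')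
  moreover have "(\<lambda>U. indicator X (- U i) :: ennreal) \<in> borel_measurable ?L"
    using coordinate_measurable[OF i] by measurable
  ultimately have meas: "(\<lambda>U. if Z n i U > 0 then \<integral>\<^sup>+a. ennreal (?g U a) * indicator X a \<partial>lborel else indicator X (- U i))
      \<in> borel_measurable ?L"
    by measurable
  have "emeasure (nu n i U) X
      = (if Z n i U > 0 then \<integral>\<^sup>+a. ennreal (?g U a) * indicator X a \<partial>lborel else indicator X (- U i))" for U
  proof -
    have [measurable]: "kappa n i U \<in> borel_measurable borel" "F n i U \<in> borel_measurable borel"
      unfolding kappa_def[abs_def] F_def[abs_def] by measurable
    show ?thesis by (simp add: nu_def emeasure_density)
  qed
  then show ?thesis using meas by simp
qed

lemma kernel_nu_measurable:
  assumes n: "n \<ge> 1" and M: "sets M = sets (H0_measure n)"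
  shows "(\<lambda>U. PiM {1..n} (\<lambda>i. nu n i U)) \<in> measurable M (prob_algebra (Rn_borel n))"
proof (rule measurable_prob_algebra_generated[where \<Omega> = "\<Pi>\<^sub>E i\<in>{1..n}. UNIV"
      and G = "{Pi\<^sub>E {1..n} X | X. \<forall>i\<in>{1..n}. X i \<in> sets borel}"])
  have "prod_algebra {1..n} (\<lambda>_. borel :: real measure) = {Pi\<^sub>E {1..n} X | X. \<forall>i\<in>{1..n}. X i \<in> sets borel}"
    by (subst prod_algebra_eq_finite) (auto simp: Pi_iff)
  then show "sets (Rn_borel n) = sigma_sets (\<Pi>\<^sub>E i\<in>{1..n}. UNIV) {Pi\<^sub>E {1..n} X | X. \<forall>i\<in>{1..n}. X i \<in> sets borel}"
    unfolding Rn_borel_def sets_PiM by simp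
  show "Int_stable {Pi\<^sub>E {1..n} X | X. \<forall>i\<in>{1..n}. X i \<in> sets (borel :: real measure)}"
    by (rule Int_stable_PiE)
  show "{Pi\<^sub>E {1..n} X | X. \<forall>i\<in>{1..n}. X i \<in> sets borel} \<subseteq> Pow (\<Pi>\<^sub>E i\<in>{1..n}. UNIV :: real set)"
    by auto
  fix U
  show "prob_space (PiM {1..n} (\<lambda>i. nu n i U))" by (intro prob_space_PiM prob_space_nu)
  show "sets (PiM {1..n} (\<lambda>i. nu n i U)) = sets (Rn_borel n)"
    unfolding Rn_borel_def by (intro sets_PiM_cong) auto
next
  fix B assume "B \<in> {Pi\<^sub>E {1..n} X | X. \<forall>i\<in>{1..n}. X i \<in> sets (borel :: real measure)}"
  then obtain X where X: "B = Pi\<^sub>E {1..n} X" "\<And>i. i \<in> {1..n} \<Longrightarrow> X i \<in> sets borel" by blast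
  have "emeasure (PiM {1..n} (\<lambda>i. nu n i U)) B = (\<Prod>i\<in>{1..n}. emeasure (nu n i U) (X i))" for U
  proof -
    interpret product_sigma_finite "\<lambda>i. nu n i U"
      by (intro product_sigma_finite.intro prob_space_imp_sigma_finite prob_space_nu)
    show ?thesis unfolding X(1) using X(2) by (intro emeasure_PiM) auto
  qed
  moreover have "(\<lambda>U. \<Prod>i\<in>{1..n}. emeasure (nu n i U) (X i)) \<in> borel_measurable (H0_measure n)"
    using X(2) n by (intro measurable_H0_measure borel_measurable_prod_ennreal emeasure_nu_measurable) auto
  ultimately show "(\<lambda>U. emeasure (PiM {1..n} (\<lambda>i. nu n i U)) B) \<in> borel_measurable M"
    by (simp add: measurable_cong_sets[OF M refl])
qed

lemma joint_law_density:
  assumes n: "n \<ge> 1" and M: "sets M = sets (H0_measure n)" "space M \<noteq> {}"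
    and f: "f \<in> borel_measurable M"
  shows "joint_law n (density M f) = density (joint_law n M) (\<lambda>(U, A). f U)"
  unfolding joint_law_def
  using kernel_nu_measurable[OF n M(1)] M(2) f by (intro density_semidirect measurable_prob_algebraD)

lemma distr_fst_joint_law:
  assumes n: "n \<ge> 1" and M: "sets M = sets (H0_measure n)" "space M \<noteq> {}"
  shows "distr (joint_law n M) M fst = M"
  unfolding joint_law_def using kernel_nu_measurable[OF n M(1)] M(2) by (rule distr_fst_semidirect)

lemma sets_joint_law:
  assumes n: "n \<ge> 1" and M: "sets M = sets (H0_measure n)" "space M \<noteq> {}"
  shows "sets (joint_law n M) = sets (M \<Otimes>\<^sub>M Rn_borel n)"
  unfolding joint_law_def using kernel_nu_measurable[OF n M(1)] M(2)
  by (intro sets_semidirect measurable_prob_algebraD)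

lemma prob_space_joint_law:
  assumes n: "n \<ge> 1" and M: "sets M = sets (H0_measure n)" "prob_space M"
  shows "prob_space (joint_law n M)"
proof -
  have ne: "space M \<noteq> {}" using M(2) by (rule prob_space.not_empty)
  have "prob_space (distr (joint_law n M) M fst)"
    using distr_fst_joint_law[OF n M(1) ne] M(2) by simp
  moreover have "fst \<in> measurable (joint_law n M) M"
    by (simp add: measurable_cong_sets[OF sets_joint_law[OF n M(1) ne] refl])
  ultimately show ?thesis by (intro prob_space_distrD[where f = fst and N = M])
qed

lemma gap_weight_pos: "gap_weight n U > 0"
  by (simp add: gap_weight_def)

lemma sets_P_gap: "sets (P_gap n) = sets (H0_measure n)"
  by (simp add: P_gap_def)

lemma W_measurable_P_gap:
  assumes "n \<ge> 2"
  shows "W n \<in> borel_measurable (P_gap n)"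
  unfolding P_gap_def using measurable_H0_measure[OF W_measurable[OF assms]] by simp

lemma W_integrable:
  assumes n: "n \<ge> 2"
  shows "integrable (P_gap n) (W n)"
proof -
  interpret prob_space "P_gap n" using n by (intro prob_space_P_gap) simp
  show ?thesis
    using W_bounds[OF n] W_measurable_P_gap[OF n] by (intro integrable_const_bound[where B = 1]) auto
qed

lemma W_bar_deviation_le:
  assumes n: "n \<ge> 2"
  shows "\<bar>W_bar n - c\<bar> \<le> (\<integral>U. \<bar>W n U - c\<bar> \<partial>P_gap n)"
proof -
  interpret prob_space "P_gap n" using n by (intro prob_space_P_gap) simp
  have "\<bar>W_bar n - c\<bar> = \<bar>\<integral>U. W n U - c \<partial>P_gap n\<bar>"
    unfolding W_bar_def using W_integrable[OF n] prob_space by simp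
  also have "\<dots> \<le> (\<integral>U. \<bar>W n U - c\<bar> \<partial>P_gap n)" by (rule integral_abs_bound)
  finally show ?thesis .
qed

lemma Z_ad_eq:
  assumes n: "n \<ge> 2"
  shows "Z_ad n = real n ^ n * (Z_gap n * W_bar n)"
proof -
  have Zg: "Z_gap n > 0" using n by (intro Z_gap_eq) simp
  have "W_bar n = (\<integral>U. gap_weight n U / Z_gap n * W n U \<partial>H0_measure n)"
    unfolding W_bar_def P_gap_def
    using measurable_H0_measure[OF W_measurable[OF n]] Zg
    by (subst integral_density) (auto simp: gap_weight_pos less_imp_le)
  also have "\<dots> = (\<integral>U. gap_weight n U * W n U \<partial>H0_measure n) / Z_gap n"
    by simp
  finally have "(\<integral>U. gap_weight n U * W n U \<partial>H0_measure n) = Z_gap n * W_bar n"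
    using Zg by simp
  then show ?thesis unfolding Z_ad_def prod_Z[OF n] by simp
qed

text \<open>By the product formula the two \<open>U\<close>-marginals differ by the factor \<open>W / W_bar\<close>, and both joint laws
attach the same kernel.\<close>

lemma P_ad_density:
  assumes n: "n \<ge> 2"
  shows "P_ad n = density (P_ref n) (\<lambda>(U, A). ennreal (W n U / W_bar n))"
proof -
  have n': "n \<ge> 1" using n by simp
  have Zg: "Z_gap n > 0" using n' by (rule Z_gap_eq)
  have Wb: "W_bar n \<ge> 0" unfolding W_bar_def using W_bounds[OF n] by (intro Bochner_Integration.integral_nonneg)
  have meas: "(\<lambda>U. ennreal (W n U / W_bar n)) \<in> borel_measurable (P_gap n)"
    using W_measurable_P_gap[OF n] by measurable
  have "density (H0_measure n) (\<lambda>U. ennreal ((\<Prod>i\<in>{1..n}. Z n i U) / Z_ad n))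
      = density (P_gap n) (\<lambda>U. ennreal (W n U / W_bar n))"
  proof -
    have "(\<Prod>i\<in>{1..n}. Z n i U) / Z_ad n = gap_weight n U / Z_gap n * (W n U / W_bar n)" for U
      unfolding prod_Z[OF n] Z_ad_eq[OF n] using n by simp
    then have "ennreal ((\<Prod>i\<in>{1..n}. Z n i U) / Z_ad n)
        = ennreal (gap_weight n U / Z_gap n) * ennreal (W n U / W_bar n)" for U
      using Zg Wb W_bounds[OF n, of U] by (simp only:) (intro ennreal_mult, auto simp: gap_weight_pos less_imp_le)
    then show ?thesis
      unfolding P_gap_def using meas[unfolded P_gap_def] by (simp add: density_density_eq)
  qed
  moreover have "joint_law n (density (P_gap n) (\<lambda>U. ennreal (W n U / W_bar n)))
      = density (P_ref n) (\<lambda>(U, A). ennreal (W n U / W_bar n))"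
    unfolding P_ref_def
    using prob_space.not_empty[OF prob_space_P_gap[OF n']] meas
    by (intro joint_law_density[OF n' sets_P_gap])
  ultimately show ?thesis by (simp add: P_ad_def)
qed

lemma prob_space_P_ref:
  assumes "n \<ge> 1"
  shows "prob_space (P_ref n)"
  unfolding P_ref_def using assms by (intro prob_space_joint_law sets_P_gap prob_space_P_gap)

lemma fst_measurable_P_ref:
  assumes n: "n \<ge> 1"
  shows "fst \<in> measurable (P_ref n) (P_gap n)"
  unfolding P_ref_def
    measurable_cong_sets[OF sets_joint_law[OF n sets_P_gap prob_space.not_empty[OF prob_space_P_gap[OF n]]] refl]
  by simp

lemma RN_deriv_P_ad:
  assumes n: "n \<ge> 2"
  shows "AE (U, A) in P_ref n. RN_deriv (P_ref n) (P_ad n) (U, A) = ennreal (W n U / W_bar n)"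
proof -
  have n': "n \<ge> 1" using n by simp
  interpret prob_space "P_ref n" using n' by (rule prob_space_P_ref)
  have "(\<lambda>z. ennreal (W n (fst z) / W_bar n)) \<in> borel_measurable (P_ref n)"
    using measurable_compose[OF fst_measurable_P_ref[OF n'] W_measurable_P_gap[OF n]] by measurable
  then have "AE z in P_ref n. (\<lambda>(U, A). ennreal (W n U / W_bar n)) z = RN_deriv (P_ref n) (P_ad n) z"
    by (intro RN_deriv_unique P_ad_density[OF n, symmetric]) (simp add: split_beta')
  then show ?thesis by eventually_elim auto
qed

text \<open>The density depends on \<open>U\<close> alone, so the distance is at most the \<open>L\<^sup>1\<close> distance of \<open>W / W_bar\<close> from
\<open>1\<close> under the gap law.  Replacing \<open>W_bar\<close> by another constant \<open>c\<close> costs a factor \<open>2\<close>.\<close>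

lemma tv_dist_P_ad_P_ref_le:
  assumes n: "n \<ge> 2" and Wb: "W_bar n > 0"
  shows "0 \<le> tv_dist (P_ad n) (P_ref n)"
    and "tv_dist (P_ad n) (P_ref n) \<le> 2 * (\<integral>U. \<bar>W n U - c\<bar> \<partial>P_gap n) / W_bar n"
proof -
  have n': "n \<ge> 1" using n by simp
  interpret G: prob_space "P_gap n" using n' by (rule prob_space_P_gap)
  interpret P: prob_space "P_ref n" using n' by (rule prob_space_P_ref)
  let ?w = "\<lambda>U. W n U / W_bar n"
  let ?D = "\<integral>U. \<bar>?w U - 1\<bar> \<partial>P_gap n"
  note fst_m = fst_measurable_P_ref[OF n']
  have w_int: "integrable (P_gap n) ?w" using W_integrable[OF n] by simp
  have marginal: "distr (P_ref n) (P_gap n) fst = P_gap n"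
    unfolding P_ref_def by (intro distr_fst_joint_law n' sets_P_gap G.not_empty)
  have lift_int: "integrable (P_ref n) (\<lambda>z. f (fst z))" "(\<integral>z. f (fst z) \<partial>P_ref n) = (\<integral>U. f U \<partial>P_gap n)"
    if f: "integrable (P_gap n) f" for f :: "(nat \<Rightarrow> real) \<Rightarrow> real"
  proof -
    have m: "f \<in> borel_measurable (P_gap n)" using f by (rule borel_measurable_integrable)
    show "integrable (P_ref n) (\<lambda>z. f (fst z))"
      using f integrable_distr_eq[OF fst_m m] by (simp add: marginal)
    show "(\<integral>z. f (fst z) \<partial>P_ref n) = (\<integral>U. f U \<partial>P_gap n)"
      using integral_distr[OF fst_m m] by (simp add: marginal)
  qed
  have w_ref: "integrable (P_ref n) (\<lambda>z. ?w (fst z))" using w_int by (rule lift_int)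
  have bound: "\<bar>measure (P_ad n) B - measure (P_ref n) B\<bar> \<le> ?D" if B: "B \<in> sets (P_ad n)" for B
  proof -
    have B'[measurable]: "B \<in> sets (P_ref n)" using B by (simp add: P_ad_density[OF n])
    have "measure (P_ad n) B = (\<integral>z. indicator B z \<partial>P_ad n)"
      using B sets.sets_into_space[OF B] by (simp add: Int_absorb2)
    also have "\<dots> = (\<integral>z. ?w (fst z) *\<^sub>R indicator B z \<partial>P_ref n)"
      unfolding P_ad_density[OF n] split_beta'
      using w_ref W_bounds[OF n] Wb by (intro integral_density) auto
    finally have ad: "measure (P_ad n) B = (\<integral>z. ?w (fst z) * indicator B z \<partial>P_ref n)" by simp
    have ref: "measure (P_ref n) B = (\<integral>z. indicator B z \<partial>P_ref n)"
      using B' sets.sets_into_space[OF B'] by (simp add: Int_absorb2)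
    have int1: "integrable (P_ref n) (\<lambda>z. ?w (fst z) * indicator B z)"
      using integrable_mult_indicator[OF B' w_ref] by (simp add: mult.commute)
    have int2: "integrable (P_ref n) (\<lambda>z. indicator B z :: real)"
      by (intro integrable_real_indicator B') (simp add: P.emeasure_eq_measure)
    have "\<bar>measure (P_ad n) B - measure (P_ref n) B\<bar> = \<bar>\<integral>z. ?w (fst z) * indicator B z - indicator B z \<partial>P_ref n\<bar>"
      unfolding ad ref using int1 int2 by simp
    also have "\<dots> \<le> (\<integral>z. \<bar>?w (fst z) * indicator B z - indicator B z\<bar> \<partial>P_ref n)"
      by (rule integral_abs_bound)
    also have "\<dots> \<le> (\<integral>z. \<bar>?w (fst z) - 1\<bar> \<partial>P_ref n)"
      using int1 int2 w_ref by (intro integral_mono) (auto split: split_indicator)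
    also have "\<dots> = ?D"
    proof (rule lift_int(2))
      show "integrable (P_gap n) (\<lambda>U. \<bar>?w U - 1\<bar>)" using w_int by simp
    qed
    finally show ?thesis .
  qed
  have "\<bar>measure (P_ad n) {} - measure (P_ref n) {}\<bar> \<le> tv_dist (P_ad n) (P_ref n)"
    unfolding tv_dist_def using bound by (intro cSUP_upper bdd_aboveI2[where M = ?D]) auto
  then show "0 \<le> tv_dist (P_ad n) (P_ref n)" by simp
  have "tv_dist (P_ad n) (P_ref n) \<le> ?D"
    unfolding tv_dist_def using bound by (intro cSUP_least) auto
  also have "?D = (\<integral>U. \<bar>W n U - W_bar n\<bar> \<partial>P_gap n) / W_bar n"
  proof -
    have "\<bar>?w U - 1\<bar> = \<bar>W n U - W_bar n\<bar> / W_bar n" for U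
    proof -
      have "?w U - 1 = (W n U - W_bar n) / W_bar n" using Wb by (simp add: field_simps)
      then show ?thesis using Wb by simp
    qed
    then show ?thesis by simp
  qed
  also have "\<dots> \<le> 2 * (\<integral>U. \<bar>W n U - c\<bar> \<partial>P_gap n) / W_bar n"
  proof -
    note W_int = W_integrable[OF n]
    note b = W_bar_deviation_le[OF n, of c]
    have "(\<integral>U. \<bar>W n U - W_bar n\<bar> \<partial>P_gap n) \<le> (\<integral>U. \<bar>W n U - c\<bar> + \<bar>W_bar n - c\<bar> \<partial>P_gap n)"
      using W_int by (intro integral_mono) auto
    also have "\<dots> = (\<integral>U. \<bar>W n U - c\<bar> \<partial>P_gap n) + \<bar>W_bar n - c\<bar>"
      using W_int G.prob_space by simp
    finally show ?thesis using b Wb by (intro divide_right_mono) auto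
  qed
  finally show "tv_dist (P_ad n) (P_ref n) \<le> 2 * (\<integral>U. \<bar>W n U - c\<bar> \<partial>P_gap n) / W_bar n" .
qed

section \<open>Rates of convergence\<close>

lemma expectation_W_deviation_rate:
  assumes n: "n \<ge> 3"
  shows "(\<integral>U. \<bar>W n U - exp (- zeta 2)\<bar> \<partial>P_gap n) \<le> 34 * sqrt (ln (real n) / real n)"
proof -
  define L where "L = ln (real n) / real n"
  (* From n = 3 on, ln n >= 1; this lets ln n / n absorb 1 / n. *)
  have "exp 1 \<le> real n" using exp_le n by linarith
  then have ln: "1 \<le> ln (real n)" using n by (subst ln_ge_iff) auto
  have "ln (real n) \<le> real n" using n ln_le_minus_one[of "real n"] by simp
  then have L: "0 \<le> L" "L \<le> 1" using ln n by (auto simp: L_def)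
  then have sq: "L \<le> sqrt L"
    using mult_left_le[of "sqrt L" "sqrt L"] by (simp add: real_sqrt_le_1_iff)
  have H: "harmonic n / real n \<le> 2 * L"
    using harmonic_le[of n] ln n by (simp add: L_def divide_right_mono)
  have H1: "6 * harmonic n / real n \<le> 12 * sqrt L" using H sq by simp
  have "192 * harmonic n / real n \<le> 20\<^sup>2 * L" using H L by simp
  then have "sqrt (192 * harmonic n / real n) \<le> sqrt (20\<^sup>2 * L)" by (rule real_sqrt_le_mono)
  also have "\<dots> = 20 * sqrt L" by (simp only: real_sqrt_mult real_sqrt_abs)
  finally have H2: "sqrt (192 * harmonic n / real n) \<le> 20 * sqrt L" .
  have "1 / (real n - 1) \<le> 2 / real n" using n by (simp add: field_simps)
  also have "\<dots> \<le> 2 * L" using ln n by (simp add: L_def divide_right_mono)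
  finally have "1 / (real n - 1) \<le> 2 * sqrt L" using sq by simp
  with H1 H2 expectation_W_deviation_le[of n] n show ?thesis unfolding L_def by linarith
qed

theorem proposition3p5:
  shows "(\<lambda>n. \<integral>U. \<bar>W n U - exp (- zeta 2)\<bar> \<partial>P_gap n) \<in> O(\<lambda>n. sqrt (ln (real n) / real n))
    \<and> W_bar \<longlonglongrightarrow> exp (- zeta 2)
    \<and> (\<forall>n\<ge>2. P_ad n = density (P_ref n) (\<lambda>(U, A). ennreal (W n U / W_bar n))
           \<and> (AE (U, A) in P_ref n. RN_deriv (P_ref n) (P_ad n) (U, A) = ennreal (W n U / W_bar n)))
    \<and> (\<lambda>n. tv_dist (P_ad n) (P_ref n)) \<in> O(\<lambda>n. sqrt (ln (real n) / real n))
    \<and> (\<forall>\<^sub>F n in sequentially. \<forall>U\<in>H0 n. W n U / W_bar n \<le> 2 * exp (zeta 2))"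
proof -
  let ?c = "exp (- zeta 2)" and ?s = "\<lambda>n. sqrt (ln (real n) / real n)"
  let ?e = "\<lambda>n. \<integral>U. \<bar>W n U - ?c\<bar> \<partial>P_gap n"
  have e_nonneg: "0 \<le> ?e n" for n by (intro Bochner_Integration.integral_nonneg) simp
  have e_le: "\<forall>\<^sub>F n in sequentially. ?e n \<le> 34 * ?s n"
    using eventually_ge_at_top[of 3] by eventually_elim (rule expectation_W_deviation_rate)
  have e_bigo: "?e \<in> O(?s)"
  proof (rule bigoI)
    show "\<forall>\<^sub>F n in sequentially. norm (?e n) \<le> 34 * norm (?s n)"
      using e_le
    proof eventually_elim
      case (elim n)
      then show ?case using e_nonneg[of n] abs_ge_self[of "?s n"] by (simp only: real_norm_def abs_of_nonneg)
    qed
  qed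
  have "(\<lambda>n. 34 * ?s n) \<longlonglongrightarrow> 34 * sqrt 0"
    by (intro tendsto_mult tendsto_const tendsto_real_sqrt lim_ln_over_n)
  then have s_lim: "(\<lambda>n. 34 * ?s n) \<longlonglongrightarrow> 0" by simp
  have "\<forall>\<^sub>F n in sequentially. norm (W_bar n - ?c) \<le> 34 * ?s n"
    using e_le eventually_ge_at_top[of 2]
  proof eventually_elim
    case (elim n)
    then show ?case using W_bar_deviation_le[of n ?c] by simp
  qed
  then have "(\<lambda>n. W_bar n - ?c) \<longlonglongrightarrow> 0" using s_lim by (rule Lim_null_comparison)
  then have lim: "W_bar \<longlonglongrightarrow> ?c" by (rule LIM_zero_cancel)
  have W_bar_ge: "\<forall>\<^sub>F n in sequentially. ?c / 2 < W_bar n"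
    using lim by (rule order_tendstoD) simp
  have density_le: "\<forall>\<^sub>F n in sequentially. \<forall>U\<in>H0 n. W n U / W_bar n \<le> 2 * exp (zeta 2)"
    using W_bar_ge eventually_ge_at_top[of 2]
  proof eventually_elim
    case (elim n)
    have half: "1 / (?c / 2) = 2 * exp (zeta 2)" by (simp only: exp_minus inverse_eq_divide) simp
    have "W n U / W_bar n \<le> 1 / (?c / 2)" for U
    proof (rule frac_le)
      show "W n U \<le> 1" using elim(2) by (rule W_bounds)
    qed (use elim in auto)
    then show ?case unfolding half by blast
  qed
  have "\<forall>\<^sub>F n in sequentially. norm (tv_dist (P_ad n) (P_ref n)) \<le> 4 / ?c * norm (?e n)"
    using W_bar_ge eventually_ge_at_top[of 2]
  proof eventually_elim
    case (elim n)
    have pos: "W_bar n > 0" using elim(1) exp_gt_zero[of "- zeta 2"] by linarith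
    have "tv_dist (P_ad n) (P_ref n) \<le> 2 * ?e n / W_bar n"
      by (rule tv_dist_P_ad_P_ref_le(2)[OF elim(2) pos])
    also have "\<dots> \<le> 2 * ?e n / (?c / 2)"
    proof (rule divide_left_mono)
      show "?c / 2 \<le> W_bar n" using elim(1) by simp
      show "0 \<le> 2 * ?e n" using e_nonneg[of n] by simp
      show "0 < W_bar n * (?c / 2)" using pos by simp
    qed
    finally show ?case
      using tv_dist_P_ad_P_ref_le(1)[OF elim(2) pos] e_nonneg[of n] by simp
  qed
  then have "(\<lambda>n. tv_dist (P_ad n) (P_ref n)) \<in> O(?e)" by (rule bigoI)
  then have tv: "(\<lambda>n. tv_dist (P_ad n) (P_ref n)) \<in> O(?s)"
    using e_bigo by (rule landau_o.big_trans)
  show ?thesis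
    using P_ad_density RN_deriv_P_ad by (intro conjI allI impI e_bigo lim tv density_le)
qed

end
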